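(* Let $1\le k\le n-1$ be integers, let $m$ be a positive integer and let $p_i,\alpha_i$, $i=1,\dots,m$, be real numbers with $p_i\neq 0$. Let $f_i$ be bounded functions on $\mathbb{R}^n$ with $f_i\in L^{p_i}(\mathbb{R}^n)$, $i=1,\dots,m$. Define $$ \tilde I(f_1,\dots,f_m)=\int_{M_{n,k}}\prod_{i=1}^m\big\|f_i|_F\big\|_{p_i}^{\alpha_i}\,d\nu_{n,k}(F). $$ If this quantity is finite and $\sum_{i=1}^m\frac{\alpha_i}{p_i}=n+1$, then for every volume-preserving affine transformation $g$ of $\mathbb{R}^n$, $$ \tilde I(g\cdot f_1,\dots,g\cdot f_m)=\tilde I(f_1,\dots,f_m), $$ where $(g\cdot f_i)(t)=f_i(g^{-1}t)$.
   Context: $M_{n,k}$ is the affine Grassmannian of $k$-dimensional affine subspaces of $\mathbb{R}^n$ with the measure $\nu_{n,k}(A)=\int_{G_{n,k}}|\{x\in E^\perp: x+E\in A\}|\,d\mu_{n,k}(E)$, where $G_{n,k}$ is the Grassmannian of $k$-dimensional linear subspaces with Haar probability measure $\mu_{n,k}$ and $|\cdot|$ is Lebesgue measure on $E^\perp$. For $F\in M_{n,k}$, $f|_F$ is the restriction of $f$ to $F$ and $\|f|_F\|_p=\left(\int_F|f(t)|^p\,dt\right)^{1/p}$ with respect to $k$-dimensional Lebesgue measure on $F$. When a factor is $0$ with a negative exponent it is read as $+\infty$, with $0\cdot\infty=0$. *)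

theory Defs
  imports "HOL-Analysis.Analysis" "HOL-Probability.Probability_Measure"
begin

text \<open>Real powers on \<open>[0, \<infinity>]\<close>. As \<open>powr\<close> on the reals has \<open>0 powr a = 0\<close> for every \<open>a\<close>, the
  value \<open>0\<^sup>a = \<infinity>\<close> for \<open>a < 0\<close> has to be set explicitly; \<open>0 * \<infinity> = 0\<close> already holds in \<open>ennreal\<close>.\<close>

definition ennpowr :: "ennreal \<Rightarrow> real \<Rightarrow> ennreal" where
  "ennpowr x a =
    (if a = 0 then 1
     else if x = 0 then (if a > 0 then 0 else \<infinity>)
     else if x = \<infinity> then (if a > 0 then \<infinity> else 0)
     else ennreal (enn2real x powr a))"

definition grassmannian :: "nat \<Rightarrow> 'a::euclidean_space set set" where
  "grassmannian k = {E. subspace E \<and> dim E = k}"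

definition affine_grassmannian :: "nat \<Rightarrow> 'a::euclidean_space set set" where
  "affine_grassmannian k = {F. affine F \<and> aff_dim F = int k}"

definition direction :: "'a::euclidean_space set \<Rightarrow> 'a set" where
  "direction F = {x - y |x y. x \<in> F \<and> y \<in> F}"

text \<open>For a linear subspace \<open>E\<close>, \<open>closest_point E\<close> is the orthogonal projection onto \<open>E\<close>. The
  \<open>\<sigma>\<close>-algebras below are the Borel \<open>\<sigma>\<close>-algebras of the usual topologies on the two Grassmannians:
  \<open>E\<close> is identified with the matrix of its orthogonal projection, and \<open>F = x + E\<close> with
  \<open>x \<in> E\<^sup>\<bottom>\<close> is identified with the pair of the projection matrix of \<open>E\<close> and the vector
  \<open>x = closest_point F 0\<close>.\<close>

definition grassmannian_borel :: "nat \<Rightarrow> (real ^ 'n) set measure" where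
  "grassmannian_borel k =
    vimage_algebra (grassmannian k) (\<lambda>E. matrix (closest_point E)) borel"

definition affine_grassmannian_borel :: "nat \<Rightarrow> (real ^ 'n) set measure" where
  "affine_grassmannian_borel k =
    vimage_algebra (affine_grassmannian k)
      (\<lambda>F. (matrix (closest_point (direction F)), closest_point F 0)) borel"

text \<open>The Haar probability measure on the Grassmannian: the (unique) Borel probability measure
  invariant under the action of the orthogonal group.\<close>

definition grassmannian_haar :: "nat \<Rightarrow> (real ^ 'n) set measure \<Rightarrow> bool" where
  "grassmannian_haar k \<mu> \<longleftrightarrow>
     prob_space \<mu> \<and> sets \<mu> = sets (grassmannian_borel k) \<and>
     (\<forall>h. orthogonal_transformation h \<longrightarrow> distr \<mu> \<mu> (\<lambda>E. h ` E) = \<mu>)"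

definition orthonormal_basis :: "'a::euclidean_space set \<Rightarrow> 'a set \<Rightarrow> bool" where
  "orthonormal_basis S B \<longleftrightarrow> pairwise orthogonal B \<and> (\<forall>b\<in>B. norm b = 1) \<and> span B = S"

lemma orthonormal_basis_exists: "subspace S \<Longrightarrow> \<exists>B. orthonormal_basis S B"
  unfolding orthonormal_basis_def by (metis orthonormal_basis_subspace)

text \<open>Lebesgue measure on an affine subspace \<open>F\<close>, of dimension that of \<open>F\<close>, regarded as a Borel
  measure on the whole space concentrated on \<open>F\<close>. It is transported from coordinates with respect
  to an orthonormal basis of the direction of \<open>F\<close>, as \<open>lborel\<close> itself is from \<open>Basis\<close>; it does
  not depend on the orthonormal basis or on the base point in \<open>F\<close>.\<close>

definition flat_lborel :: "'a::euclidean_space set \<Rightarrow> 'a measure" where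
  "flat_lborel F =
    (let B = (SOME B. orthonormal_basis (direction F) B)
     in distr (\<Pi>\<^sub>M b\<in>B. (lborel :: real measure)) borel
          (\<lambda>c. closest_point F 0 + (\<Sum>b\<in>B. c b *\<^sub>R b)))"

definition affine_grassmannian_measure ::
    "nat \<Rightarrow> (real ^ 'n) set measure \<Rightarrow> (real ^ 'n) set measure" where
  "affine_grassmannian_measure k \<mu> =
    measure_of (affine_grassmannian k) (sets (affine_grassmannian_borel k))
      (\<lambda>A. \<integral>\<^sup>+ E. emeasure (flat_lborel (E\<^sup>\<bottom>)) {x \<in> E\<^sup>\<bottom>. (\<lambda>y. x + y) ` E \<in> A} \<partial>\<mu>)"

definition p_norm :: "'a measure \<Rightarrow> real \<Rightarrow> ('a \<Rightarrow> real) \<Rightarrow> ennreal" where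
  "p_norm M p f = ennpowr (\<integral>\<^sup>+ t. ennpowr (ennreal \<bar>f t\<bar>) p \<partial>M) (1 / p)"

definition in_Lp :: "real \<Rightarrow> ('a::euclidean_space \<Rightarrow> real) \<Rightarrow> bool" where
  "in_Lp p f \<longleftrightarrow>
     f \<in> borel_measurable lebesgue \<and> (\<integral>\<^sup>+ t. ennpowr (ennreal \<bar>f t\<bar>) p \<partial>lebesgue) < \<infinity>"

definition I_tilde ::
    "nat \<Rightarrow> (real ^ 'n) set measure \<Rightarrow> nat \<Rightarrow> (nat \<Rightarrow> real) \<Rightarrow> (nat \<Rightarrow> real) \<Rightarrow>
     (nat \<Rightarrow> real ^ 'n \<Rightarrow> real) \<Rightarrow> ennreal" where
  "I_tilde k \<mu> m p \<alpha> f =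
    (\<integral>\<^sup>+ F. (\<Prod>i\<in>{1..m}. ennpowr (p_norm (flat_lborel F) (p i) (f i)) (\<alpha> i))
       \<partial>affine_grassmannian_measure k \<mu>)"

definition volume_preserving_affine :: "('a::euclidean_space \<Rightarrow> 'a) \<Rightarrow> bool" where
  "volume_preserving_affine g \<longleftrightarrow>
     (\<exists>L b. linear L \<and> g = (\<lambda>x. L x + b)) \<and> bij g \<and>
     (\<forall>A\<in>sets lebesgue. emeasure lebesgue (g ` A) = emeasure lebesgue A)"

end

theory Submission
  imports Defs "HOL-Probability.Distributions"
begin

text \<open>
  Let \<open>J(E)\<close> be the volume distortion on \<open>E\<close> of the linear part \<open>L\<close> of \<open>g\<close>. Since
  \<open>\<parallel>f \<circ> g\<^sup>-\<^sup>1\<parallel>\<^sub>p\<close> on \<open>g F\<close> is \<open>J(E)\<^bsup>1/p\<^esup>\<close> times \<open>\<parallel>f\<parallel>\<^sub>p\<close> on \<open>F = x + E\<close>, the integrand picks up the factor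
  \<open>J(E)\<^bsup>n+1\<^esup>\<close>, and it remains to show that \<open>F \<mapsto> g F\<close> changes the measure on flats by the factor \<open>J(E)\<^bsup>-(n+1)\<^esup>\<close>.
  One factor \<open>1/J(E)\<close> comes from the map induced between the orthogonal complements of \<open>E\<close> and \<open>L E\<close>.
  The factor \<open>J(E)\<^bsup>-n\<^esup>\<close> on the Grassmannian amounts to the invariance, under \<open>A \<mapsto> A L\<^sup>T\<close>, of the measure
  \<open>\<Lambda> = \<integral> \<lambda>\<^sub>E d\<mu>(E)\<close> on \<open>n \<times> n\<close> matrices, \<open>\<lambda>\<^sub>E\<close> being Lebesgue measure on the matrices with all rows in \<open>E\<close>.
  Invariance under \<open>A \<mapsto> L A\<close> is clear, since it holds for each \<open>\<lambda>\<^sub>E\<close>; and \<open>\<Lambda>\<close> is invariant under transposition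
  because it is invariant under the orthogonal group from both sides and \<open>A\<^sup>T = Q A Q\<close> for some orthogonal
  \<open>Q\<close>, so that \<open>\<Lambda>\<close> and its transpose agree on all balls.

  Restrictions to flats of Lebesgue measurable functions need not be measurable, so the changes of variables are
  carried out for lower integrals of arbitrary functions.
\<close>

section \<open>Integrals of possibly nonmeasurable functions\<close>

text \<open>Every integral over a subspace E is written as an integral over the whole space, with
  the projection onto E inside the function and a Gaussian of mass 1 weighting the component in the
  complement. Then E enters only through its projection matrix, which yields measurability in E and
  access to Fubini, and Jacobians appear as Gaussian integrals instead of determinants.

  The detour through matrices is due to the Haar measure being given by its orthogonal invariance
  alone, whereas L is not orthogonal. Right multiplication by \<open>transpose (matrix L)\<close>
  moves the fibre over E to the fibre over its image with a Jacobian that varies with E, so its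
  invariance cannot be seen fibre by fibre; left multiplication preserves each fibre. Taking n rows
  produces the exponent n and makes the matrices square, so that transposition exchanges the two
  actions. As dim E \<le> n, a generic matrix with rows in E has row space E, and a function on the
  Grassmannian can be recovered from its lift to matrices.\<close>

lemma nn_integral_le_if_measurable_minorants:
  assumes "\<And>u. u \<in> borel_measurable M \<Longrightarrow> (\<And>x. u x \<le> h x) \<Longrightarrow> (\<integral>\<^sup>+ x. u x \<partial>M) \<le> c"
  shows "(\<integral>\<^sup>+ x. h x \<partial>M) \<le> c"
  unfolding nn_integral_def
proof (rule SUP_least)
  fix u assume "u \<in> {g. simple_function M g \<and> g \<le> h}"
  then show "simple_integral M u \<le> c"
    using assms[of u]
    by (simp add: nn_integral_eq_simple_integral[symmetric] borel_measurable_simple_function le_fun_def)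
qed

text \<open>Pulling minorants of h back along T gives \<open>\<le>\<close> for any measurable T. For
  nonmeasurable h the converse uses the measurable inverse: a minorant u of the composition is
  carried to the target as u composed with S.\<close>

lemma nn_integral_distr_bij:
  fixes h :: "'b \<Rightarrow> ennreal"
  assumes T[measurable]: "T \<in> measurable M N" and S[measurable]: "S \<in> measurable N M"
    and ST: "\<And>x. x \<in> space M \<Longrightarrow> S (T x) = x" and TS: "\<And>y. y \<in> space N \<Longrightarrow> T (S y) = y"
  shows "(\<integral>\<^sup>+ y. h y \<partial>distr M N T) = (\<integral>\<^sup>+ x. h (T x) \<partial>M)"
proof (rule antisym)
  show "(\<integral>\<^sup>+ y. h y \<partial>distr M N T) \<le> (\<integral>\<^sup>+ x. h (T x) \<partial>M)"
  proof (rule nn_integral_le_if_measurable_minorants)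
    fix u assume [measurable]: "u \<in> borel_measurable (distr M N T)" and "\<And>x. u x \<le> h x"
    then show "(\<integral>\<^sup>+ y. u y \<partial>distr M N T) \<le> (\<integral>\<^sup>+ x. h (T x) \<partial>M)"
      by (subst nn_integral_distr) (auto intro!: nn_integral_mono)
  qed
  show "(\<integral>\<^sup>+ x. h (T x) \<partial>M) \<le> (\<integral>\<^sup>+ y. h y \<partial>distr M N T)"
  proof (rule nn_integral_le_if_measurable_minorants)
    fix u assume [measurable]: "u \<in> borel_measurable M" and le: "\<And>x. u x \<le> h (T x)"
    have "(\<integral>\<^sup>+ x. u x \<partial>M) = (\<integral>\<^sup>+ x. u (S (T x)) \<partial>M)"
      by (intro nn_integral_cong) (simp add: ST)
    also have "\<dots> = (\<integral>\<^sup>+ y. u (S y) \<partial>distr M N T)"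
      by (subst nn_integral_distr) auto
    also have "\<dots> \<le> (\<integral>\<^sup>+ y. h y \<partial>distr M N T)"
      using le TS by (intro nn_integral_mono) (metis space_distr)
    finally show "(\<integral>\<^sup>+ x. u x \<partial>M) \<le> (\<integral>\<^sup>+ y. h y \<partial>distr M N T)" .
  qed
qed

text \<open>A minorant u of \<open>J * h\<close> becomes the minorant u / J of h; this division is
  why J must avoid 0 and infinity.\<close>

lemma nn_integral_density_pos:
  fixes h :: "'a \<Rightarrow> ennreal"
  assumes J[measurable]: "J \<in> borel_measurable M"
    and pos: "\<And>x. x \<in> space M \<Longrightarrow> J x \<noteq> 0" and fin: "\<And>x. x \<in> space M \<Longrightarrow> J x \<noteq> \<infinity>"
  shows "(\<integral>\<^sup>+ x. h x \<partial>density M J) = (\<integral>\<^sup>+ x. J x * h x \<partial>M)"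
proof (rule antisym)
  show "(\<integral>\<^sup>+ x. h x \<partial>density M J) \<le> (\<integral>\<^sup>+ x. J x * h x \<partial>M)"
  proof (rule nn_integral_le_if_measurable_minorants)
    fix u assume "u \<in> borel_measurable (density M J)" and le: "\<And>x. u x \<le> h x"
    then have [measurable]: "u \<in> borel_measurable M" by simp
    show "(\<integral>\<^sup>+ x. u x \<partial>density M J) \<le> (\<integral>\<^sup>+ x. J x * h x \<partial>M)"
      using le by (subst nn_integral_density) (auto intro!: nn_integral_mono mult_left_mono)
  qed
  show "(\<integral>\<^sup>+ x. J x * h x \<partial>M) \<le> (\<integral>\<^sup>+ x. h x \<partial>density M J)"
  proof (rule nn_integral_le_if_measurable_minorants)
    fix u assume [measurable]: "u \<in> borel_measurable M" and le: "\<And>x. u x \<le> J x * h x"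
    have inv: "J x * (u x * inverse (J x)) = u x" "u x * inverse (J x) \<le> h x" if "x \<in> space M" for x
    proof -
      have one: "J x * inverse (J x) = 1"
        using pos[OF that] fin[OF that] by (simp add: ennreal_mult_divide_eq divide_ennreal_def[symmetric] ennreal_divide_self less_top)
      then show "J x * (u x * inverse (J x)) = u x"
        by (metis mult.commute mult.assoc mult.right_neutral)
      have "u x * inverse (J x) \<le> (J x * h x) * inverse (J x)"
        by (intro mult_right_mono le) simp
      also have "\<dots> = h x"
        using one by (metis mult.commute mult.assoc mult.right_neutral)
      finally show "u x * inverse (J x) \<le> h x" .
    qed
    have "(\<integral>\<^sup>+ x. u x \<partial>M) = (\<integral>\<^sup>+ x. J x * (u x * inverse (J x)) \<partial>M)"
      by (intro nn_integral_cong) (simp add: inv)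
    also have "\<dots> = (\<integral>\<^sup>+ x. u x * inverse (J x) \<partial>density M J)"
      by (subst nn_integral_density) auto
    also have "\<dots> \<le> (\<integral>\<^sup>+ x. h x \<partial>density M J)"
      by (intro nn_integral_mono) (simp add: inv)
    finally show "(\<integral>\<^sup>+ x. u x \<partial>M) \<le> (\<integral>\<^sup>+ x. h x \<partial>density M J)" .
  qed
qed

lemma nn_integral_cmult_pos_le:
  fixes h :: "'a \<Rightarrow> ennreal"
  assumes d: "0 < d"
  shows "(\<integral>\<^sup>+ x. ennreal d * h x \<partial>M) \<le> ennreal d * (\<integral>\<^sup>+ x. h x \<partial>M)"
proof (rule nn_integral_le_if_measurable_minorants)
  fix u assume [measurable]: "u \<in> borel_measurable M" and le: "\<And>x. u x \<le> ennreal d * h x"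
  have one: "ennreal (1 / d) * (ennreal d * t) = t" "ennreal d * (ennreal (1 / d) * t) = t" for t
    using d by (simp_all add: ennreal_mult'[symmetric] mult.assoc[symmetric])
  have "ennreal (1 / d) * u x \<le> h x" for x
    using mult_left_mono[OF le[of x], of "ennreal (1 / d)"] by (simp add: one)
  then have "ennreal d * (\<integral>\<^sup>+ x. ennreal (1 / d) * u x \<partial>M) \<le> ennreal d * (\<integral>\<^sup>+ x. h x \<partial>M)"
    by (intro mult_left_mono nn_integral_mono) auto
  then show "(\<integral>\<^sup>+ x. u x \<partial>M) \<le> ennreal d * (\<integral>\<^sup>+ x. h x \<partial>M)"
    by (simp add: nn_integral_cmult one)
qed

lemma nn_integral_cmult_pos:
  fixes h :: "'a \<Rightarrow> ennreal"
  assumes d: "0 < d"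
  shows "(\<integral>\<^sup>+ x. ennreal d * h x \<partial>M) = ennreal d * (\<integral>\<^sup>+ x. h x \<partial>M)"
proof (rule antisym)
  have one: "ennreal (1 / d) * (ennreal d * t) = t" "ennreal d * (ennreal (1 / d) * t) = t" for t
    using d by (simp_all add: ennreal_mult'[symmetric] mult.assoc[symmetric])
  have "(\<integral>\<^sup>+ x. h x \<partial>M) \<le> ennreal (1 / d) * (\<integral>\<^sup>+ x. ennreal d * h x \<partial>M)"
    using nn_integral_cmult_pos_le[of "1 / d" M "\<lambda>x. ennreal d * h x"] d by (simp add: one)
  then show "ennreal d * (\<integral>\<^sup>+ x. h x \<partial>M) \<le> (\<integral>\<^sup>+ x. ennreal d * h x \<partial>M)"
    using mult_left_mono[of _ _ "ennreal d"] one by (metis zero_le)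
qed (rule nn_integral_cmult_pos_le[OF d])

section \<open>Translation-invariant measures and linear images of Lebesgue measure\<close>

lemma translation_invariant_eq_lborel:
  fixes M :: "'a::euclidean_space measure"
  assumes sets: "sets M = sets borel" and sf: "sigma_finite_measure M"
    and inv: "\<And>a. distr M borel ((+) a) = M"
    and A[measurable]: "A \<in> sets borel"
  shows "emeasure M A * emeasure lborel (ball 0 1 :: 'a set) = emeasure lborel A * emeasure M (ball 0 1)"
proof -
  interpret M: sigma_finite_measure M by (rule sf)
  interpret P: pair_sigma_finite M "lborel :: 'a measure" by standard
  note [measurable_cong] = sets
  let ?B = "ball 0 1 :: 'a set"
  have B[measurable]: "?B \<in> sets borel" by simp
  have spM: "space M = UNIV" using sets_eq_imp_space_eq[OF sets] by simp
  have invM: "(\<integral>\<^sup>+ x. f (x + a) \<partial>M) = (\<integral>\<^sup>+ x. f x \<partial>M)" if [measurable]: "f \<in> borel_measurable borel" for f a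
    by (subst (2) inv[of a, symmetric], subst nn_integral_distr) (auto simp: add.commute)
  have invL: "(\<integral>\<^sup>+ x. f (x + a) \<partial>lborel) = (\<integral>\<^sup>+ x. f x \<partial>lborel)" if [measurable]: "f \<in> borel_measurable borel" for f and a :: 'a
    by (subst (2) lborel_distr_plus[of a, symmetric], subst nn_integral_distr) (auto simp: add.commute)
  \<comment> \<open>Both sides evaluate the double integral of
    \<open>indicator ?B y * indicator A (x + y)\<close>. Invariance of M in x decouples the two
    factors and gives the left side; shifting y by -x and integrating over x first gives the right
    side. The product form of the claim avoids dividing by 0 or infinity.\<close>
  have "emeasure M A * emeasure lborel ?B = (\<integral>\<^sup>+ y. indicator ?B y * (\<integral>\<^sup>+ x. indicator A x \<partial>M) \<partial>lborel)"
    by (subst nn_integral_multc) (auto simp: mult.commute sets)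
  also have "\<dots> = (\<integral>\<^sup>+ y. (\<integral>\<^sup>+ x. indicator ?B y * indicator A (x + y) \<partial>M) \<partial>lborel)"
    by (intro nn_integral_cong, subst nn_integral_cmult)
      (auto simp: invM[of "indicator A"] simp del: nn_integral_indicator)
  also have "\<dots> = (\<integral>\<^sup>+ x. (\<integral>\<^sup>+ y. indicator ?B y * indicator A (x + y) \<partial>lborel) \<partial>M)"
    by (rule P.Fubini') simp
  also have "\<dots> = (\<integral>\<^sup>+ x. (\<integral>\<^sup>+ y. indicator ?B (y + - x) * indicator A (x + (y + - x)) \<partial>lborel) \<partial>M)"
    by (subst invL[where f="\<lambda>y. indicator ?B y * indicator A (_ + y)"]) auto
  \<comment> \<open>Symmetry of the unit ball replaces y - x by x - y, so that invariance of M can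
    be applied in x.\<close>
  also have "\<dots> = (\<integral>\<^sup>+ x. (\<integral>\<^sup>+ y. indicator ?B (x + - y) * indicator A y \<partial>lborel) \<partial>M)"
    by (intro nn_integral_cong arg_cong2[where f="(*)"]) (auto simp: indicator_def norm_minus_commute)
  also have "\<dots> = (\<integral>\<^sup>+ y. (\<integral>\<^sup>+ x. indicator ?B (x + - y) * indicator A y \<partial>M) \<partial>lborel)"
    by (rule P.Fubini'[symmetric]) simp
  also have "\<dots> = (\<integral>\<^sup>+ y. (\<integral>\<^sup>+ x. indicator ?B (x + - y) \<partial>M) * indicator A y \<partial>lborel)"
    by (intro nn_integral_cong nn_integral_multc) auto
  also have "\<dots> = (\<integral>\<^sup>+ y. emeasure M ?B * indicator A y \<partial>lborel)"
    by (subst invM) (auto simp: sets)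
  also have "\<dots> = emeasure lborel A * emeasure M ?B"
    by (subst nn_integral_cmult) (auto simp: mult.commute)
  finally show ?thesis .
qed

lemma emeasure_lborel_open_pos:
  fixes U :: "'a::euclidean_space set"
  assumes "open U" "x \<in> U"
  shows "0 < emeasure lborel U"
proof (rule ccontr)
  assume "\<not> ?thesis"
  then have "U \<in> null_sets lborel"
    using assms by (auto simp: null_sets_def not_gr_zero)
  then have "negligible U"
    by (simp add: negligible_iff_null_sets null_sets_completionI)
  then show False
    using open_not_negligible[of U] assms by auto
qed

text \<open>The image measure is translation invariant, since T intertwines translation by the
  preimage of a with translation by a; hence it is a multiple of Lebesgue measure. The constant is 1
  / |det T|, but only its existence is recorded: its value is later read off from Gaussians or
  products of balls.\<close>

lemma distr_lborel_linear_bij: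
  fixes T :: "'a::euclidean_space \<Rightarrow> 'a"
  assumes lin: "linear T" and bij: "bij T"
  shows "\<exists>c::real. 0 < c \<and> distr lborel borel T = density lborel (\<lambda>_. ennreal c)"
proof -
  let ?M = "distr lborel borel T" and ?B = "ball 0 1 :: 'a set"
  define S where "S = inv T"
  have linS: "linear S" unfolding S_def using lin bij by (simp add: bij_is_inj inj_linear_imp_inv_linear)
  have ST: "S (T x) = x" and TS: "T (S x) = x" for x
    using bij by (auto simp: S_def bij_is_inj bij_is_surj surj_f_inv_f)
  have [measurable]: "T \<in> borel_measurable borel" "S \<in> borel_measurable borel"
    using lin linS by (auto intro!: borel_measurable_continuous_onI linear_continuous_on simp: linear_linear)
  have vim: "T -` A = S ` A" for A
    using ST TS by (auto simp: image_iff) metis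
  have imT: "T ` A = S -` A" for A
    using ST by (auto intro: image_eqI[of _ _ "S _"] simp: TS)
  interpret M: sigma_finite_measure ?M
  proof
    have "emeasure ?M (T ` ball 0 n) = emeasure lborel (ball 0 n :: 'a set)" for n
    proof -
      note eq = imT[of "ball 0 n"]
      have "T -` S -` ball 0 n = ball 0 n" using ST by auto
      then show ?thesis unfolding eq using measurable_sets[OF \<open>S \<in> borel_measurable borel\<close>, of "ball 0 n"]
        by (subst emeasure_distr) auto
    qed
    moreover have "T ` ball 0 n \<in> sets borel" for n
    proof -
      note eq = imT[of "ball 0 n"]
      show ?thesis unfolding eq using measurable_sets[OF \<open>S \<in> borel_measurable borel\<close>, of "ball 0 n"] by auto
    qed
    moreover have "(\<Union>n::nat. T ` ball 0 (real n)) = UNIV"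
    proof -
      have "x \<in> (\<Union>n::nat. T ` ball 0 (real n))" for x
      proof -
        obtain n :: nat where "norm (S x) < real n" using reals_Archimedean2 by blast
        then have "S x \<in> ball 0 (real n)" by simp
        then have "T (S x) \<in> (\<Union>n::nat. T ` ball 0 (real n))" by blast
        then show ?thesis by (simp only: TS)
      qed
      then show ?thesis by auto
    qed
    ultimately show "\<exists>A. countable A \<and> A \<subseteq> sets ?M \<and> \<Union> A = space ?M \<and> (\<forall>a\<in>A. emeasure ?M a \<noteq> \<infinity>)"
      using emeasure_lborel_ball_finite[of "0::'a"]
      by (intro exI[of _ "range (\<lambda>n::nat. T ` ball 0 (real n))"]) (auto simp: less_top[symmetric])
  qed
  have inv: "distr ?M borel ((+) a) = ?M" for a
  proof -
    have "distr ?M borel ((+) a) = distr lborel borel (T \<circ> (+) (S a))"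
      by (subst distr_distr) (auto intro!: distr_cong simp: linear_add[OF lin] TS)
    also have "\<dots> = distr (distr lborel borel ((+) (S a))) borel T"
      by (subst distr_distr) auto
    finally show ?thesis by (simp only: lborel_distr_plus)
  qed
  have eq: "emeasure ?M A * emeasure lborel ?B = emeasure lborel A * emeasure ?M ?B" if "A \<in> sets borel" for A
    using translation_invariant_eq_lborel[OF _ _ inv that] M.sigma_finite_measure_axioms by simp
  have opT: "open (T -` ?B)"
    by (intro open_vimage linear_continuous_on) (auto simp: linear_linear lin)
  have bdd: "bounded (T -` ?B)" unfolding vim
    by (rule bounded_linear_image) (auto simp: linear_linear linS)
  have M: "emeasure ?M ?B = emeasure lborel (T -` ?B)" by (subst emeasure_distr) auto
  have Mpos: "0 < emeasure ?M ?B" unfolding M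
    by (rule emeasure_lborel_open_pos[OF opT, of 0]) (simp add: linear_0[OF lin])
  have Mfin: "emeasure ?M ?B < \<infinity>" unfolding M by (rule emeasure_bounded_finite[OF bdd])
  have Lpos: "0 < emeasure lborel ?B" by (rule emeasure_lborel_open_pos[of _ 0]) auto
  have Lfin: "emeasure lborel ?B < \<infinity>" by (rule emeasure_lborel_ball_finite)
  define c where "c = enn2real (emeasure ?M ?B) / enn2real (emeasure lborel ?B)"
  have c: "ennreal c = emeasure ?M ?B / emeasure lborel ?B"
    using Mfin Lfin Mpos Lpos unfolding c_def
    by (subst divide_ennreal[symmetric]) (auto simp: enn2real_positive_iff less_top)
  have "0 < c" using Mfin Lfin Mpos Lpos by (auto simp: c_def enn2real_positive_iff)
  moreover have "distr lborel borel T = density lborel (\<lambda>_. ennreal c)"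
  proof (rule measure_eqI)
    fix A assume "A \<in> sets ?M"
    then have [measurable]: "A \<in> sets borel" by simp
    have "emeasure ?M A = emeasure ?M A * emeasure lborel ?B / emeasure lborel ?B"
      using Lpos Lfin by (subst ennreal_mult_divide_eq) auto
    also have "\<dots> = emeasure (density lborel (\<lambda>_. ennreal c)) A"
      by (subst eq, simp) (simp add: emeasure_density_const c ennreal_times_divide mult.commute)
    finally show "emeasure ?M A = emeasure (density lborel (\<lambda>_. ennreal c)) A" .
  qed simp
  ultimately show ?thesis by blast
qed

section \<open>Orthogonal projections\<close>

lemma closest_point_subspace_eqI:
  fixes E :: "'a::euclidean_space set"
  assumes "subspace E" "y \<in> E" "\<And>v. v \<in> E \<Longrightarrow> (x - y) \<bullet> v = 0"
  shows "closest_point E x = y"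
proof (rule closest_point_unique[symmetric])
  show "convex E" "closed E" using assms by (auto simp: subspace_imp_convex closed_subspace)
  show "\<forall>z\<in>E. dist x y \<le> dist x z"
  proof
    fix z assume "z \<in> E"
    then have "(x - y) \<bullet> (y - z) = 0" using assms by (simp add: subspace_diff)
    then have "(norm (x - z))\<^sup>2 = (norm (x - y))\<^sup>2 + (norm (y - z))\<^sup>2"
      by (simp add: power2_norm_eq_inner algebra_simps inner_commute)
    then have "(norm (x - y))\<^sup>2 \<le> (norm (x - z))\<^sup>2" by simp
    then show "dist x y \<le> dist x z" unfolding dist_norm by (rule power2_le_imp_le) simp
  qed
qed (use assms in auto)

lemma closest_point_subspace_in:
  "subspace E \<Longrightarrow> closest_point E x \<in> (E::'a::euclidean_space set)"
  by (rule closest_point_in_set) (auto simp: closed_subspace dest: subspace_0)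

lemma closest_point_subspace_orth:
  fixes E :: "'a::euclidean_space set"
  assumes E: "subspace E" and v: "v \<in> E"
  shows "(x - closest_point E x) \<bullet> v = 0"
proof -
  let ?p = "closest_point E x"
  have c: "(x - ?p) \<bullet> (y - ?p) \<le> 0" if "y \<in> E" for y
    using closest_point_dot[of E y x] E that by (simp add: subspace_imp_convex closed_subspace)
  \<comment> \<open>The variational inequality at these two points bounds the inner product with v
    from both sides.\<close>
  have "?p + v \<in> E" "?p - v \<in> E"
    using E v closest_point_subspace_in[OF E] by (auto simp: subspace_add subspace_diff)
  from c[OF this(1)] c[OF this(2)] show ?thesis by simp
qed

lemma closest_point_subspace_linear:
  fixes E :: "'a::euclidean_space set"
  assumes E: "subspace E"
  shows "linear (closest_point E)"
proof (rule linearI)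
  fix x y :: 'a and c :: real
  note in_E = closest_point_subspace_in[OF E] and orth = closest_point_subspace_orth[OF E]
  show "closest_point E (x + y) = closest_point E x + closest_point E y"
    using E in_E orth[of _ x] orth[of _ y]
    by (intro closest_point_subspace_eqI) (auto simp: subspace_add algebra_simps)
  show "closest_point E (c *\<^sub>R x) = c *\<^sub>R closest_point E x"
    using E in_E orth[of _ x]
    by (intro closest_point_subspace_eqI) (auto simp: subspace_scale algebra_simps)
qed

lemma closest_point_subspace_self: "subspace E \<Longrightarrow> x \<in> E \<Longrightarrow> closest_point E x = (x::'a::euclidean_space)"
  by (rule closest_point_self)

lemma closest_point_subspace_pythagoras:
  fixes E :: "'a::euclidean_space set"
  assumes E: "subspace E"
  shows "(norm x)\<^sup>2 = (norm (closest_point E x))\<^sup>2 + (norm (x - closest_point E x))\<^sup>2"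
  using closest_point_subspace_orth[OF E closest_point_subspace_in[OF E], of x x]
  by (simp add: power2_norm_eq_inner algebra_simps inner_commute)

lemma closest_point_subspace_selfadjoint:
  fixes E :: "'a::euclidean_space set"
  assumes E: "subspace E"
  shows "closest_point E x \<bullet> y = x \<bullet> closest_point E y"
  using closest_point_subspace_orth[OF E closest_point_subspace_in[OF E], of x y]
    closest_point_subspace_orth[OF E closest_point_subspace_in[OF E], of y x]
  by (simp add: algebra_simps inner_commute)

lemma closest_point_orthogonal_comp:
  fixes E :: "'a::euclidean_space set"
  assumes E: "subspace E"
  shows "closest_point (E\<^sup>\<bottom>) x = x - closest_point E x"
proof (rule closest_point_subspace_eqI)
  show "x - closest_point E x \<in> E\<^sup>\<bottom>"
    using closest_point_subspace_orth[OF E]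
    by (auto simp: orthogonal_comp_def orthogonal_def inner_commute)
  show "(x - (x - closest_point E x)) \<bullet> v = 0" if "v \<in> E\<^sup>\<bottom>" for v
    using that closest_point_subspace_in[OF E] by (auto simp: orthogonal_comp_def orthogonal_def)
qed (rule subspace_orthogonal_comp)

lemma closest_point_orthogonal_image:
  fixes E :: "'a::euclidean_space set"
  assumes E: "subspace E" and h: "orthogonal_transformation (h :: 'a \<Rightarrow> 'a)"
  shows "closest_point (h ` E) (h x) = h (closest_point E x)"
proof (rule closest_point_subspace_eqI)
  have lin: "linear h" using h by (rule orthogonal_transformation_linear)
  show "subspace (h ` E)" using E lin by (rule linear_subspace_image[rotated])
  show "h (closest_point E x) \<in> h ` E" using closest_point_subspace_in[OF E] by auto
  fix v assume "v \<in> h ` E"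
  then show "(h x - h (closest_point E x)) \<bullet> v = 0"
    using closest_point_subspace_orth[OF E] h
    by (auto simp: linear_diff[OF lin, symmetric] orthogonal_transformation_def)
qed

section \<open>Flats as translates of linear subspaces\<close>

lemma direction_translate:
  assumes E: "subspace E"
  shows "direction ((\<lambda>y. z + y) ` E) = E"
proof -
  have "v = (z + v) - (z + 0)" for v by simp
  then show ?thesis unfolding direction_def
    using subspace_diff[OF E] subspace_0[OF E] by (fastforce simp: image_iff)
qed

lemma direction_subspace: "subspace E \<Longrightarrow> direction E = E"
  using direction_translate[of E 0] by simp

lemma closest_point_translate_0:
  fixes E :: "'a::euclidean_space set"
  assumes E: "subspace E"
  shows "closest_point ((\<lambda>y. z + y) ` E) 0 = z - closest_point E z"
proof (rule closest_point_unique[symmetric])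
  show "convex ((\<lambda>y. z + y) ` E)" "closed ((\<lambda>y. z + y) ` E)"
    using E by (auto simp: subspace_imp_convex closed_subspace closed_translation)
  have "z - closest_point E z = z + (- closest_point E z)" by simp
  then show "z - closest_point E z \<in> (\<lambda>y. z + y) ` E"
    using closest_point_subspace_in[OF E, of z] E by (blast intro: subspace_neg)
  show "\<forall>w\<in>(\<lambda>y. z + y) ` E. dist 0 (z - closest_point E z) \<le> dist 0 w"
  proof
    fix w assume "w \<in> (\<lambda>y. z + y) ` E"
    then obtain y where y: "y \<in> E" "w = z + y" by auto
    have "closest_point E w = closest_point E z + y"
      using y linear_add[OF closest_point_subspace_linear[OF E]] closest_point_subspace_self[OF E] by simp
    then have "(norm w)\<^sup>2 = (norm (closest_point E w))\<^sup>2 + (norm (z - closest_point E z))\<^sup>2"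
      using closest_point_subspace_pythagoras[OF E, of w] y by simp
    then have "(norm (z - closest_point E z))\<^sup>2 \<le> (norm w)\<^sup>2" by simp
    then have "norm (z - closest_point E z) \<le> norm w" by (rule power2_le_imp_le) simp
    then show "dist 0 (z - closest_point E z) \<le> dist 0 w" by (simp only: dist_0_norm)
  qed
qed

lemma affine_grassmannian_eq:
  "affine_grassmannian k = {(\<lambda>y. z + y) ` E |z E. E \<in> grassmannian k}" (is "_ = ?R")
proof (intro set_eqI iffI)
  fix F :: "'a set" assume "F \<in> affine_grassmannian k"
  then have F: "affine F" "aff_dim F = int k" by (auto simp: affine_grassmannian_def)
  then have "F \<noteq> {}" by auto
  then obtain z where z: "z \<in> F" by blast
  define E where "E = (\<lambda>y. - z + y) ` F"
  have FE: "F = (\<lambda>y. z + y) ` E" by (simp add: E_def image_image)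
  have "subspace E" unfolding E_def using F(1) z by (metis affine_diffs_subspace_subtract diff_conv_add_uminus add.commute image_cong)
  moreover have "aff_dim E = aff_dim F" unfolding E_def by (rule aff_dim_translation_eq)
  ultimately have "E \<in> grassmannian k"
    using F(2) by (simp add: grassmannian_def aff_dim_subspace)
  then show "F \<in> ?R" using FE by blast
next
  fix F :: "'a set" assume "F \<in> ?R"
  then obtain z E where FE: "F = (\<lambda>y. z + y) ` E" and E: "subspace E" "dim E = k"
    by (auto simp: grassmannian_def)
  have "affine F" unfolding FE using E(1) by (simp add: subspace_imp_affine affine_translation[symmetric])
  moreover have "aff_dim F = int k"
    unfolding FE aff_dim_translation_eq using E by (simp add: aff_dim_subspace)
  ultimately show "F \<in> affine_grassmannian k" by (simp add: affine_grassmannian_def)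
qed

section \<open>Projection matrices and orthonormal bases\<close>

abbreviation proj_mat :: "(real ^ 'n) set \<Rightarrow> real ^ 'n ^ 'n" where
  "proj_mat E \<equiv> matrix (closest_point E)"

lemma proj_mat_mult: "subspace E \<Longrightarrow> proj_mat E *v x = closest_point E x"
  by (simp add: closest_point_subspace_linear matrix_works)

lemma proj_mat_range: "subspace E \<Longrightarrow> range ((*v) (proj_mat E)) = E"
  using closest_point_subspace_in[of E] closest_point_subspace_self[of E]
  by (auto simp: proj_mat_mult) (metis rangeI)

lemma transpose_eqI:
  fixes A B :: "real ^ 'n ^ 'n"
  assumes "\<And>x y. (A *v x) \<bullet> y = x \<bullet> (B *v y)"
  shows "transpose A = B"
proof -
  have "x \<bullet> (transpose A *v y) = x \<bullet> (B *v y)" for x y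
    using assms[of x y] by (simp only: dot_lmul_matrix[symmetric] vector_transpose_matrix)
  then have "transpose A *v y = B *v y" for y
    by (metis vector_eq_ldot)
  then show ?thesis using matrix_eq by blast
qed

lemma transpose_proj_mat:
  assumes "subspace E"
  shows "transpose (proj_mat E) = proj_mat E"
proof (rule transpose_eqI)
  show "(proj_mat E *v x) \<bullet> y = x \<bullet> (proj_mat E *v y)" for x y
    unfolding proj_mat_mult[OF assms] by (rule closest_point_subspace_selfadjoint[OF assms])
qed

lemma proj_mat_orthogonal_image:
  fixes E :: "(real ^ 'n) set" and h :: "real ^ 'n \<Rightarrow> real ^ 'n"
  assumes E: "subspace E" and h: "orthogonal_transformation h"
  shows "proj_mat (h ` E) = matrix h ** proj_mat E ** transpose (matrix h)"
proof -
  have lin: "linear h" using h by (rule orthogonal_transformation_linear)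
  have sub: "subspace (h ` E)" using E lin by (rule linear_subspace_image[rotated])
  have orth: "orthogonal_matrix (matrix h)" using h orthogonal_transformation_matrix by blast
  have "proj_mat (h ` E) ** matrix h = matrix h ** proj_mat E"
    unfolding matrix_eq matrix_vector_mul_assoc[symmetric] proj_mat_mult[OF sub] proj_mat_mult[OF E]
      matrix_works[OF lin[folded linear_matrix_vector_mul_eq]] closest_point_orthogonal_image[OF E h] by simp
  then have "proj_mat (h ` E) ** matrix h ** transpose (matrix h) = matrix h ** proj_mat E ** transpose (matrix h)"
    by simp
  then show ?thesis
    using orth by (simp add: matrix_mul_assoc[symmetric] orthogonal_matrix_def)
qed

lemma orthonormal_basis_inner:
  "orthonormal_basis E B \<Longrightarrow> b \<in> B \<Longrightarrow> c \<in> B \<Longrightarrow> b \<bullet> c = (if b = c then 1 else 0)"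
  by (auto simp: orthonormal_basis_def pairwise_def orthogonal_def norm_eq_1)

lemma closest_point_orthonormal:
  fixes E :: "'a::euclidean_space set"
  assumes E: "subspace E" and B: "orthonormal_basis E B"
  shows "finite B" and "closest_point E x = (\<Sum>b\<in>B. (x \<bullet> b) *\<^sub>R b)" and "card B = dim E"
proof -
  have orth: "pairwise orthogonal B" and norm: "\<And>b. b \<in> B \<Longrightarrow> norm b = 1" and span: "span B = E"
    using B by (auto simp: orthonormal_basis_def)
  have "0 \<notin> B" using norm by force
  then have ind: "independent B" using orth pairwise_orthogonal_independent by blast
  then show fin: "finite B" by (rule independent_imp_finite)
  show "card B = dim E" using ind span by (metis dim_eq_card_independent dim_span)
  have ip: "b \<bullet> c = (if b = c then 1 else 0)" if "b \<in> B" "c \<in> B" for b c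
    using that orth norm by (auto simp: pairwise_def orthogonal_def norm_eq_1)
  show "closest_point E x = (\<Sum>b\<in>B. (x \<bullet> b) *\<^sub>R b)"
  proof (rule closest_point_subspace_eqI[OF E])
    show "(\<Sum>b\<in>B. (x \<bullet> b) *\<^sub>R b) \<in> E"
      unfolding span[symmetric] by (intro span_sum span_scale span_base)
    fix v assume "v \<in> E"
    then have "v \<in> span B" using span by simp
    then show "(x - (\<Sum>b\<in>B. (x \<bullet> b) *\<^sub>R b)) \<bullet> v = 0"
    proof (induction rule: span_induct_alt)
      case (step c b y)
      have "(\<Sum>b\<in>B. (x \<bullet> b) *\<^sub>R b) \<bullet> b = (\<Sum>a\<in>B. if a = b then x \<bullet> b else 0)"
        unfolding inner_sum_left using step ip by (intro sum.cong) auto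
      also have "\<dots> = x \<bullet> b" using fin step by simp
      finally show ?case using step by (simp add: inner_add_right inner_diff_left)
    qed simp
  qed
qed

text \<open>In terms of an orthonormal basis of E the trace is the sum of the squared norms of the
  basis vectors. This makes the dimension of a subspace a Borel function of its projection
  matrix.\<close>

lemma trace_proj_mat:
  fixes E :: "(real ^ 'n) set"
  assumes E: "subspace E"
  shows "trace (proj_mat E) = real (dim E)"
proof -
  obtain B where B: "orthonormal_basis E B" using orthonormal_basis_exists[OF E] by blast
  note cp = closest_point_orthonormal[OF E B]
  have "trace (proj_mat E) = (\<Sum>i\<in>UNIV. \<Sum>b\<in>B. (b $ i) * (b $ i))"
    unfolding trace_def matrix_def by (simp add: cp(2) inner_axis')
  also have "\<dots> = (\<Sum>b\<in>B. b \<bullet> b)"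
    by (subst sum.swap) (simp add: inner_vec_def)
  also have "\<dots> = real (card B)"
    using B by (simp add: orthonormal_basis_def dot_square_norm)
  finally show ?thesis by (simp add: cp(3))
qed

section \<open>Lebesgue measure and Gaussian weights\<close>

text \<open>The factor pi gives total mass 1 in every dimension, and the Gaussian of an orthogonal
  sum is the product of the Gaussians. Weighting with \<open>gauss\<close> therefore adds directions
  of integration without changing the value.\<close>

definition gauss :: "'a::euclidean_space \<Rightarrow> ennreal" where
  "gauss x = ennreal (exp (- (pi * (norm x)\<^sup>2)))"

lemma gauss_measurable[measurable]: "gauss \<in> borel_measurable borel"
  unfolding gauss_def by measurable

lemma gauss_pos: "gauss x \<noteq> 0"
  by (simp add: gauss_def)

lemma gauss_cong: "norm x = norm y \<Longrightarrow> gauss x = gauss y"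
  by (simp add: gauss_def)

lemma gauss_mult: "(norm x)\<^sup>2 + (norm y)\<^sup>2 = (norm z)\<^sup>2 \<Longrightarrow> gauss x * gauss y = gauss z"
  by (simp add: gauss_def ennreal_mult'[symmetric] exp_add[symmetric] algebra_simps flip: distrib_left)

lemma nn_integral_gauss_real: "(\<integral>\<^sup>+ x. gauss (x::real) \<partial>lborel) = 1"
proof -
  \<comment> \<open>A centred normal density of variance 1 / (2 pi) has prefactor 1 and exponent -pi
    x^2.\<close>
  define s where "s = 1 / sqrt (2 * pi)"
  have s: "0 < s" by (simp add: s_def)
  have s2: "s\<^sup>2 = 1 / (2 * pi)" by (simp add: s_def power_divide)
  have "gauss x = ennreal (normal_density 0 s x)" for x :: real
    by (simp add: gauss_def normal_density_def s2 field_simps)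
  then have "(\<integral>\<^sup>+ x. gauss (x::real) \<partial>lborel) = (\<integral>\<^sup>+ x. ennreal (normal_density 0 s x) \<partial>lborel)"
    by simp
  also have "\<dots> = emeasure (density lborel (normal_density 0 s)) UNIV"
    by (simp add: emeasure_density)
  also have "\<dots> = 1"
    using prob_space.emeasure_space_1[OF prob_space_normal_density[OF s]] by simp
  finally show ?thesis .
qed

lemma gauss_prod_Basis: "gauss (x :: 'a::euclidean_space) = (\<Prod>b\<in>Basis. gauss (x \<bullet> b))"
proof -
  have "(norm x)\<^sup>2 = (\<Sum>b\<in>Basis. (x \<bullet> b)\<^sup>2)"
    unfolding power2_norm_eq_inner by (subst euclidean_inner) (simp add: power2_eq_square)
  then show ?thesis
    by (simp add: gauss_def prod_ennreal exp_sum[symmetric] sum_negf sum_distrib_left)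
qed

lemma nn_integral_gauss: "(\<integral>\<^sup>+ x. gauss (x::'a::euclidean_space) \<partial>lborel) = 1"
  by (subst gauss_prod_Basis, subst nn_integral_lborel_prod) (auto simp: nn_integral_gauss_real)

lemma nn_integral_lborel_linear:
  fixes T :: "'a::euclidean_space \<Rightarrow> 'a"
  assumes T: "distr lborel borel T = density lborel (\<lambda>_. ennreal c)" and lin: "linear T"
    and f[measurable]: "f \<in> borel_measurable borel"
  shows "(\<integral>\<^sup>+ x. f (T x) \<partial>lborel) = ennreal c * (\<integral>\<^sup>+ x. f x \<partial>lborel)"
proof -
  have [measurable]: "T \<in> borel_measurable borel"
    using lin by (auto intro!: borel_measurable_continuous_onI linear_continuous_on simp: linear_linear)
  have "(\<integral>\<^sup>+ x. f (T x) \<partial>lborel) = (\<integral>\<^sup>+ x. f x \<partial>distr lborel borel T)"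
    by (subst nn_integral_distr) auto
  also have "\<dots> = ennreal c * (\<integral>\<^sup>+ x. f x \<partial>lborel)"
    unfolding T by (simp add: nn_integral_density nn_integral_cmult)
  finally show ?thesis .
qed

lemma linear_norm_imp_bij:
  fixes T :: "'a::euclidean_space \<Rightarrow> 'a"
  assumes "linear T" "\<And>x. norm (T x) = norm x"
  shows "bij T"
  using assms orthogonal_transformation orthogonal_transformation_bij by blast

text \<open>A Gaussian is unchanged by T and has mass 1, which forces the constant of
  \<open>distr_lborel_linear_bij\<close> to be 1.\<close>

lemma distr_lborel_isometry:
  fixes T :: "'a::euclidean_space \<Rightarrow> 'a"
  assumes lin: "linear T" and norm: "\<And>x. norm (T x) = norm x"
  shows "distr lborel borel T = lborel"
proof -
  obtain c where c: "0 < c" "distr lborel borel T = density lborel (\<lambda>_. ennreal c)"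
    using distr_lborel_linear_bij[OF lin linear_norm_imp_bij[OF assms]] by blast
  have "(\<integral>\<^sup>+ x. gauss (T x) \<partial>lborel) = ennreal c * (\<integral>\<^sup>+ x. gauss x \<partial>(lborel :: 'a measure))"
    by (rule nn_integral_lborel_linear[OF c(2) lin]) simp
  moreover have "gauss (T x) = gauss x" for x by (rule gauss_cong) (rule norm)
  ultimately have "c = 1"
    using c(1) by (simp add: nn_integral_gauss)
  then show ?thesis using c(2) by (simp add: density_1)
qed

lemma nn_integral_lborel_isometry:
  fixes T :: "'a::euclidean_space \<Rightarrow> 'a"
  assumes "linear T" "\<And>x. norm (T x) = norm x" and f[measurable]: "f \<in> borel_measurable borel"
  shows "(\<integral>\<^sup>+ x. f (T x) \<partial>lborel) = (\<integral>\<^sup>+ x. f x \<partial>lborel)"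
  using nn_integral_lborel_linear[of T 1 f] assms distr_lborel_isometry[of T]
  by (simp add: density_1)

text \<open>The standard basis consists of the vectors \<open>axis i b\<close>, so a box is a
  product of boxes, one per component. A matrix can thus be treated as a tuple of independent
  rows.\<close>

lemma lborel_vec:
  "(lborel :: ('b::euclidean_space ^ 'n) measure) = distr (\<Pi>\<^sub>M i\<in>UNIV. lborel) borel vec_lambda"
proof (rule lborel_eqI)
  interpret product_sigma_finite "\<lambda>_::'n. lborel :: 'b measure" by standard
  fix l u :: "'b ^ 'n"
  assume le: "\<And>b. b \<in> Basis \<Longrightarrow> l \<bullet> b \<le> u \<bullet> b"
  have le': "l $ i \<bullet> b \<le> u $ i \<bullet> b" if "b \<in> Basis" for i b
    using le[of "axis i b"] that by (auto simp: Basis_vec_def inner_axis)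
  have meas: "vec_lambda \<in> measurable (\<Pi>\<^sub>M i\<in>(UNIV::'n set). (lborel :: 'b measure)) borel"
    by (subst borel_measurable_euclidean_space) (auto simp: Basis_vec_def inner_axis)
  have "vec_lambda -` box l u \<inter> space (\<Pi>\<^sub>M i\<in>(UNIV::'n set). (lborel :: 'b measure)) = (\<Pi>\<^sub>E i\<in>UNIV. box (l $ i) (u $ i))"
    by (auto simp: space_PiM box_def Basis_vec_def inner_axis PiE_iff)
  then have "emeasure (distr (\<Pi>\<^sub>M i\<in>UNIV. lborel) borel vec_lambda) (box l u) = (\<Prod>i\<in>UNIV. emeasure lborel (box (l $ i) (u $ i)))"
    by (subst emeasure_distr[OF meas]) (auto simp: emeasure_PiM)
  also have "\<dots> = (\<Prod>i\<in>UNIV. ennreal (\<Prod>b\<in>Basis. (u $ i - l $ i) \<bullet> b))"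
    using le' by (intro prod.cong refl emeasure_lborel_box) auto
  also have "\<dots> = (\<Prod>b\<in>Basis. (u - l) \<bullet> b)"
  proof -
    have B: "(Basis :: ('b ^ 'n) set) = (\<lambda>(i, b). axis i b) ` (UNIV \<times> Basis)"
      by (auto simp: Basis_vec_def)
    have inj: "inj_on (\<lambda>(i, b). axis i b :: 'b ^ 'n) (UNIV \<times> Basis)"
      by (auto simp: inj_on_def axis_eq_axis nonzero_Basis)
    have "(\<Prod>b\<in>Basis. (u - l) \<bullet> b) = (\<Prod>(i, b)\<in>UNIV \<times> Basis. (u $ i - l $ i) \<bullet> b)"
      unfolding B by (subst prod.reindex[OF inj]) (auto intro!: prod.cong simp: inner_axis)
    also have "\<dots> = (\<Prod>i\<in>UNIV. \<Prod>b\<in>Basis. (u $ i - l $ i) \<bullet> b)"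
      by (simp add: prod.cartesian_product)
    finally show ?thesis
      using le' by (subst prod_ennreal) (auto intro!: prod_nonneg simp: inner_diff_left)
  qed
  finally show "emeasure (distr (\<Pi>\<^sub>M i\<in>UNIV. lborel) borel vec_lambda) (box l u) = ennreal (\<Prod>b\<in>Basis. (u - l) \<bullet> b)"
    by simp
qed simp

lemma sets_borel_rows:
  fixes B :: "'n::finite \<Rightarrow> 'b::euclidean_space set"
  assumes [measurable]: "\<And>i. B i \<in> sets borel"
  shows "{Z :: 'b ^ 'n. \<forall>i. Z $ i \<in> B i} \<in> sets borel"
proof -
  have [measurable]: "(\<lambda>Z :: 'b ^ 'n. Z $ i) \<in> borel_measurable borel" for i
    by (intro borel_measurable_continuous_onI continuous_intros)
  have "{Z \<in> space borel. \<forall>i\<in>UNIV. (Z :: 'b ^ 'n) $ i \<in> B i} \<in> sets borel" by measurable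
  then show ?thesis by simp
qed

lemma emeasure_lborel_rows:
  fixes B :: "'n::finite \<Rightarrow> 'b::euclidean_space set"
  assumes B[measurable]: "\<And>i. B i \<in> sets borel"
  shows "emeasure lborel {Z :: 'b ^ 'n. \<forall>i. Z $ i \<in> B i} = (\<Prod>i\<in>UNIV. emeasure lborel (B i))"
proof -
  interpret product_sigma_finite "\<lambda>_::'n. lborel :: 'b measure" by standard
  have meas: "vec_lambda \<in> measurable (\<Pi>\<^sub>M i\<in>(UNIV::'n set). (lborel :: 'b measure)) borel"
    by (subst borel_measurable_euclidean_space) (auto simp: Basis_vec_def inner_axis)
  have "vec_lambda -` {Z. \<forall>i. Z $ i \<in> B i} \<inter> space (\<Pi>\<^sub>M i\<in>(UNIV::'n set). (lborel :: 'b measure)) = (\<Pi>\<^sub>E i\<in>UNIV. B i)"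
    by (auto simp: space_PiM PiE_iff)
  moreover have "{Z :: 'b ^ 'n. \<forall>i. Z $ i \<in> B i} \<in> sets borel"
    by (rule sets_borel_rows) simp
  ultimately show ?thesis
    by (subst lborel_vec, subst emeasure_distr[OF meas]) (auto simp: emeasure_PiM)
qed

text \<open>The row-wise map is linear and bijective, so it has some constant; the set of tuples
  with all rows in the unit ball determines it, because the preimage of this set is again a
  product.\<close>

lemma distr_lborel_rows:
  fixes T :: "'n::finite \<Rightarrow> 'b::euclidean_space \<Rightarrow> 'b" and c :: "'n \<Rightarrow> real"
  assumes lin: "\<And>i. linear (T i)" and bij: "\<And>i. bij (T i)" and pos: "\<And>i. 0 < c i"
    and T: "\<And>i. distr lborel borel (T i) = density lborel (\<lambda>_. ennreal (c i))"
  shows "distr lborel borel (\<lambda>Z :: 'b ^ 'n. \<chi> i. T i (Z $ i)) = density lborel (\<lambda>_. ennreal (\<Prod>i\<in>UNIV. c i))"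
proof -
  let ?T = "\<lambda>Z :: 'b ^ 'n. \<chi> i. T i (Z $ i)"
  have lT: "linear ?T"
    using lin by (intro linearI) (simp_all add: vec_eq_iff linear_add linear_scale)
  have "inj ?T"
    using bij by (intro injI) (simp add: vec_eq_iff bij_is_inj inj_eq)
  then have bT: "bij ?T" using lT linear_injective_imp_surjective by (auto simp: bij_def)
  obtain d where d: "0 < d" "distr lborel borel ?T = density lborel (\<lambda>_. ennreal d)"
    using distr_lborel_linear_bij[OF lT bT] by blast
  let ?B = "ball 0 1 :: 'b set"
  define b where "b = enn2real (emeasure lborel ?B)"
  have b: "0 < b" "emeasure lborel ?B = ennreal b"
    using emeasure_lborel_open_pos[of ?B 0] emeasure_lborel_ball_finite[of "0::'b" 1]
    by (auto simp: b_def enn2real_positive_iff less_top)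
  have mT[measurable]: "T i \<in> borel_measurable borel" for i
    using lin by (auto intro!: borel_measurable_continuous_onI linear_continuous_on simp: linear_linear)
  have msets: "{Z :: 'b ^ 'n. \<forall>i. Z $ i \<in> ?B} \<in> sets borel"
    by (rule sets_borel_rows) simp
  have mT'[measurable]: "?T \<in> borel_measurable borel"
    using lT by (intro borel_measurable_continuous_onI linear_continuous_on) (simp add: linear_linear)
  have 1: "emeasure lborel (T i -` ?B) = ennreal (c i * b)" for i
  proof -
    have "emeasure lborel (T i -` ?B) = emeasure (distr lborel borel (T i)) ?B"
      by (subst emeasure_distr) auto
    also have "\<dots> = ennreal (c i) * ennreal b"
      unfolding T by (simp add: emeasure_density_const b)
    finally show ?thesis using pos[of i] b by (simp add: ennreal_mult')
  qed
  have cube: "emeasure lborel {Z :: 'b ^ 'n. \<forall>i. Z $ i \<in> ?B} = ennreal (b ^ CARD('n))"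
    using b(1) by (subst emeasure_lborel_rows) (simp_all add: b(2) ennreal_power)
  have "ennreal d * ennreal (b ^ CARD('n)) = emeasure (distr lborel borel ?T) {Z. \<forall>i. Z $ i \<in> ?B}"
    unfolding d(2) using msets by (subst emeasure_density_const) (auto simp only: cube sets_lborel)
  also have "\<dots> = emeasure lborel {Z :: 'b ^ 'n. \<forall>i. Z $ i \<in> T i -` ?B}"
    using msets by (subst emeasure_distr[OF _ msets]) (auto intro!: arg_cong[where f="emeasure lborel"])
  also have "\<dots> = (\<Prod>i\<in>UNIV. ennreal (c i * b))"
    using measurable_sets[OF mT, of ?B] 1 by (subst emeasure_lborel_rows) auto
  also have "\<dots> = ennreal ((\<Prod>i\<in>UNIV. c i) * b ^ CARD('n))"
    using pos b(1) by (subst prod_ennreal) (auto simp: less_imp_le prod.distrib)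
  finally have "ennreal (d * b ^ CARD('n)) = ennreal ((\<Prod>i\<in>UNIV. c i) * b ^ CARD('n))"
    using d(1) by (simp add: ennreal_mult')
  moreover have "0 \<le> (\<Prod>i\<in>UNIV. c i)" using pos by (intro prod_nonneg) (simp add: less_imp_le)
  ultimately have "d * b ^ CARD('n) = (\<Prod>i\<in>UNIV. c i) * b ^ CARD('n)"
    using d(1) b(1) by (subst (asm) ennreal_inj) auto
  then have "d = (\<Prod>i\<in>UNIV. c i)" using b(1) by simp
  then show ?thesis using d(2) by simp
qed

section \<open>Lebesgue measure on flats\<close>

lemma linear_borel_measurable:
  fixes T :: "'a::euclidean_space \<Rightarrow> 'b::euclidean_space"
  assumes "linear T"
  shows "T \<in> borel_measurable borel"
  using assms by (intro borel_measurable_continuous_onI linear_continuous_on) (simp add: linear_linear)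

text \<open>The isometry h carries \<open>Basis\<close> to B and preserves Lebesgue measure, while
  \<rho> renames the coordinates accordingly.\<close>

lemma lborel_orthonormal:
  fixes B :: "'a::euclidean_space set"
  assumes B: "orthonormal_basis UNIV B"
  shows "lborel = distr (\<Pi>\<^sub>M b\<in>B. (lborel :: real measure)) borel (\<lambda>c. \<Sum>b\<in>B. c b *\<^sub>R b)"
proof -
  interpret product_sigma_finite "\<lambda>_::'a. lborel :: real measure" by standard
  note fin[simp] = closest_point_orthonormal(1)[OF subspace_UNIV B]
  have ip: "b \<bullet> c = (if b = c then 1 else 0)" if "b \<in> B" "c \<in> B" for b c
    using that B by (auto simp: orthonormal_basis_def pairwise_def orthogonal_def norm_eq_1)
  have "card B = card (Basis :: 'a set)"
    using closest_point_orthonormal(3)[OF subspace_UNIV B] by simp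
  then obtain \<beta> where \<beta>: "bij_betw \<beta> (Basis :: 'a set) B"
    by (metis bij_betw_iff_card fin finite_Basis)
  define h where "h x = (\<Sum>b\<in>Basis. (x \<bullet> b) *\<^sub>R \<beta> b)" for x :: 'a
  have lin: "linear h"
    by (rule linearI) (simp_all add: h_def inner_add_left algebra_simps sum.distrib scaleR_sum_right)
  have \<beta>B: "\<beta> b \<in> B" if "b \<in> Basis" for b using \<beta> that by (auto simp: bij_betw_def)
  have \<beta>ip: "\<beta> b \<bullet> \<beta> c = (if b = c then 1 else 0)" if "b \<in> Basis" "c \<in> Basis" for b c
    using ip[OF \<beta>B \<beta>B, OF that] \<beta> that by (auto simp: bij_betw_def inj_on_eq_iff)
  have norm: "norm (h x) = norm x" for x
  proof -
    have "h x \<bullet> h x = (\<Sum>b\<in>Basis. (x \<bullet> b) * (x \<bullet> b))"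
      unfolding h_def inner_sum_left inner_sum_right
      by (intro sum.cong refl) (simp add: \<beta>ip if_distrib[of "\<lambda>t. _ * t"] sum.delta' cong: if_cong sum.cong)
    also have "\<dots> = x \<bullet> x" by (rule euclidean_inner[symmetric])
    finally show ?thesis by (simp add: norm_eq_sqrt_inner)
  qed
  define \<rho> where "\<rho> c = (\<lambda>i\<in>Basis. c (\<beta> i))" for c :: "'a \<Rightarrow> real"
  have \<rho>[measurable]: "\<rho> \<in> measurable (\<Pi>\<^sub>M b\<in>B. (lborel :: real measure)) (\<Pi>\<^sub>M b\<in>Basis. (lborel :: real measure))"
    unfolding \<rho>_def using \<beta>B by (intro measurable_restrict measurable_component_singleton) auto
  have PiM: "(\<Pi>\<^sub>M b\<in>Basis. (lborel :: real measure)) = distr (\<Pi>\<^sub>M b\<in>B. lborel) (\<Pi>\<^sub>M b\<in>Basis. lborel) \<rho>"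
  proof (rule PiM_eqI[symmetric])
    fix A :: "'a \<Rightarrow> real set" assume A: "\<And>i. i \<in> Basis \<Longrightarrow> A i \<in> sets lborel"
    define \<gamma> where "\<gamma> = the_inv_into Basis \<beta>"
    have \<gamma>: "\<gamma> (\<beta> i) = i" if "i \<in> Basis" for i
      using \<beta> that by (simp add: \<gamma>_def bij_betw_def the_inv_into_f_f)
    have \<gamma>B: "\<gamma> b \<in> Basis" "\<beta> (\<gamma> b) = b" if "b \<in> B" for b
      using \<beta> that by (auto simp: \<gamma>_def bij_betw_def the_inv_into_into f_the_inv_into_f)
    have iff: "(\<forall>i\<in>Basis. x (\<beta> i) \<in> A i) \<longleftrightarrow> (\<forall>b\<in>B. x b \<in> A (\<gamma> b))" for x
      using \<gamma> \<gamma>B \<beta>B by metis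
    have "\<rho> -` (Pi\<^sub>E Basis A) \<inter> space (\<Pi>\<^sub>M b\<in>B. (lborel :: real measure)) = Pi\<^sub>E B (\<lambda>b. A (\<gamma> b))"
      using iff by (auto simp: \<rho>_def space_PiM PiE_iff)
    then have "emeasure (distr (\<Pi>\<^sub>M b\<in>B. lborel) (\<Pi>\<^sub>M b\<in>Basis. lborel) \<rho>) (Pi\<^sub>E Basis A)
        = (\<Prod>b\<in>B. emeasure lborel (A (\<gamma> b)))"
      using A \<gamma>B by (subst emeasure_distr) (auto simp: emeasure_PiM intro!: sets_PiM_I_finite)
    also have "\<dots> = (\<Prod>i\<in>Basis. emeasure lborel (A i))"
      using \<gamma> by (subst prod.reindex_bij_betw[OF \<beta>, symmetric]) (auto intro!: prod.cong)
    finally show "emeasure (distr (\<Pi>\<^sub>M b\<in>B. lborel) (\<Pi>\<^sub>M b\<in>Basis. lborel) \<rho>) (Pi\<^sub>E Basis A)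
        = (\<Prod>i\<in>Basis. emeasure lborel (A i))" .
  qed auto
  have [measurable]: "h \<in> borel_measurable borel" by (rule linear_borel_measurable[OF lin])
  have msum[measurable]: "(\<lambda>f. \<Sum>b\<in>Basis. f b *\<^sub>R b) \<in> borel_measurable (\<Pi>\<^sub>M b\<in>(Basis :: 'a set). (lborel :: real measure))"
    by (intro borel_measurable_sum borel_measurable_scaleR) auto
  have "lborel = distr lborel borel h" by (rule distr_lborel_isometry[OF lin norm, symmetric])
  also have "\<dots> = distr (\<Pi>\<^sub>M b\<in>B. (lborel :: real measure)) borel (\<lambda>c. h (\<Sum>b\<in>Basis. \<rho> c b *\<^sub>R b))"
    using measurable_compose[OF \<rho> msum] by (subst lborel_eq, subst PiM) (simp add: distr_distr comp_def)
  also have "\<dots> = distr (\<Pi>\<^sub>M b\<in>B. (lborel :: real measure)) borel (\<lambda>c. \<Sum>b\<in>B. c b *\<^sub>R b)"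
  proof (intro distr_cong refl)
    fix c
    have "h (\<Sum>b\<in>Basis. \<rho> c b *\<^sub>R b) = (\<Sum>b\<in>Basis. c (\<beta> b) *\<^sub>R \<beta> b)"
      unfolding h_def by (intro sum.cong refl) (simp add: \<rho>_def)
    also have "\<dots> = (\<Sum>b\<in>B. c b *\<^sub>R b)"
      by (rule sum.reindex_bij_betw[OF \<beta>])
    finally show "h (\<Sum>b\<in>Basis. \<rho> c b *\<^sub>R b) = (\<Sum>b\<in>B. c b *\<^sub>R b)" .
  qed
  finally show ?thesis .
qed

lemma sets_flat_lborel[simp, measurable_cong]: "sets (flat_lborel F) = sets borel"
  by (simp add: flat_lborel_def Let_def)

lemma space_flat_lborel[simp]: "space (flat_lborel F) = UNIV"
  by (simp add: flat_lborel_def Let_def)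

lemma closest_point_subspace_measurable:
  "subspace E \<Longrightarrow> closest_point (E::'a::euclidean_space set) \<in> borel_measurable borel"
  by (rule linear_borel_measurable[OF closest_point_subspace_linear])

lemma orthonormal_basis_Un:
  fixes E :: "'a::euclidean_space set"
  assumes E: "subspace E" and B1: "orthonormal_basis E B1" and B2: "orthonormal_basis (E\<^sup>\<bottom>) B2"
  shows "B1 \<inter> B2 = {}" and "orthonormal_basis UNIV (B1 \<union> B2)"
proof -
  have sub1: "b \<in> E" if "b \<in> B1" for b using B1 that by (auto simp: orthonormal_basis_def span_base)
  have sub2: "b \<in> E\<^sup>\<bottom>" if "b \<in> B2" for b using B2 that by (metis orthonormal_basis_def span_base)
  have o12: "b \<bullet> c = 0" if "b \<in> B1" "c \<in> B2" for b c
    using sub1[OF that(1)] sub2[OF that(2)] by (auto simp: orthogonal_comp_def orthogonal_def)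
  have o21: "c \<bullet> b = 0" if "b \<in> B1" "c \<in> B2" for b c
    using o12[OF that] by (simp add: inner_commute)
  show "B1 \<inter> B2 = {}"
    using o12 B1 by (force simp: orthonormal_basis_def)
  show "orthonormal_basis UNIV (B1 \<union> B2)"
    unfolding orthonormal_basis_def
  proof (intro conjI)
    show "pairwise orthogonal (B1 \<union> B2)"
      using B1 B2 o12 o21
      unfolding orthonormal_basis_def pairwise_def orthogonal_def by blast
    show "\<forall>b\<in>B1 \<union> B2. norm b = 1" using B1 B2 by (auto simp: orthonormal_basis_def)
    have "x \<in> span (B1 \<union> B2)" for x
    proof -
      have "closest_point E x \<in> span B1" "x - closest_point E x \<in> span B2"
        using B1 B2 closest_point_subspace_in[OF E, of x]
          closest_point_subspace_in[OF subspace_orthogonal_comp, of E x] closest_point_orthogonal_comp[OF E, of x]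
        by (auto simp: orthonormal_basis_def)
      then have "closest_point E x + (x - closest_point E x) \<in> span (B1 \<union> B2)"
        by (intro span_add) (metis span_mono subsetD sup_ge1 sup_ge2)+
      then show ?thesis by simp
    qed
    then show "span (B1 \<union> B2) = UNIV" by auto
  qed
qed

text \<open>In coordinates from orthonormal bases of E and \<open>E\<^sup>\<bottom>\<close> the
  integral on the right splits, and the Gaussian of the second block integrates to 1. The right side
  is free of the basis chosen inside \<open>flat_lborel\<close> and depends on E only through the
  projection.\<close>

lemma nn_integral_flat_lborel:
  fixes E :: "'a::euclidean_space set"
  assumes E: "subspace E" and f[measurable]: "f \<in> borel_measurable borel"
  shows "(\<integral>\<^sup>+ x. f x \<partial>flat_lborel E) = (\<integral>\<^sup>+ z. f (closest_point E z) * gauss (z - closest_point E z) \<partial>lborel)"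
proof -
  interpret product_sigma_finite "\<lambda>_::'a. lborel :: real measure" by standard
  define B1 where "B1 = (SOME B. orthonormal_basis (direction E) B)"
  have B1: "orthonormal_basis E B1"
    unfolding B1_def direction_subspace[OF E] by (rule someI_ex[OF orthonormal_basis_exists[OF E]])
  obtain B2 where B2: "orthonormal_basis (E\<^sup>\<bottom>) B2"
    using orthonormal_basis_exists[OF subspace_orthogonal_comp] by blast
  note cp1 = closest_point_orthonormal[OF E B1] and cp2 = closest_point_orthonormal[OF subspace_orthogonal_comp B2]
  have sub1: "b \<in> E" if "b \<in> B1" for b using B1 that by (auto simp: orthonormal_basis_def span_base)
  have sub2: "b \<in> E\<^sup>\<bottom>" if "b \<in> B2" for b using B2 that by (metis orthonormal_basis_def span_base)
  note disj = orthonormal_basis_Un(1)[OF E B1 B2]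
  have ip2: "b \<bullet> c = (if b = c then 1 else 0)" if "b \<in> B2" "c \<in> B2" for b c
    using that B2 by (auto simp: orthonormal_basis_def pairwise_def orthogonal_def norm_eq_1)
  note lb = lborel_orthonormal[OF orthonormal_basis_Un(2)[OF E B1 B2]]
  have meas1[measurable]: "(\<lambda>c. \<Sum>b\<in>B1. c b *\<^sub>R b) \<in> borel_measurable (\<Pi>\<^sub>M b\<in>B1. (lborel :: real measure))"
    by (intro borel_measurable_sum borel_measurable_scaleR) auto
  have meas2[measurable]: "(\<lambda>c. \<Sum>b\<in>B2. c b *\<^sub>R b) \<in> borel_measurable (\<Pi>\<^sub>M b\<in>B2. (lborel :: real measure))"
    by (intro borel_measurable_sum borel_measurable_scaleR) auto
  have meas12[measurable]: "(\<lambda>c. \<Sum>b\<in>B1 \<union> B2. c b *\<^sub>R b) \<in> borel_measurable (\<Pi>\<^sub>M b\<in>B1 \<union> B2. (lborel :: real measure))"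
    by (intro borel_measurable_sum borel_measurable_scaleR) auto
  have [measurable]: "closest_point E \<in> borel_measurable borel"
    by (rule closest_point_subspace_measurable[OF E])
  have lin: "linear (closest_point E)" by (rule closest_point_subspace_linear[OF E])
  have s: "(\<Sum>b\<in>B1 \<union> B2. merge B1 B2 (x, y) b *\<^sub>R b) = (\<Sum>b\<in>B1. x b *\<^sub>R b) + (\<Sum>b\<in>B2. y b *\<^sub>R b)" for x y
    using disj cp1(1) cp2(1)
    by (subst sum.union_disjoint) (auto intro!: arg_cong2[where f="(+)"] sum.cong simp: merge_def)
  have s1: "closest_point E ((\<Sum>b\<in>B1. x b *\<^sub>R b) + (\<Sum>b\<in>B2. y b *\<^sub>R b)) = (\<Sum>b\<in>B1. x b *\<^sub>R b)" for x y
  proof (rule closest_point_subspace_eqI[OF E])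
    show "(\<Sum>b\<in>B1. x b *\<^sub>R b) \<in> E" using sub1 E by (intro subspace_sum subspace_scale) auto
    fix v assume v: "v \<in> E"
    have "(\<Sum>b\<in>B2. y b *\<^sub>R b) \<in> E\<^sup>\<bottom>"
      using sub2 by (intro subspace_sum subspace_scale subspace_orthogonal_comp) auto
    then show "((\<Sum>b\<in>B1. x b *\<^sub>R b) + (\<Sum>b\<in>B2. y b *\<^sub>R b) - (\<Sum>b\<in>B1. x b *\<^sub>R b)) \<bullet> v = 0"
      using v by (auto simp: orthogonal_comp_def orthogonal_def inner_commute)
  qed
  have g2: "gauss (\<Sum>b\<in>B2. y b *\<^sub>R b) = (\<Prod>b\<in>B2. gauss (y b))" for y
  proof -
    have "(norm (\<Sum>b\<in>B2. y b *\<^sub>R b))\<^sup>2 = (\<Sum>b\<in>B2. (y b)\<^sup>2)"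
      unfolding power2_norm_eq_inner inner_sum_left inner_sum_right using cp2(1)
      by (intro sum.cong refl) (simp add: ip2 power2_eq_square if_distrib[of "\<lambda>t. _ * t"] sum.delta' cong: if_cong sum.cong)
    then show ?thesis
      by (simp add: gauss_def prod_ennreal exp_sum[OF cp2(1), symmetric] sum_negf sum_distrib_left)
  qed
  have "(\<integral>\<^sup>+ z. f (closest_point E z) * gauss (z - closest_point E z) \<partial>lborel) =
      (\<integral>\<^sup>+ x. (\<integral>\<^sup>+ y. f (\<Sum>b\<in>B1. x b *\<^sub>R b) * gauss (\<Sum>b\<in>B2. y b *\<^sub>R b) \<partial>(\<Pi>\<^sub>M b\<in>B2. lborel)) \<partial>(\<Pi>\<^sub>M b\<in>B1. lborel))"
    using disj cp1(1) cp2(1)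
    by (subst lb, subst nn_integral_distr) (auto simp: product_nn_integral_fold s s1)
  also have "\<dots> = (\<integral>\<^sup>+ x. f (\<Sum>b\<in>B1. x b *\<^sub>R b) \<partial>(\<Pi>\<^sub>M b\<in>B1. lborel))"
  proof (intro nn_integral_cong)
    fix x
    have "(\<integral>\<^sup>+ y. f (\<Sum>b\<in>B1. x b *\<^sub>R b) * gauss (\<Sum>b\<in>B2. y b *\<^sub>R b) \<partial>(\<Pi>\<^sub>M b\<in>B2. lborel)) =
        f (\<Sum>b\<in>B1. x b *\<^sub>R b) * (\<integral>\<^sup>+ y. gauss (\<Sum>b\<in>B2. y b *\<^sub>R b) \<partial>(\<Pi>\<^sub>M b\<in>B2. lborel))"
      by (rule nn_integral_cmult) measurable
    also have "(\<integral>\<^sup>+ y. gauss (\<Sum>b\<in>B2. y b *\<^sub>R b) \<partial>(\<Pi>\<^sub>M b\<in>B2. lborel)) = 1"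
      unfolding g2 using cp2(1)
      by (subst product_nn_integral_prod) (auto simp: nn_integral_gauss_real)
    finally show "(\<integral>\<^sup>+ y. f (\<Sum>b\<in>B1. x b *\<^sub>R b) * gauss (\<Sum>b\<in>B2. y b *\<^sub>R b) \<partial>(\<Pi>\<^sub>M b\<in>B2. lborel)) = f (\<Sum>b\<in>B1. x b *\<^sub>R b)"
      by simp
  qed
  also have "\<dots> = (\<integral>\<^sup>+ x. f x \<partial>flat_lborel E)"
    unfolding flat_lborel_def B1_def[symmetric] Let_def
    using closest_point_subspace_self[OF E subspace_0[OF E]]
    by (subst nn_integral_distr) auto
  finally show ?thesis by simp
qed

lemma nn_integral_flat_translate:
  fixes E :: "'a::euclidean_space set"
  assumes E: "subspace E" and v: "v \<in> E" and f[measurable]: "f \<in> borel_measurable borel"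
  shows "(\<integral>\<^sup>+ x. f (v + x) \<partial>flat_lborel E) = (\<integral>\<^sup>+ x. f x \<partial>flat_lborel E)"
proof -
  have [measurable]: "closest_point E \<in> borel_measurable borel"
    by (rule closest_point_subspace_measurable[OF E])
  have cp: "closest_point E (v + z) = v + closest_point E z" for z
    by (simp add: linear_add[OF closest_point_subspace_linear[OF E]] closest_point_subspace_self[OF E v])
  have "(\<integral>\<^sup>+ x. f (v + x) \<partial>flat_lborel E) = (\<integral>\<^sup>+ z. f (v + closest_point E z) * gauss (z - closest_point E z) \<partial>lborel)"
    by (rule nn_integral_flat_lborel[OF E]) measurable
  also have "\<dots> = (\<integral>\<^sup>+ z. f (closest_point E (v + z)) * gauss ((v + z) - closest_point E (v + z)) \<partial>lborel)"
    by (simp add: cp)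
  also have "\<dots> = (\<integral>\<^sup>+ z. f (closest_point E z) * gauss (z - closest_point E z) \<partial>distr lborel borel ((+) v))"
    by (subst nn_integral_distr) auto
  also have "\<dots> = (\<integral>\<^sup>+ x. f x \<partial>flat_lborel E)"
    unfolding lborel_distr_plus by (rule nn_integral_flat_lborel[OF E f, symmetric])
  finally show ?thesis .
qed

text \<open>The base point used by \<open>flat_lborel\<close> is the foot of the perpendicular from
  0. It differs from z by a vector of E, and the measure on E is invariant under that shift.\<close>

lemma flat_lborel_translate:
  fixes E :: "'a::euclidean_space set"
  assumes E: "subspace E"
  shows "flat_lborel ((\<lambda>y. z + y) ` E) = distr (flat_lborel E) borel (\<lambda>x. z + x)"
proof -
  define B1 where "B1 = (SOME B. orthonormal_basis E B)"
  have [measurable]: "(\<lambda>c. \<Sum>b\<in>B1. c b *\<^sub>R b) \<in> borel_measurable (\<Pi>\<^sub>M b\<in>B1. (lborel :: real measure))"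
    by (intro borel_measurable_sum borel_measurable_scaleR) auto
  have 1: "flat_lborel ((\<lambda>y. z + y) ` E) = distr (flat_lborel E) borel (\<lambda>x. (z - closest_point E z) + x)"
    unfolding flat_lborel_def direction_translate[OF E] direction_subspace[OF E] B1_def[symmetric] Let_def
      closest_point_translate_0[OF E]
    using closest_point_subspace_self[OF E subspace_0[OF E]]
    by (subst distr_distr) (auto simp: comp_def)
  show ?thesis
  proof (rule measure_eqI)
    fix A assume "A \<in> sets (flat_lborel ((\<lambda>y. z + y) ` E))"
    then have [measurable]: "A \<in> sets borel" by simp
    have "emeasure (distr (flat_lborel E) borel (\<lambda>x. z + x)) A = (\<integral>\<^sup>+ x. indicator A (z + x) \<partial>flat_lborel E)"
      by (subst nn_integral_indicator[symmetric], simp, subst nn_integral_distr) auto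
    also have "\<dots> = (\<integral>\<^sup>+ x. indicator A (z + (- closest_point E z + x)) \<partial>flat_lborel E)"
      by (rule nn_integral_flat_translate[OF E, symmetric])
        (auto intro!: subspace_neg E closest_point_subspace_in)
    also have "\<dots> = emeasure (flat_lborel ((\<lambda>y. z + y) ` E)) A"
      unfolding 1 by (subst nn_integral_indicator[symmetric], simp, subst nn_integral_distr) (auto simp: algebra_simps)
    finally show "emeasure (flat_lborel ((\<lambda>y. z + y) ` E)) A = emeasure (distr (flat_lborel E) borel (\<lambda>x. z + x)) A" by simp
  qed simp
qed

section \<open>Jacobians of linear maps on subspaces\<close>

text \<open>The integral over E of the Gaussian of L x, hence for injective L the reciprocal of the
  volume distortion J(E). Written over the whole space, it is visibly measurable in the projection
  onto E.\<close>

definition inv_jac :: "('a::euclidean_space \<Rightarrow> 'a) \<Rightarrow> 'a set \<Rightarrow> ennreal" where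
  "inv_jac L E = (\<integral>\<^sup>+ z. gauss (L (closest_point E z)) * gauss (z - closest_point E z) \<partial>lborel)"

lemma orthogonal_comp_closest_point:
  "subspace E \<Longrightarrow> x - closest_point E x \<in> (E :: 'a::euclidean_space set)\<^sup>\<bottom>"
  by (metis closest_point_orthogonal_comp closest_point_subspace_in subspace_orthogonal_comp)

lemma closest_point_add_orthogonal_comp:
  fixes E :: "'a::euclidean_space set"
  assumes E: "subspace E" and "x \<in> E" "y \<in> E\<^sup>\<bottom>"
  shows "closest_point E (x + y) = x"
  using assms by (intro closest_point_subspace_eqI) (auto simp: orthogonal_comp_def orthogonal_def inner_commute)

lemma dim_orthogonal_comp:
  fixes E :: "'a::euclidean_space set"
  assumes "subspace E"
  shows "dim (E\<^sup>\<bottom>) + dim E = DIM('a)"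
proof -
  have "E\<^sup>\<bottom> = {y \<in> UNIV. \<forall>x\<in>E. orthogonal x y}" by (auto simp: orthogonal_comp_def)
  then show ?thesis using dim_subspace_orthogonal_to_vectors[of E UNIV] assms by simp
qed

lemma linear_inj_bij:
  fixes T :: "'a::euclidean_space \<Rightarrow> 'a"
  assumes lin: "linear T" and "\<And>x. T x = 0 \<Longrightarrow> x = 0"
  shows "bij T"
proof -
  have "inj T" using assms linear_injective_0 by blast
  then show ?thesis using lin linear_injective_imp_surjective by (auto simp: bij_def)
qed

text \<open>M agrees with L on E and maps the complement of E isometrically onto the complement of
  the image; injectivity of L makes the dimensions match. Substituting M on the whole space realises
  the change of variables by L on E.\<close>

lemma adapted_linear_map:
  fixes E :: "'a::euclidean_space set" and L :: "'a \<Rightarrow> 'a"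
  assumes E: "subspace E" and lin: "linear L" and inj: "inj L"
  obtains M c where "linear M" "bij M" "\<And>x. closest_point (L ` E) (M x) = L (closest_point E x)"
    "\<And>x. norm (M x - L (closest_point E x)) = norm (x - closest_point E x)"
    "0 < c" "distr lborel borel M = density lborel (\<lambda>_. ennreal c)" "inv_jac L E = ennreal c"
proof -
  let ?P = "closest_point E" and ?Q = "closest_point (L ` E)"
  have E': "subspace (L ` E)" using E lin by (rule linear_subspace_image[rotated])
  have dim: "dim (L ` E) = dim E"
    using dim_image_eq[OF lin] inj by (metis inj_on_subset subset_UNIV)
  have "dim (E\<^sup>\<bottom>) = dim ((L ` E)\<^sup>\<bottom>)"
    using dim_orthogonal_comp[OF E] dim_orthogonal_comp[OF E'] dim by simp
  then obtain f where f: "linear f" "f ` (E\<^sup>\<bottom>) = (L ` E)\<^sup>\<bottom>" "\<And>x. x \<in> E\<^sup>\<bottom> \<Longrightarrow> norm (f x) = norm x"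
    using isometries_subspaces[OF subspace_orthogonal_comp[of E] subspace_orthogonal_comp[of "L ` E"]] by metis
  define M where "M x = L (?P x) + f (x - ?P x)" for x
  have linP: "linear ?P" by (rule closest_point_subspace_linear[OF E])
  have linM: "linear M"
    unfolding M_def
    by (intro linear_compose_add linear_compose[OF linP lin, unfolded o_def]
        linear_compose[OF linear_compose_sub[OF linear_ident linP] f(1), unfolded o_def])
  have cp: "?Q (M x) = L (?P x)" for x
    unfolding M_def using f(2) closest_point_subspace_in[OF E] orthogonal_comp_closest_point[OF E]
    by (intro closest_point_add_orthogonal_comp[OF E']) auto
  have norm: "norm (M x - L (?P x)) = norm (x - ?P x)" for x
    by (simp add: M_def f(3) orthogonal_comp_closest_point[OF E])
  have bijM: "bij M"
  proof (rule linear_inj_bij[OF linM])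
    fix x assume "M x = 0"
    then have "L (?P x) = 0" using cp[of x] closest_point_subspace_self[OF E' subspace_0[OF E']] by simp
    then have "?P x = 0" using lin inj by (metis injD linear_0)
    then show "x = 0" using norm[of x] \<open>M x = 0\<close> linear_0[OF lin] by simp
  qed
  obtain c where c: "0 < c" "distr lborel borel M = density lborel (\<lambda>_. ennreal c)"
    using distr_lborel_linear_bij[OF linM bijM] by blast
  \<comment> \<open>Since \<open>M z\<close> has orthogonal components of norms
    \<open>norm (L (?P z))\<close> and \<open>norm (z - ?P z)\<close>, the two Gaussian factors
    combine to \<open>gauss (M z)\<close>.\<close>
  have "inv_jac L E = (\<integral>\<^sup>+ z. gauss (M z) \<partial>lborel)"
    unfolding inv_jac_def
  proof (intro nn_integral_cong gauss_mult)
    fix z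
    show "(norm (L (?P z)))\<^sup>2 + (norm (z - ?P z))\<^sup>2 = (norm (M z))\<^sup>2"
      using closest_point_subspace_pythagoras[OF E', of "M z"] by (simp add: cp norm)
  qed
  also have "\<dots> = ennreal c"
    by (simp add: nn_integral_lborel_linear[OF c(2) linM] nn_integral_gauss)
  finally show ?thesis using that linM bijM cp norm c by blast
qed

lemma inv_jac_pos_fin:
  fixes E :: "'a::euclidean_space set" and L :: "'a \<Rightarrow> 'a"
  assumes "subspace E" "linear L" "inj L"
  shows "inv_jac L E \<noteq> 0" "inv_jac L E \<noteq> \<infinity>"
  using adapted_linear_map[OF assms, of "inv_jac L E \<noteq> 0 \<and> inv_jac L E \<noteq> \<infinity>"] by auto

lemma nn_integral_flat_linear:
  fixes E :: "'a::euclidean_space set" and L :: "'a \<Rightarrow> 'a"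
  assumes E: "subspace E" and lin: "linear L" and inj: "inj L" and f[measurable]: "f \<in> borel_measurable borel"
  shows "(\<integral>\<^sup>+ x. f (L x) \<partial>flat_lborel E) = inv_jac L E * (\<integral>\<^sup>+ x. f x \<partial>flat_lborel (L ` E))"
proof -
  obtain M c where M: "linear M" "bij M" "\<And>x. closest_point (L ` E) (M x) = L (closest_point E x)"
    "\<And>x. norm (M x - L (closest_point E x)) = norm (x - closest_point E x)"
    "0 < c" "distr lborel borel M = density lborel (\<lambda>_. ennreal c)" "inv_jac L E = ennreal c"
    using adapted_linear_map[OF E lin inj] by metis
  have E': "subspace (L ` E)" using E lin by (rule linear_subspace_image[rotated])
  have [measurable]: "L \<in> borel_measurable borel" by (rule linear_borel_measurable[OF lin])
  have [measurable]: "closest_point (L ` E) \<in> borel_measurable borel" by (rule closest_point_subspace_measurable[OF E'])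
  have "(\<integral>\<^sup>+ x. f (L x) \<partial>flat_lborel E) = (\<integral>\<^sup>+ z. f (L (closest_point E z)) * gauss (z - closest_point E z) \<partial>lborel)"
    by (rule nn_integral_flat_lborel[OF E]) simp
  also have "\<dots> = (\<integral>\<^sup>+ z. f (closest_point (L ` E) (M z)) * gauss (M z - closest_point (L ` E) (M z)) \<partial>lborel)"
    by (intro nn_integral_cong arg_cong2[where f="(*)"] gauss_cong) (simp_all add: M)
  also have "\<dots> = ennreal c * (\<integral>\<^sup>+ z. f (closest_point (L ` E) z) * gauss (z - closest_point (L ` E) z) \<partial>lborel)"
    by (rule nn_integral_lborel_linear[OF M(6,1)]) measurable
  also have "\<dots> = inv_jac L E * (\<integral>\<^sup>+ x. f x \<partial>flat_lborel (L ` E))"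
    by (simp add: M nn_integral_flat_lborel[OF E'])
  finally show ?thesis .
qed

lemma distr_flat_lborel_affine:
  fixes E :: "'a::euclidean_space set" and L :: "'a \<Rightarrow> 'a" and z b :: 'a
  assumes E: "subspace E" and lin: "linear L" and inj: "inj L"
  defines "F \<equiv> (\<lambda>y. z + y) ` E" and "g \<equiv> \<lambda>x. L x + b"
  shows "distr (flat_lborel F) borel g = density (flat_lborel (g ` F)) (\<lambda>_. inv_jac L E)"
proof (rule measure_eqI)
  have E': "subspace (L ` E)" using E lin by (rule linear_subspace_image[rotated])
  have [measurable]: "L \<in> borel_measurable borel" by (rule linear_borel_measurable[OF lin])
  have gF: "g ` F = (\<lambda>y. g z + y) ` (L ` E)"
    by (auto simp: g_def F_def image_image linear_add[OF lin] algebra_simps)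
  fix A assume "A \<in> sets (distr (flat_lborel F) borel g)"
  then have [measurable]: "A \<in> sets borel" by simp
  have "emeasure (distr (flat_lborel F) borel g) A = (\<integral>\<^sup>+ x. indicator A (g (z + x)) \<partial>flat_lborel E)"
    unfolding F_def flat_lborel_translate[OF E] g_def
    by (subst nn_integral_indicator[symmetric], simp, subst nn_integral_distr, measurable)
      (subst nn_integral_distr, measurable)
  also have "\<dots> = (\<integral>\<^sup>+ x. indicator A (g z + L x) \<partial>flat_lborel E)"
    by (simp add: g_def linear_add[OF lin] add.assoc add.left_commute add.commute)
  also have "\<dots> = inv_jac L E * (\<integral>\<^sup>+ x. indicator A (g z + x) \<partial>flat_lborel (L ` E))"
    by (rule nn_integral_flat_linear[OF E lin inj, where f="\<lambda>x. indicator A (g z + x)"]) simp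
  also have "(\<integral>\<^sup>+ x. indicator A (g z + x) \<partial>flat_lborel (L ` E)) = emeasure (flat_lborel (g ` F)) A"
    unfolding gF flat_lborel_translate[OF E']
    by (subst nn_integral_indicator[symmetric], simp, subst nn_integral_distr) auto
  also have "inv_jac L E * emeasure (flat_lborel (g ` F)) A = emeasure (density (flat_lborel (g ` F)) (\<lambda>_. inv_jac L E)) A"
    by (subst emeasure_density_const) auto
  finally show "emeasure (distr (flat_lborel F) borel g) A = emeasure (density (flat_lborel (g ` F)) (\<lambda>_. inv_jac L E)) A" .
qed simp

text \<open>A shear \<open>z \<mapsto> z - X z\<close> with \<open>X\<^sup>2 = 0\<close> is conjugate to its inverse \<open>z \<mapsto> z + X z\<close> by the reflection in the range of \<open>X\<close>.\<close>

lemma nn_integral_shear: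
  fixes E :: "'a::euclidean_space set" and X :: "'a \<Rightarrow> 'a"
  assumes E: "subspace E" and lin: "linear X" and range: "\<And>z. X z \<in> E" and ker: "\<And>z. z \<in> E \<Longrightarrow> X z = 0"
    and f[measurable]: "f \<in> borel_measurable borel"
  shows "(\<integral>\<^sup>+ z. f (z - X z) \<partial>lborel) = (\<integral>\<^sup>+ z. f z \<partial>lborel)"
proof -
  let ?P = "closest_point E"
  define S where "S z = z - X z" for z
  define S' where "S' z = z + X z" for z
  define R where "R z = 2 *\<^sub>R ?P z - z" for z
  have linP: "linear ?P" by (rule closest_point_subspace_linear[OF E])
  have linS: "linear S" and linS': "linear S'" and linR: "linear R"
    using lin linP by (auto simp: S_def S'_def R_def linear_iff algebra_simps)
  have XX: "X (X z) = 0" for z using range ker by simp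
  have SS': "S (S' z) = z" and S'S: "S' (S z) = z" for z
    by (simp_all add: S_def S'_def linear_add[OF lin] linear_diff[OF lin] XX)
  have PR: "?P (R z) = ?P z" for z
    by (simp add: R_def linear_diff[OF linP] linear_scale[OF linP]
        closest_point_subspace_self[OF E closest_point_subspace_in[OF E]]) (simp add: scaleR_2)
  have normR: "norm (R z) = norm z" for z
  proof -
    note PR[of z]
    moreover have "R z - ?P z = - (z - ?P z)" by (simp add: R_def scaleR_2)
    ultimately have "(norm (R z))\<^sup>2 = (norm z)\<^sup>2"
      using closest_point_subspace_pythagoras[OF E, of "R z"] closest_point_subspace_pythagoras[OF E, of z]
      by (metis norm_minus_cancel)
    then show ?thesis by simp
  qed
  have RSR: "R (S (R z)) = S' z" for z
  proof -
    have 1: "X (R z) = - X z"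
      by (simp add: R_def linear_diff[OF lin] linear_scale[OF lin] ker closest_point_subspace_in[OF E])
    have 2: "R (X z) = X z" by (simp add: R_def closest_point_subspace_self[OF E range] scaleR_2)
    have 3: "R (R z) = z"
      by (subst R_def, subst PR) (simp add: R_def)
    show ?thesis by (simp add: S_def S'_def linear_add[OF linR] 1 2 3)
  qed
  have bij: "bij S" "bij S'" using SS' S'S by (auto intro!: o_bij simp: fun_eq_iff)
  obtain c where c: "0 < c" "distr lborel borel S = density lborel (\<lambda>_. ennreal c)"
    using distr_lborel_linear_bij[OF linS bij(1)] by blast
  obtain d where d: "0 < d" "distr lborel borel S' = density lborel (\<lambda>_. ennreal d)"
    using distr_lborel_linear_bij[OF linS' bij(2)] by blast
  have [measurable]: "S \<in> borel_measurable borel" by (rule linear_borel_measurable[OF linS])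
  have cg: "(\<integral>\<^sup>+ z. gauss (S z) \<partial>lborel) = ennreal c"
    by (simp add: nn_integral_lborel_linear[OF c(2) linS] nn_integral_gauss)
  \<comment> \<open>R is an isometry conjugating S into S', so the two maps have the same constant;
    being mutually inverse, they have constants with product 1.\<close>
  have "ennreal d = (\<integral>\<^sup>+ z. gauss (S' z) \<partial>lborel)"
    by (simp add: nn_integral_lborel_linear[OF d(2) linS'] nn_integral_gauss)
  also have "\<dots> = (\<integral>\<^sup>+ z. gauss (S (R z)) \<partial>lborel)"
    by (intro nn_integral_cong gauss_cong) (simp add: RSR[symmetric] normR)
  also have "\<dots> = ennreal c"
    by (subst nn_integral_lborel_isometry[OF linR normR, where f="\<lambda>z. gauss (S z)"]) (auto simp: cg)
  finally have "d = c" using c(1) d(1) by simp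
  have "1 = (\<integral>\<^sup>+ z. gauss (S (S' z)) \<partial>(lborel :: 'a measure))" by (simp add: SS' nn_integral_gauss)
  also have "\<dots> = ennreal d * ennreal c"
    by (subst nn_integral_lborel_linear[OF d(2) linS', where f="\<lambda>z. gauss (S z)"]) (auto simp: cg)
  finally have "ennreal (c * c) = 1" using \<open>d = c\<close> c(1) by (simp add: ennreal_mult')
  then have "c * c = 1" using c(1) by (simp add: ennreal_eq_1)
  then have "c = 1" using c(1) by (metis abs_of_pos power2_eq_square real_sqrt_abs real_sqrt_one)
  then show ?thesis using nn_integral_lborel_linear[OF c(2) linS f] by (simp add: S_def)
qed

text \<open>For u constant along the image of E, both integrals amount to integrals over orthogonal
  complements, and L acts as the induced map between the quotients by E and by its image. As L
  preserves volume, the distortion of that map is reciprocal to the one on E.\<close>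

lemma nn_integral_coset_function:
  fixes E :: "'a::euclidean_space set" and L :: "'a \<Rightarrow> 'a"
  assumes E: "subspace E" and lin: "linear L" and inj: "inj L" and vol: "distr lborel borel L = lborel"
    and u[measurable]: "u \<in> borel_measurable borel" and inv: "\<And>y v. v \<in> L ` E \<Longrightarrow> u (y + v) = u y"
  shows "inv_jac L E * (\<integral>\<^sup>+ z. u (L z + b) * gauss (closest_point E z) \<partial>lborel)
    = (\<integral>\<^sup>+ y. u y * gauss (closest_point (L ` E) y) \<partial>lborel)"
proof -
  let ?P = "closest_point E" and ?Q = "closest_point (L ` E)"
  have E': "subspace (L ` E)" using E lin by (rule linear_subspace_image[rotated])
  have linP: "linear ?P" and linQ: "linear ?Q" by (auto intro!: closest_point_subspace_linear E E')
  have [measurable]: "?P \<in> borel_measurable borel" "?Q \<in> borel_measurable borel" "L \<in> borel_measurable borel"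
    by (auto intro!: linear_borel_measurable linP linQ lin)
  have dim: "dim E = dim (L ` E)"
    using dim_image_eq[OF lin] inj by (metis inj_on_subset subset_UNIV)
  have dim': "dim (E\<^sup>\<bottom>) = dim ((L ` E)\<^sup>\<bottom>)"
    using dim_orthogonal_comp[OF E] dim_orthogonal_comp[OF E'] dim by simp
  obtain f where f: "linear f" "f ` (E\<^sup>\<bottom>) = (L ` E)\<^sup>\<bottom>" "\<And>x. x \<in> E\<^sup>\<bottom> \<Longrightarrow> norm (f x) = norm x"
    using isometries_subspaces[OF subspace_orthogonal_comp subspace_orthogonal_comp dim'] by metis
  obtain U U' where U: "linear U" "linear U'" "U ` E = L ` E" "\<And>x. x \<in> E \<Longrightarrow> norm (U x) = norm x"
    "\<And>x. x \<in> E \<Longrightarrow> U' (U x) = x"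
    using isometries_subspaces[OF E E' dim] by metis
  define L' where "L' = inv L"
  have bijL: "bij L" using lin inj linear_injective_imp_surjective by (auto simp: bij_def)
  have linL': "linear L'" unfolding L'_def using lin inj by (rule inj_linear_imp_inv_linear)
  have L'L: "L' (L x) = x" and LL': "L (L' x) = x" for x
    using bijL by (auto simp: L'_def bij_is_inj bij_is_surj surj_f_inv_f)
  have PP: "?P (?P z) = ?P z" and QQ: "?Q (?Q z) = ?Q z" for z
    by (auto intro!: closest_point_subspace_self closest_point_subspace_in E E')
  have QLP: "?Q (L (?P z)) = L (?P z)" for z
    by (intro closest_point_subspace_self E' imageI closest_point_subspace_in E)
  \<comment> \<open>N agrees with L modulo the image of E, so u sees no difference, but it is
    isometric on E, so the Gaussian weight is transported exactly.\<close>
  define N where "N z = (L z - ?Q (L z)) + U (?P z)" for z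
  \<comment> \<open>An isometry of the whole space taking E to its image; it rewrites
    \<open>inv_jac L E\<close> as an integral over the target side.\<close>
  define V where "V z = U (?P z) + f (z - ?P z)" for z
  have UE: "U (?P z) \<in> L ` E" for z using U(3) closest_point_subspace_in[OF E] by blast
  have linN: "linear N"
    using linP linQ U(1) lin by (auto simp: N_def linear_iff algebra_simps)
  have linV: "linear V"
    unfolding V_def
    by (intro linear_compose_add linear_compose[OF linP U(1), unfolded o_def]
        linear_compose[OF linear_compose_sub[OF linear_ident linP] f(1), unfolded o_def])
  have QN: "?Q (N z) = U (?P z)" for z
    unfolding N_def by (subst add.commute) (intro closest_point_add_orthogonal_comp[OF E' UE] orthogonal_comp_closest_point[OF E'])
  have QV: "?Q (V z) = U (?P z)" for z
    unfolding V_def using f(2) orthogonal_comp_closest_point[OF E] by (intro closest_point_add_orthogonal_comp[OF E' UE]) auto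
  have normU: "norm (U (?P z)) = norm (?P z)" for z by (simp add: U(4) closest_point_subspace_in[OF E])
  have normf: "norm (f (z - ?P z)) = norm (z - ?P z)" for z by (simp add: f(3) orthogonal_comp_closest_point[OF E])
  have normV: "norm (V z) = norm z" for z
  proof -
    have "V z - U (?P z) = f (z - ?P z)" by (simp add: V_def)
    then have "(norm (V z))\<^sup>2 = (norm z)\<^sup>2"
      using closest_point_subspace_pythagoras[OF E', of "V z"] closest_point_subspace_pythagoras[OF E, of z]
      by (simp add: QV normU normf)
    then show ?thesis by simp
  qed
  have bijN: "bij N"
  proof (rule linear_inj_bij[OF linN])
    fix z assume Nz: "N z = 0"
    then have "U (?P z) = 0" using QN[of z] linear_0[OF linQ] by simp
    then have P0: "?P z = 0" using normU[of z] by simp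
    then have "L z = ?Q (L z)" using Nz linear_0[OF U(1)] by (simp add: N_def)
    then have "L z \<in> L ` E" using closest_point_subspace_in[OF E', of "L z"] by simp
    then have "z \<in> E" using inj by (simp add: inj_image_mem_iff)
    then show "z = 0" using P0 closest_point_subspace_self[OF E] by simp
  qed
  obtain c where c: "0 < c" "distr lborel borel N = density lborel (\<lambda>_. ennreal c)"
    using distr_lborel_linear_bij[OF linN bijN] by blast
  \<comment> \<open>Only the component of b orthogonal to the image of E is kept: it does not affect
    the Gaussian weight, and u ignores the rest.\<close>
  define b' where "b' = b - ?Q b"
  have Qb': "?Q b' = 0" by (simp add: b'_def linear_diff[OF linQ] QQ)
  have ub: "u (L z + b) = u (N z + b')" for z
  proof -
    have "L z + b = (N z + b') + (?Q (L z) - U (?P z) + ?Q b)" by (simp add: N_def b'_def)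
    moreover have "?Q (L z) - U (?P z) + ?Q b \<in> L ` E"
      by (intro subspace_add subspace_diff E' UE closest_point_subspace_in)
    ultimately show ?thesis using inv by metis
  qed
  have "(\<integral>\<^sup>+ z. u (L z + b) * gauss (?P z) \<partial>lborel) = (\<integral>\<^sup>+ z. u (N z + b') * gauss (?Q (N z)) \<partial>lborel)"
    by (intro nn_integral_cong arg_cong2[where f="(*)"] gauss_cong) (simp_all add: ub QN normU)
  also have "\<dots> = ennreal c * (\<integral>\<^sup>+ y. u (y + b') * gauss (?Q y) \<partial>lborel)"
    by (rule nn_integral_lborel_linear[OF c(2) linN]) measurable
  also have "(\<integral>\<^sup>+ y. u (y + b') * gauss (?Q y) \<partial>lborel) = (\<integral>\<^sup>+ y. u (b' + y) * gauss (?Q (b' + y)) \<partial>lborel)"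
    by (simp add: linear_add[OF linQ] Qb' add.commute)
  also have "\<dots> = (\<integral>\<^sup>+ y. u y * gauss (?Q y) \<partial>distr lborel borel ((+) b'))"
    by (subst nn_integral_distr) auto
  finally have 1: "(\<integral>\<^sup>+ z. u (L z + b) * gauss (?P z) \<partial>lborel) = ennreal c * (\<integral>\<^sup>+ y. u y * gauss (?Q y) \<partial>lborel)"
    by (simp only: lborel_distr_plus)
  \<comment> \<open>The function h is built to have integral \<open>inv_jac L E\<close>, while its
    composition with N has integral 1. Comparing the two through the constant c of N gives
    \<open>ennreal c * inv_jac L E = 1\<close>.\<close>
  define h where "h w = gauss (L (U' (?Q w))) * gauss (w - ?Q w)" for w
  have [measurable]: "U' \<in> borel_measurable borel" by (rule linear_borel_measurable[OF U(2)])
  have h[measurable]: "h \<in> borel_measurable borel" unfolding h_def by measurable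
  have U'U: "U' (U (?P z)) = ?P z" for z by (simp add: U(5) closest_point_subspace_in[OF E])
  have hN: "h (N z) = gauss (L (?P z)) * gauss (L z - ?Q (L z))" for z
    by (simp add: h_def QN U'U) (simp add: N_def)
  have hV: "h (V z) = gauss (L (?P z)) * gauss (z - ?P z)" for z
    using gauss_cong[OF normf] by (simp add: h_def QV U'U) (simp add: V_def)
  have "inv_jac L E = (\<integral>\<^sup>+ z. h (V z) \<partial>lborel)" by (simp add: inv_jac_def hV)
  also have "\<dots> = (\<integral>\<^sup>+ z. h z \<partial>lborel)" by (rule nn_integral_lborel_isometry[OF linV normV h])
  finally have "ennreal c * inv_jac L E = (\<integral>\<^sup>+ z. h (N z) \<partial>lborel)"
    by (simp add: nn_integral_lborel_linear[OF c(2) linN h])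
  also have "\<dots> = (\<integral>\<^sup>+ z. gauss (L (z - L' (?Q (L (z - ?P z))))) \<partial>lborel)"
  proof (intro nn_integral_cong)
    fix z
    \<comment> \<open>Subtracting a suitable element of E from z makes the component of its image
      under L along the image of E equal to \<open>L (?P z)\<close>. The correction vanishes for z
      in E, so it is a shear and preserves Lebesgue measure.\<close>
    let ?w = "L (z - L' (?Q (L (z - ?P z))))"
    have w: "?w = (L z - ?Q (L z)) + L (?P z)"
      by (simp add: linear_diff[OF lin] LL' linear_diff[OF linQ] QLP)
    have Qw: "?Q ?w = L (?P z)"
      unfolding w linear_add[OF linQ] linear_diff[OF linQ] QQ QLP by simp
    show "h (N z) = gauss ?w"
      unfolding hN using closest_point_subspace_pythagoras[OF E', of ?w]
      by (intro gauss_mult) (simp add: Qw, simp add: w)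
  qed
  also have "\<dots> = (\<integral>\<^sup>+ z. gauss (L z) \<partial>lborel)"
  proof (rule nn_integral_shear[OF E, where f="\<lambda>z. gauss (L z)"])
    show "linear (\<lambda>z. L' (?Q (L (z - ?P z))))"
      by (rule linear_compose[OF linear_compose[OF linear_compose[OF
              linear_compose_sub[OF linear_ident linP] lin] linQ] linL', unfolded o_def])
    show "L' (?Q (L (z - ?P z))) \<in> E" for z
      using closest_point_subspace_in[OF E', of "L (z - ?P z)"] L'L by auto
    show "L' (?Q (L (z - ?P z))) = 0" if "z \<in> E" for z
      using that by (simp add: closest_point_subspace_self[OF E] linear_0[OF lin] linear_0[OF linQ] linear_0[OF linL'])
  qed simp
  also have "\<dots> = (\<integral>\<^sup>+ z. gauss z \<partial>distr lborel borel L)"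
    by (subst nn_integral_distr) auto
  finally have "ennreal c * inv_jac L E = 1" by (simp add: vol nn_integral_gauss)
  then show ?thesis unfolding 1 by (metis mult.assoc mult.commute mult.left_neutral)
qed

section \<open>Measures agreeing on balls\<close>

text \<open>Mollification: \<open>u n\<close> averages, over balls of radius \<open>r n\<close>, the
  indicator of those centres whose ball lies in U. By Fubini its integral depends only on the masses
  of balls; it stays below the indicator of U and is eventually 1 at each point of U, so Fatou's
  lemma gives the claim.\<close>

lemma emeasure_open_le_if_balls_eq:
  fixes M N :: "'a::euclidean_space measure"
  assumes sM[measurable_cong]: "sets M = sets borel" and sN[measurable_cong]: "sets N = sets borel"
    and sfM: "sigma_finite_measure M" and sfN: "sigma_finite_measure N"
    and eq: "\<And>x r. 0 < r \<Longrightarrow> emeasure M (ball x r) = emeasure N (ball x r)"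
    and U: "open U"
  shows "emeasure M U \<le> emeasure N U"
proof -
  interpret PM: pair_sigma_finite M "lborel :: 'a measure"
    using sfM by (simp add: pair_sigma_finite_def lborel.sigma_finite_measure_axioms)
  interpret PN: pair_sigma_finite N "lborel :: 'a measure"
    using sfN by (simp add: pair_sigma_finite_def lborel.sigma_finite_measure_axioms)
  have [simp]: "space M = UNIV" "space N = UNIV"
    using sets_eq_imp_space_eq[OF sM] sets_eq_imp_space_eq[OF sN] by simp_all
  have [measurable]: "U \<in> sets borel" using U by simp
  define r where "r n = inverse (real (Suc n))" for n
  have r: "0 < r n" for n by (simp add: r_def)
  \<comment> \<open>Averaging over \<open>S n\<close> instead of U makes \<open>u n\<close> vanish
    outside U.\<close>
  define S where "S n = {B. ball B (r n) \<subseteq> U}" for n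
  have [measurable]: "S n \<in> sets borel" for n
  proof -
    have "- S n = (\<Union>y\<in>- U. ball y (r n))"
      by (force simp: S_def dist_commute)
    then have "open (- S n)" by (metis open_UN open_ball)
    then have "closed (S n)" by (simp add: closed_def)
    then show ?thesis by simp
  qed
  define V where "V n = emeasure lborel (ball (0::'a) (r n))" for n
  have V: "V n \<noteq> 0" "V n \<noteq> \<infinity>" for n
    using emeasure_lborel_open_pos[of "ball (0::'a) (r n)" 0] r emeasure_lborel_ball_finite[of "0::'a" "r n"]
    by (auto simp: V_def)
  have Vx: "emeasure lborel (ball x (r n)) = V n" for x :: 'a and n
  proof -
    have vim: "(+) x -` ball x (r n) = ball 0 (r n)" by (auto simp: dist_norm)
    have "V n = emeasure (distr lborel borel ((+) x)) (ball x (r n))"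
      unfolding V_def by (subst emeasure_distr) (auto simp: vim)
    then show ?thesis by (simp only: lborel_distr_plus)
  qed
  define u where "u n A = (\<integral>\<^sup>+ B. indicator (S n) B * indicator {x. dist A x < r n} B \<partial>lborel) / V n" for n and A :: 'a
  have meas_dist[measurable]: "(\<lambda>(A, B). indicator {x. dist A x < r n} B :: ennreal) \<in> borel_measurable (borel \<Otimes>\<^sub>M (borel :: 'a measure))" for n
  proof -
    have "(\<lambda>(A, B). indicator {x. dist A x < r n} B :: ennreal) = indicator {p \<in> space (borel \<Otimes>\<^sub>M (borel :: 'a measure)). dist (fst p) (snd p) < r n}"
      by (auto simp: fun_eq_iff indicator_def space_pair_measure)
    also have "\<dots> \<in> borel_measurable (borel \<Otimes>\<^sub>M (borel :: 'a measure))"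
      by measurable
    finally show ?thesis .
  qed
  have [measurable]: "u n \<in> borel_measurable borel" for n
    unfolding u_def by measurable
  have integral_u: "(\<integral>\<^sup>+ A. u n A \<partial>Q) = (\<integral>\<^sup>+ B. indicator (S n) B * emeasure Q (ball B (r n)) \<partial>lborel) / V n"
    if sQ[measurable_cong]: "sets Q = sets borel" and PQ: "pair_sigma_finite Q (lborel :: 'a measure)" for Q n
  proof -
    interpret PQ: pair_sigma_finite Q "lborel :: 'a measure" by (rule PQ)
    have [simp]: "space Q = UNIV" using sets_eq_imp_space_eq[OF sQ] by simp
    have "(\<integral>\<^sup>+ A. u n A \<partial>Q) = (\<integral>\<^sup>+ A. (\<integral>\<^sup>+ B. indicator (S n) B * indicator {x. dist A x < r n} B \<partial>lborel) \<partial>Q) / V n"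
      unfolding u_def by (rule nn_integral_divide) measurable
    also have "(\<integral>\<^sup>+ A. (\<integral>\<^sup>+ B. indicator (S n) B * indicator {x. dist A x < r n} B \<partial>lborel) \<partial>Q) =
        (\<integral>\<^sup>+ B. (\<integral>\<^sup>+ A. indicator (S n) B * indicator {x. dist A x < r n} B \<partial>Q) \<partial>lborel)"
      by (rule PQ.Fubini'[symmetric]) measurable
    also have "\<dots> = (\<integral>\<^sup>+ B. indicator (S n) B * emeasure Q (ball B (r n)) \<partial>lborel)"
    proof (intro nn_integral_cong)
      fix B :: 'a
      have "(\<integral>\<^sup>+ A. indicator (S n) B * indicator {x. dist A x < r n} B \<partial>Q) = (\<integral>\<^sup>+ A. indicator (S n) B * indicator (ball B (r n)) A \<partial>Q)"
        by (intro nn_integral_cong) (auto simp: indicator_def dist_commute)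
      also have "\<dots> = indicator (S n) B * emeasure Q (ball B (r n))"
        by (rule nn_integral_cmult_indicator) (simp add: sQ)
      finally show "(\<integral>\<^sup>+ A. indicator (S n) B * indicator {x. dist A x < r n} B \<partial>Q) = indicator (S n) B * emeasure Q (ball B (r n))" .
    qed
    finally show ?thesis .
  qed
  have u_le: "u n A \<le> indicator U A" for n A
  proof (cases "A \<in> U")
    case True
    have "(\<integral>\<^sup>+ B. indicator (S n) B * indicator {x. dist A x < r n} B \<partial>lborel) \<le> (\<integral>\<^sup>+ B. indicator (ball A (r n)) B \<partial>lborel)"
      by (intro nn_integral_mono) (auto simp: indicator_def)
    then have "u n A \<le> V n / V n"
      unfolding u_def by (intro divide_right_mono_ennreal) (simp add: Vx)
    then show ?thesis using True V by (simp add: ennreal_divide_self less_top)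
  next
    case False
    then have z: "indicator (S n) B * indicator {x. dist A x < r n} B = (0::ennreal)" for B
      by (auto simp: indicator_def S_def subset_eq dist_commute)
    show ?thesis unfolding u_def z by simp
  qed
  have u_1: "\<forall>\<^sub>F n in sequentially. u n A = 1" if A: "A \<in> U" for A
  proof -
    obtain e where "0 < e" and e: "ball A e \<subseteq> U" using U A open_contains_ball by blast
    obtain n0 where n0: "inverse (real (Suc n0)) < e / 2" using reals_Archimedean[of "e / 2"] \<open>0 < e\<close> by auto
    have "u n A = 1" if "n0 \<le> n" for n
    proof -
      have rn: "r n < e / 2"
        using n0 that unfolding r_def by (meson le_imp_inverse_le le_less_trans of_nat_0_less_iff of_nat_le_iff Suc_le_mono zero_less_Suc)
      have "indicator (S n) B * indicator {x. dist A x < r n} B = (indicator (ball A (r n)) B :: ennreal)" for B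
      proof -
        have "B \<in> S n" if "dist A B < r n"
        proof -
          have "ball B (r n) \<subseteq> ball A e"
          proof
            fix y assume "y \<in> ball B (r n)"
            then have "dist A y < e" using dist_triangle[of A y B] that rn by simp
            then show "y \<in> ball A e" by simp
          qed
          then show ?thesis using e by (auto simp: S_def)
        qed
        then show ?thesis by (auto simp: indicator_def)
      qed
      then show ?thesis using V Vx by (simp add: u_def ennreal_divide_self less_top)
    qed
    then show ?thesis by (auto simp: eventually_sequentially)
  qed
  have "emeasure M U = (\<integral>\<^sup>+ A. indicator U A \<partial>M)" by (simp add: sM)
  also have "\<dots> \<le> (\<integral>\<^sup>+ A. liminf (\<lambda>n. u n A) \<partial>M)"
  proof (intro nn_integral_mono)
    fix A
    show "indicator U A \<le> liminf (\<lambda>n. u n A)"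
    proof (cases "A \<in> U")
      case True
      have "1 \<le> liminf (\<lambda>n. u n A)"
        by (rule Liminf_bounded) (use u_1[OF True] in \<open>auto elim: eventually_mono\<close>)
      then show ?thesis using True by simp
    qed simp
  qed
  also have "\<dots> \<le> liminf (\<lambda>n. \<integral>\<^sup>+ A. u n A \<partial>M)" by (rule nn_integral_liminf) measurable
  also have "\<dots> = liminf (\<lambda>n. \<integral>\<^sup>+ A. u n A \<partial>N)"
    using r by (simp add: integral_u sM sN PM.pair_sigma_finite_axioms PN.pair_sigma_finite_axioms eq)
  also have "\<dots> \<le> emeasure N U"
  proof -
    have "(\<integral>\<^sup>+ A. u n A \<partial>N) \<le> emeasure N U" for n
    proof -
      have "(\<integral>\<^sup>+ A. u n A \<partial>N) \<le> (\<integral>\<^sup>+ A. indicator U A \<partial>N)" by (intro nn_integral_mono u_le)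
      then show ?thesis by (simp add: sN)
    qed
    then show ?thesis by (intro Liminf_le) auto
  qed
  finally show ?thesis .
qed

text \<open>Balls are not stable under intersection, so agreement is first extended to open sets,
  which are, by \<open>emeasure_open_le_if_balls_eq\<close> in both directions. N inherits
  finiteness on balls from M.\<close>

lemma measure_eqI_balls:
  fixes M N :: "'a::euclidean_space measure"
  assumes sM: "sets M = sets borel" and sN: "sets N = sets borel"
    and fin: "\<And>r. emeasure M (ball 0 r) < \<infinity>"
    and eq: "\<And>x r. 0 < r \<Longrightarrow> emeasure M (ball x r) = emeasure N (ball x r)"
  shows "M = N"
proof -
  have un: "(\<Union>n. ball (0::'a) (real n)) = UNIV"
    using reals_Archimedean2 by auto
  have fin': "emeasure N (ball 0 r) \<noteq> \<infinity>" "emeasure M (ball 0 r) \<noteq> \<infinity>" for r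
    using eq[of r 0] fin[of r] by (cases "0 < r"; simp add: ball_empty)+
  have sf: "sigma_finite_measure Q" if "sets Q = sets borel" "\<And>r. emeasure Q (ball 0 r) \<noteq> \<infinity>" for Q :: "'a measure"
    using that un sets_eq_imp_space_eq[OF that(1)]
    by unfold_locales (intro exI[of _ "range (\<lambda>n. ball 0 (real n))"], auto)
  note le = emeasure_open_le_if_balls_eq[OF sM sN sf[OF sM fin'(2)] sf[OF sN fin'(1)] eq]
  note ge = emeasure_open_le_if_balls_eq[OF sN sM sf[OF sN fin'(1)] sf[OF sM fin'(2)] eq[symmetric]]
  show ?thesis
  proof (rule measure_eqI_generator_eq[where E="{S. open S}" and \<Omega>=UNIV and A="\<lambda>n. ball 0 (real n)"])
    show "Int_stable {S :: 'a set. open S}" by (auto simp: Int_stable_def)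
    show "sets M = sigma_sets UNIV {S. open S}" "sets N = sigma_sets UNIV {S. open S}"
      by (simp_all add: sM sN borel_def)
    show "emeasure M X = emeasure N X" if "X \<in> {S. open S}" for X
      using le[of X] ge[of X] that by (intro antisym) auto
  qed (use un fin' in auto)
qed

section \<open>A matrix and its transpose are orthogonally equivalent\<close>

lemma compact_orthogonal_matrices: "compact {Q :: real ^ 'n ^ 'n. orthogonal_matrix Q}"
proof -
  have bd: "norm Q \<le> real CARD('n)" if "orthogonal_matrix Q" for Q :: "real ^ 'n ^ 'n"
  proof -
    have "norm Q \<le> (\<Sum>i\<in>UNIV. norm (Q $ i))"
      unfolding norm_vec_def[of Q] by (rule L2_set_le_sum) simp
    also have "\<dots> = (\<Sum>i\<in>(UNIV::'n set). 1)"
      using that by (intro sum.cong) (simp_all add: orthogonal_matrix_orthonormal_rows row_def)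
    finally show ?thesis by simp
  qed
  have "closed {Q :: real ^ 'n ^ 'n. transpose Q ** Q = mat 1}"
    unfolding matrix_matrix_mult_def transpose_def by (intro closed_Collect_eq continuous_intros)
  then have "closed {Q :: real ^ 'n ^ 'n. orthogonal_matrix Q}" by (simp add: orthogonal_matrix)
  moreover have "bounded {Q :: real ^ 'n ^ 'n. orthogonal_matrix Q}"
    using bd by (auto simp: bounded_iff)
  ultimately show ?thesis by (simp add: compact_eq_bounded_closed)
qed

definition givens :: "'n::finite \<Rightarrow> 'n \<Rightarrow> real \<Rightarrow> real ^ 'n ^ 'n" where
  "givens i j t = (\<chi> a b. if a = b then (if a = i \<or> a = j then cos t else 1)
     else if a = i \<and> b = j then - sin t else if a = j \<and> b = i then sin t else 0)"

lemma givens_mult_vec: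
  fixes x :: "real ^ 'n"
  assumes "i \<noteq> j"
  shows "givens i j t *v x = (\<chi> a. if a = i then cos t * x $ i - sin t * x $ j
    else if a = j then sin t * x $ i + cos t * x $ j else x $ a)"
proof -
  have "(givens i j t *v x) $ a = (if a = i then cos t * x $ i - sin t * x $ j
    else if a = j then sin t * x $ i + cos t * x $ j else x $ a)" for a
  proof -
    have "(givens i j t *v x) $ a = (\<Sum>b\<in>UNIV. (if b = a then (if a = i \<or> a = j then cos t else 1) * x $ a else 0)
      + (if b = j then (if a = i then - sin t * x $ j else 0) else 0)
      + (if b = i then (if a = j then sin t * x $ i else 0) else 0))"
      unfolding matrix_vector_mult_def givens_def using assms
      by (simp only: vec_lambda_beta, intro sum.cong refl) auto
    then show ?thesis using assms by (simp add: sum.distrib)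
  qed
  then show ?thesis by (simp add: vec_eq_iff)
qed

lemma orthogonal_givens:
  assumes "i \<noteq> j"
  shows "orthogonal_matrix (givens i j t)"
proof -
  have "norm (givens i j t *v x) = norm x" for x :: "real ^ 'a"
  proof -
    let ?y = "givens i j t *v x"
    have y: "?y $ i = cos t * x $ i - sin t * x $ j" "?y $ j = sin t * x $ i + cos t * x $ j"
      "\<And>a. a \<noteq> i \<Longrightarrow> a \<noteq> j \<Longrightarrow> ?y $ a = x $ a"
      using assms by (auto simp: givens_mult_vec)
    have split: "(\<Sum>a\<in>UNIV. h a) = h i + h j + (\<Sum>a\<in>UNIV - {i, j}. h a)" for h :: "'a \<Rightarrow> real"
    proof -
      have "(\<Sum>a\<in>UNIV. h a) = (\<Sum>a\<in>UNIV - {i, j}. h a) + (\<Sum>a\<in>{i, j}. h a)"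
        by (rule sum.subset_diff) auto
      then show ?thesis using assms by simp
    qed
    have "(\<Sum>a\<in>UNIV. (?y $ a)\<^sup>2) = (\<Sum>a\<in>UNIV. (x $ a)\<^sup>2)"
    proof -
      have "(\<Sum>a\<in>UNIV - {i, j}. (?y $ a)\<^sup>2) = (\<Sum>a\<in>UNIV - {i, j}. (x $ a)\<^sup>2)"
        by (intro sum.cong) (auto simp: y(3))
      moreover have "(cos t * x $ i - sin t * x $ j)\<^sup>2 + (sin t * x $ i + cos t * x $ j)\<^sup>2
          = ((cos t)\<^sup>2 + (sin t)\<^sup>2) * ((x $ i)\<^sup>2 + (x $ j)\<^sup>2)"
        by algebra
      ultimately show ?thesis
        unfolding split[of "\<lambda>a. (?y $ a)\<^sup>2"] split[of "\<lambda>a. (x $ a)\<^sup>2"] y(1,2) by simp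
    qed
    then show ?thesis by (simp add: norm_vec_def L2_set_def)
  qed
  then have "orthogonal_transformation ((*v) (givens i j t))"
    by (simp add: orthogonal_transformation matrix_vector_mul_linear)
  then show ?thesis by (simp add: orthogonal_transformation_matrix)
qed

text \<open>The derivative in t at 0 is \<open>S $ i $ j - S $ j $ i\<close>, so stationarity of the
  trace under this rotation means symmetry of S in these entries.\<close>

lemma trace_givens_mult:
  fixes S :: "real ^ 'n ^ 'n"
  assumes "i \<noteq> j"
  shows "trace (givens i j t ** S) = trace S + (cos t - 1) * (S $ i $ i + S $ j $ j) + sin t * (S $ i $ j - S $ j $ i)"
proof -
  have col: "(givens i j t ** S) $ a $ a = (if a = i then cos t * S $ i $ a - sin t * S $ j $ a
    else if a = j then sin t * S $ i $ a + cos t * S $ j $ a else S $ a $ a)" for a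
  proof -
    have "(givens i j t ** S) $ a $ a = (givens i j t *v column a S) $ a"
      by (simp add: matrix_matrix_mult_def matrix_vector_mult_def column_def)
    then show ?thesis using assms by (simp add: givens_mult_vec column_def)
  qed
  have "trace (givens i j t ** S) = (\<Sum>a\<in>UNIV. S $ a $ a
      + (if a = i then (cos t - 1) * S $ i $ i - sin t * S $ j $ i else 0)
      + (if a = j then (cos t - 1) * S $ j $ j + sin t * S $ i $ j else 0))"
    unfolding trace_def col using assms by (intro sum.cong) (auto simp: algebra_simps)
  then show ?thesis using assms by (simp add: sum.distrib trace_def algebra_simps)
qed

text \<open>The left side vanishes at t = 0, so it is maximal there, and its derivative at 0 is
  x.\<close>

lemma trig_extremum_zero:
  fixes x y :: real
  assumes "\<And>t. (cos t - 1) * y + sin t * x \<le> 0"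
  shows "x = 0"
proof -
  have "((\<lambda>t. (cos t - 1) * y + sin t * x) has_real_derivative x) (at 0)"
    by (auto intro!: derivative_eq_intros)
  then show ?thesis
    by (rule DERIV_local_max[where d=1]) (use assms in auto)
qed

text \<open>If \<open>Q\<close> maximises the trace of \<open>Q A\<close> over the orthogonal group, then \<open>Q A\<close> is symmetric.\<close>

lemma transpose_orthogonally_equivalent:
  fixes A :: "real ^ 'n ^ 'n"
  obtains Q where "orthogonal_matrix Q" "transpose A = Q ** A ** Q"
proof -
  have "continuous_on {Q :: real ^ 'n ^ 'n. orthogonal_matrix Q} (\<lambda>Q. trace (Q ** A))"
    unfolding trace_def matrix_matrix_mult_def by (intro continuous_intros)
  then obtain Q where Q: "orthogonal_matrix Q"
    and max: "\<And>R. orthogonal_matrix R \<Longrightarrow> trace (R ** A) \<le> trace (Q ** A)"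
    using continuous_attains_sup[OF compact_orthogonal_matrices] orthogonal_matrix_id by blast
  define S where "S = Q ** A"
  have "S $ i $ j = S $ j $ i" for i j
  proof (cases "i = j")
    case False
    have "(cos t - 1) * (S $ i $ i + S $ j $ j) + sin t * (S $ i $ j - S $ j $ i) \<le> 0" for t
      using max[OF orthogonal_matrix_mul[OF orthogonal_givens[OF False, of t] Q]] trace_givens_mult[OF False, of t S]
      by (simp add: S_def matrix_mul_assoc)
    then have "S $ i $ j - S $ j $ i = 0" by (rule trig_extremum_zero)
    then show ?thesis by simp
  qed simp
  then have sym: "transpose (Q ** A) = Q ** A"
    by (simp add: transpose_def vec_eq_iff S_def)
  have "transpose A = transpose A ** (transpose Q ** Q)"
    using Q by (simp add: orthogonal_matrix)
  also have "\<dots> = transpose (Q ** A) ** Q"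
    by (simp add: matrix_transpose_mul matrix_mul_assoc)
  finally have "transpose A = Q ** A ** Q" by (simp add: sym)
  then show ?thesis using that Q by blast
qed

section \<open>Spaces of matrices\<close>

lemma borel_measurable_vecI:
  fixes f :: "'x \<Rightarrow> 'b::euclidean_space ^ 'n"
  assumes "\<And>i. (\<lambda>x. f x $ i) \<in> borel_measurable M"
  shows "f \<in> borel_measurable M"
  by (subst borel_measurable_euclidean_space)
    (auto simp: Basis_vec_def inner_axis intro!: borel_measurable_inner assms)

lemma borel_measurable_vec_nth[measurable (raw)]:
  fixes f :: "'x \<Rightarrow> 'b::euclidean_space ^ 'n"
  assumes "f \<in> borel_measurable M"
  shows "(\<lambda>x. f x $ i) \<in> borel_measurable M"
  using assms by (rule measurable_compose) (intro borel_measurable_continuous_onI continuous_intros)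

lemma borel_measurable_matrix_mult[measurable (raw)]:
  fixes f :: "'x \<Rightarrow> real ^ 'm ^ 'n" and g :: "'x \<Rightarrow> real ^ 'k ^ 'm"
  assumes [measurable]: "f \<in> borel_measurable M" "g \<in> borel_measurable M"
  shows "(\<lambda>x. f x ** g x) \<in> borel_measurable M"
  by (intro borel_measurable_vecI) (simp add: matrix_matrix_mult_def)

lemma borel_measurable_matrix_vector_mult[measurable (raw)]:
  fixes f :: "'x \<Rightarrow> real ^ 'm ^ 'n" and g :: "'x \<Rightarrow> real ^ 'm"
  assumes [measurable]: "f \<in> borel_measurable M" "g \<in> borel_measurable M"
  shows "(\<lambda>x. f x *v g x) \<in> borel_measurable M"
  by (intro borel_measurable_vecI) (simp add: matrix_vector_mult_def)

lemma borel_measurable_transpose[measurable (raw)]: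
  fixes f :: "'x \<Rightarrow> real ^ 'm ^ 'n"
  assumes [measurable]: "f \<in> borel_measurable M"
  shows "(\<lambda>x. transpose (f x)) \<in> borel_measurable M"
  by (intro borel_measurable_vecI) (simp add: transpose_def)

lemma borel_measurable_trace[measurable (raw)]:
  fixes f :: "'x \<Rightarrow> real ^ 'n ^ 'n"
  assumes [measurable]: "f \<in> borel_measurable M"
  shows "(\<lambda>x. trace (f x)) \<in> borel_measurable M"
  unfolding trace_def by measurable

lemma subspace_range_matrix: "subspace (range ((*v) (A :: real ^ 'n ^ 'm)))"
  by (intro linear_subspace_image matrix_vector_mul_linear subspace_UNIV)

definition proj_range :: "real ^ 'n ^ 'n \<Rightarrow> real ^ 'n ^ 'n" where
  "proj_range A = proj_mat (range ((*v) A))"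

lemma borel_measurable_proj_range[measurable]: "proj_range \<in> borel_measurable borel"
proof -
  let ?P = "\<lambda>A :: real ^ 'n ^ 'n. closest_point (range ((*v) A))"
  have dist: "(\<lambda>A. norm (x - ?P A x)) \<in> borel_measurable borel" for x :: "real ^ 'n"
  proof (rule borel_measurableI_less)
    fix a
    have "norm (x - ?P A x) < a \<longleftrightarrow> (\<exists>q. norm (x - A *v q) < a)" for A :: "real ^ 'n ^ 'n"
    proof
      assume "norm (x - ?P A x) < a"
      moreover obtain q where "?P A x = A *v q"
        using closest_point_subspace_in[OF subspace_range_matrix[of A], of x] by auto
      ultimately show "\<exists>q. norm (x - A *v q) < a" by auto
    next
      assume "\<exists>q. norm (x - A *v q) < a"
      then obtain q where "norm (x - A *v q) < a" by blast
      moreover have "dist x (?P A x) \<le> dist x (A *v q)"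
        by (intro closest_point_le closed_subspace subspace_range_matrix) auto
      ultimately show "norm (x - ?P A x) < a" by (simp add: dist_norm)
    qed
    then have "{A. norm (x - ?P A x) < a} = (\<Union>q. {A. norm (x - A *v q) < a})" by auto
    moreover have "open (\<Union>q. {A :: real ^ 'n ^ 'n. norm (x - A *v q) < a})"
      unfolding matrix_vector_mult_def by (intro open_UN ballI open_Collect_less continuous_intros)
    ultimately show "{A \<in> space borel. norm (x - ?P A x) < a} \<in> sets borel" by simp
  qed
  have norm2: "(\<lambda>A. (norm (?P A x))\<^sup>2) \<in> borel_measurable borel" for x :: "real ^ 'n"
  proof -
    have "(norm (?P A x))\<^sup>2 = (norm x)\<^sup>2 - (norm (x - ?P A x))\<^sup>2" for A
      using closest_point_subspace_pythagoras[OF subspace_range_matrix[of A], of x] by linarith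
    then show ?thesis using dist[of x] by simp
  qed
  have entry: "proj_range A $ i $ j = ((norm (?P A (axis i 1 + axis j 1)))\<^sup>2 - (norm (?P A (axis i 1 - axis j 1)))\<^sup>2) / 4"
    for A :: "real ^ 'n ^ 'n" and i j
  proof -
    note lin = closest_point_subspace_linear[OF subspace_range_matrix[of A]]
    have "?P A x \<bullet> ?P A y = x \<bullet> ?P A y" for x y
      using closest_point_subspace_orth[OF subspace_range_matrix closest_point_subspace_in[OF subspace_range_matrix], of x A y]
      by (simp add: inner_diff_left)
    moreover have "(norm (?P A (x + y)))\<^sup>2 - (norm (?P A (x - y)))\<^sup>2 = 4 * (?P A x \<bullet> ?P A y)" for x y
      unfolding linear_add[OF lin] linear_diff[OF lin] power2_norm_eq_inner inner_add_left inner_add_right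
          inner_diff_left inner_diff_right inner_commute[of "?P A y" "?P A x"] by simp
    ultimately have "(norm (?P A (x + y)))\<^sup>2 - (norm (?P A (x - y)))\<^sup>2 = 4 * (x \<bullet> ?P A y)" for x y
      by metis
    then show ?thesis
      by (simp add: proj_range_def matrix_def inner_axis')
  qed
  have "(\<lambda>A :: real ^ 'n ^ 'n. proj_range A $ i $ j) \<in> borel_measurable borel" for i j
    unfolding entry by (intro borel_measurable_divide borel_measurable_diff norm2 borel_measurable_const)
  then show ?thesis by (intro borel_measurable_vecI)
qed

lemma row_matrix_mult: "(A ** B) $ i = transpose B *v (A $ i)" for A :: "real ^ 'n ^ 'm"
  by (simp add: vec_eq_iff matrix_matrix_mult_def matrix_vector_mult_def transpose_def mult.commute)

lemma norm_matrix_sq: "(norm (A :: real ^ 'n ^ 'm))\<^sup>2 = (\<Sum>i\<in>UNIV. (norm (A $ i))\<^sup>2)"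
  by (simp add: norm_vec_def L2_set_def sum_nonneg)

lemma norm_matrix_sq': "(norm (A :: real ^ 'n ^ 'm))\<^sup>2 = (\<Sum>i\<in>UNIV. \<Sum>j\<in>UNIV. (A $ i $ j)\<^sup>2)"
  by (simp add: norm_matrix_sq) (simp add: norm_vec_def L2_set_def sum_nonneg)

lemma norm_transpose: "norm (transpose A) = norm (A :: real ^ 'n ^ 'm)"
proof -
  have "(norm (transpose A))\<^sup>2 = (norm A)\<^sup>2"
    unfolding norm_matrix_sq' by (subst sum.swap) (simp add: transpose_def)
  then show ?thesis by simp
qed

lemma norm_orthogonal_mult_right:
  assumes "orthogonal_matrix (H :: real ^ 'n ^ 'n)"
  shows "norm (Z ** H) = norm (Z :: real ^ 'n ^ 'm)"
proof -
  have "orthogonal_transformation ((*v) (transpose H))"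
    using assms by (simp add: orthogonal_transformation_matrix)
  then have "norm ((Z ** H) $ i) = norm (Z $ i)" for i
    unfolding row_matrix_mult by (rule orthogonal_transformation_norm)
  then have "(norm (Z ** H))\<^sup>2 = (norm Z)\<^sup>2" by (simp add: norm_matrix_sq)
  then show ?thesis by simp
qed

lemma norm_orthogonal_mult_left:
  assumes "orthogonal_matrix (H :: real ^ 'n ^ 'n)"
  shows "norm (H ** Z) = norm (Z :: real ^ 'm ^ 'n)"
proof -
  have "norm (H ** Z) = norm (transpose Z ** transpose H)"
    by (metis matrix_transpose_mul norm_transpose)
  also have "\<dots> = norm Z"
    using assms by (simp add: norm_orthogonal_mult_right norm_transpose)
  finally show ?thesis .
qed

lemma linear_matrix_mult_right: "linear (\<lambda>Z :: real ^ 'n ^ 'm. Z ** (H :: real ^ 'k ^ 'n))"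
  by (rule linearI) (simp_all add: vec_eq_iff matrix_matrix_mult_def sum.distrib algebra_simps sum_distrib_left)

lemma linear_transpose: "linear (transpose :: real ^ 'n ^ 'm \<Rightarrow> _)"
  by (rule linearI) (simp_all add: vec_eq_iff transpose_def)

lemma matrix_mult_diff_right: "(A :: real ^ 'n ^ 'm) ** (B - C) = A ** B - A ** C"
  by (simp add: vec_eq_iff matrix_matrix_mult_def algebra_simps sum_subtractf)

lemma matrix_mult_diff_left: "((B :: real ^ 'n ^ 'm) - C) ** A = B ** A - C ** A"
  by (simp add: vec_eq_iff matrix_matrix_mult_def algebra_simps sum_subtractf)

lemma transpose_diff: "transpose (A - B) = transpose A - transpose (B :: real ^ 'n ^ 'm)"
  by (simp add: vec_eq_iff transpose_def)

lemma gauss_proj_mult: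
  fixes E :: "(real ^ 'n) set" and Z :: "real ^ 'n ^ 'm"
  assumes E: "subspace E"
  shows "gauss (Z ** proj_mat E) * gauss (Z - Z ** proj_mat E) = gauss Z"
proof (rule gauss_mult)
  have "(norm ((Z ** proj_mat E) $ i))\<^sup>2 + (norm ((Z - Z ** proj_mat E) $ i))\<^sup>2 = (norm (Z $ i))\<^sup>2" for i
    using closest_point_subspace_pythagoras[OF E, of "Z $ i"]
    by (simp add: row_matrix_mult transpose_proj_mat[OF E] proj_mat_mult[OF E])
  then show "(norm (Z ** proj_mat E))\<^sup>2 + (norm (Z - Z ** proj_mat E))\<^sup>2 = (norm Z)\<^sup>2"
    by (simp add: norm_matrix_sq sum.distrib[symmetric])
qed

definition coord_proj :: "'n set \<Rightarrow> real ^ 'n ^ 'n" where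
  "coord_proj K = (\<chi> i j. if i = j \<and> i \<in> K then 1 else 0)"

lemma coord_proj_mult: "coord_proj K ** V = (\<chi> i. if i \<in> K then V $ i else 0)" for V :: "real ^ 'm ^ 'n"
proof -
  have "(\<Sum>l\<in>UNIV. coord_proj K $ i $ l * V $ l $ j) = (\<Sum>l\<in>UNIV. if l = i then (if i \<in> K then V $ i $ j else 0) else 0)" for i j
    by (intro sum.cong) (auto simp: coord_proj_def)
  then show ?thesis by (simp add: vec_eq_iff matrix_matrix_mult_def)
qed

lemma transpose_coord_proj: "transpose (coord_proj K) = coord_proj K"
  by (auto simp: coord_proj_def transpose_def vec_eq_iff)

text \<open>The columns of H form an orthonormal basis adapted to E and its complement, and K marks
  those in E. Projecting rows onto E thereby becomes deleting coordinates.\<close>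

lemma proj_mat_diagonalize:
  fixes E :: "(real ^ 'n) set"
  assumes E: "subspace E"
  obtains H K where "orthogonal_matrix H" "proj_mat E = H ** coord_proj K ** transpose H"
proof -
  obtain B1 where B1: "orthonormal_basis E B1" using orthonormal_basis_exists[OF E] by blast
  obtain B2 where B2: "orthonormal_basis (E\<^sup>\<bottom>) B2"
    using orthonormal_basis_exists[OF subspace_orthogonal_comp] by blast
  note B = orthonormal_basis_Un(2)[OF E B1 B2]
  note cp = closest_point_orthonormal[OF subspace_UNIV B] and cp1 = closest_point_orthonormal[OF E B1]
  have "card (B1 \<union> B2) = card (UNIV :: 'n set)" using cp(3) by simp
  then obtain \<beta> where \<beta>: "bij_betw \<beta> (UNIV :: 'n set) (B1 \<union> B2)"
    by (metis bij_betw_iff_card cp(1) finite)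
  have \<beta>B: "\<beta> i \<in> B1 \<union> B2" for i using bij_betwE[OF \<beta>] by blast
  have inj: "\<beta> i = \<beta> j \<longleftrightarrow> i = j" for i j using bij_betw_imp_inj_on[OF \<beta>] by (simp add: inj_eq)
  have \<beta>ip: "\<beta> i \<bullet> \<beta> j = (if i = j then 1 else 0)" for i j
    by (simp only: orthonormal_basis_inner[OF B \<beta>B \<beta>B] inj)
  define K where "K = \<beta> -` B1"
  define H :: "real ^ 'n ^ 'n" where "H = (\<chi> i j. \<beta> j $ i)"
  have col: "transpose H $ j = \<beta> j" for j by (simp add: H_def transpose_def vec_eq_iff)
  have "(transpose H ** H) $ i $ j = \<beta> i \<bullet> \<beta> j" for i j
    by (simp add: H_def matrix_matrix_mult_def transpose_def inner_vec_def)
  then have orth: "orthogonal_matrix H"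
    by (simp add: orthogonal_matrix vec_eq_iff mat_def \<beta>ip)
  have "(H ** coord_proj K ** transpose H) *v x = proj_mat E *v x" for x
  proof -
    have tH: "(transpose H *v x) $ j = \<beta> j \<bullet> x" for j
      by (simp add: H_def transpose_def matrix_vector_mult_def inner_vec_def)
    have Hy: "H *v y = (\<Sum>j\<in>UNIV. (y $ j) *\<^sub>R \<beta> j)" for y
      by (simp add: vec_eq_iff H_def matrix_vector_mult_def mult.commute)
    have cK: "coord_proj K *v y = (\<chi> i. if i \<in> K then y $ i else 0)" for y
    proof -
      have "(\<Sum>l\<in>UNIV. coord_proj K $ i $ l * y $ l) = (\<Sum>l\<in>UNIV. if l = i then (if i \<in> K then y $ i else 0) else 0)" for i
        by (intro sum.cong) (auto simp: coord_proj_def)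
      then show ?thesis by (simp add: vec_eq_iff matrix_vector_mult_def)
    qed
    have "(H ** coord_proj K ** transpose H) *v x = H *v (coord_proj K *v (transpose H *v x))"
      by (simp only: matrix_vector_mul_assoc matrix_mul_assoc)
    also have "\<dots> = (\<Sum>j\<in>UNIV. (if j \<in> K then \<beta> j \<bullet> x else 0) *\<^sub>R \<beta> j)"
      unfolding Hy cK vec_lambda_beta tH ..
    also have "\<dots> = (\<Sum>j\<in>K. (x \<bullet> \<beta> j) *\<^sub>R \<beta> j)"
      by (subst sum.mono_neutral_right[of UNIV K]) (auto simp: inner_commute)
    also have "\<dots> = (\<Sum>b\<in>B1. (x \<bullet> b) *\<^sub>R b)"
    proof (rule sum.reindex_bij_betw)
      show "bij_betw \<beta> K B1"
        using bij_betw_subset[OF \<beta>, of K B1] bij_betw_imp_surj_on[OF \<beta>]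
        by (auto simp: K_def)
    qed
    also have "\<dots> = proj_mat E *v x" by (simp add: proj_mat_mult[OF E] cp1(2))
    finally show ?thesis .
  qed
  then have "proj_mat E = H ** coord_proj K ** transpose H"
    by (metis matrix_eq)
  then show ?thesis using that orth by blast
qed

text \<open>Left multiplication acts on columns, while membership in the fibre constrains rows. Once
  E is rotated to a coordinate subspace, a matrix with rows in E is a tuple of free columns, and G
  preserves Lebesgue measure on each of them.\<close>

lemma nn_integral_left_mult_proj:
  fixes E :: "(real ^ 'n) set" and G :: "real ^ 'n ^ 'n" and f :: "real ^ 'n ^ 'n \<Rightarrow> ennreal"
  assumes E: "subspace E" and G: "distr lborel borel ((*v) G) = lborel" and detG: "bij ((*v) G)"
    and f[measurable]: "f \<in> borel_measurable borel"
  shows "(\<integral>\<^sup>+ Z. f (G ** (Z ** proj_mat E)) * gauss (Z - Z ** proj_mat E) \<partial>lborel)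
    = (\<integral>\<^sup>+ Z. f (Z ** proj_mat E) * gauss (Z - Z ** proj_mat E) \<partial>lborel)"
proof -
  obtain H K where H: "orthogonal_matrix H" and PH: "proj_mat E = H ** coord_proj K ** transpose H"
    using proj_mat_diagonalize[OF E] by blast
  let ?D = "coord_proj K"
  have tH: "orthogonal_matrix (transpose H)" using H by simp
  have HH: "transpose H ** H = mat 1" using H by (simp add: orthogonal_matrix)
  define h where "h G V = f (G ** (transpose (?D ** V) ** transpose H)) * gauss (V - ?D ** V)" for G V :: "real ^ 'n ^ 'n"
  have [measurable]: "h G \<in> borel_measurable borel" for G
    unfolding h_def by measurable
  have rot: "(\<integral>\<^sup>+ Z. f (G ** (Z ** proj_mat E)) * gauss (Z - Z ** proj_mat E) \<partial>lborel) = (\<integral>\<^sup>+ V. h G V \<partial>lborel)" for G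
  proof -
    \<comment> \<open>Transposing turns columns into rows, the form that
      \<open>distr_lborel_rows\<close> handles.\<close>
    let ?T = "\<lambda>V :: real ^ 'n ^ 'n. transpose V ** transpose H"
    have linT: "linear ?T"
      by (rule linear_compose[OF linear_transpose linear_matrix_mult_right, unfolded o_def])
    have normT: "norm (?T V) = norm V" for V
      by (simp add: norm_orthogonal_mult_right[OF tH] norm_transpose)
    have "(\<integral>\<^sup>+ Z. f (G ** (Z ** proj_mat E)) * gauss (Z - Z ** proj_mat E) \<partial>lborel)
      = (\<integral>\<^sup>+ V. f (G ** (?T V ** proj_mat E)) * gauss (?T V - ?T V ** proj_mat E) \<partial>lborel)"
      by (rule nn_integral_lborel_isometry[OF linT normT, symmetric]) measurable
    also have "\<dots> = (\<integral>\<^sup>+ V. h G V \<partial>lborel)"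
    proof (intro nn_integral_cong)
      fix V
      have TP: "?T V ** proj_mat E = transpose (?D ** V) ** transpose H"
        unfolding PH matrix_transpose_mul transpose_coord_proj
        by (metis (no_types) HH matrix_mul_assoc matrix_mul_lid)
      have "?T V - transpose (?D ** V) ** transpose H = transpose (V - ?D ** V) ** transpose H"
        by (simp add: transpose_diff matrix_mult_diff_left)
      then show "f (G ** (?T V ** proj_mat E)) * gauss (?T V - ?T V ** proj_mat E) = h G V"
        unfolding h_def TP
        by (intro arg_cong2[where f="(*)"] refl gauss_cong) (simp add: norm_orthogonal_mult_right[OF tH] norm_transpose)
    qed
    finally show ?thesis .
  qed
  \<comment> \<open>The Gaussian weight in h sees only the rows outside K, which T leaves
    alone.\<close>
  define T where "T i = (if i \<in> K then (*v) G else (\<lambda>x. x))" for i :: 'n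
  have dT: "distr lborel borel (T i) = density lborel (\<lambda>_. ennreal 1)" for i
    using G distr_id2[of borel "lborel :: (real ^ 'n) measure"] by (simp add: T_def density_1)
  have linT: "linear (T i)" and bijT: "bij (T i)" for i
    using detG by (auto simp: T_def matrix_vector_mul_linear linear_ident bij_id[unfolded id_def])
  define TT where "TT V = (\<chi> i. T i (V $ i))" for V :: "real ^ 'n ^ 'n"
  have TT: "distr lborel borel TT = density lborel (\<lambda>_. ennreal 1)"
    using distr_lborel_rows[of T "\<lambda>_. 1", OF linT bijT _ dT] by (simp add: TT_def[abs_def])
  have linTT: "linear TT"
    unfolding TT_def using linT by (intro linearI) (simp_all add: vec_eq_iff linear_add linear_scale)
  have "h G V = h (mat 1) (TT V)" for V
  proof -
    have "?D ** TT V = (?D ** V) ** transpose G"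
      by (simp add: coord_proj_mult TT_def T_def vec_eq_iff[where 'b='n] row_matrix_mult)
    then have 1: "transpose (?D ** TT V) = G ** transpose (?D ** V)"
      by (simp add: matrix_transpose_mul)
    have 2: "TT V - ?D ** TT V = V - ?D ** V"
      by (simp add: coord_proj_mult TT_def T_def vec_eq_iff[where 'b='n])
    show ?thesis unfolding h_def 1 2 by (simp add: matrix_mul_assoc)
  qed
  then have "(\<integral>\<^sup>+ V. h G V \<partial>lborel) = (\<integral>\<^sup>+ V. h (mat 1) (TT V) \<partial>lborel)" by simp
  also have "\<dots> = (\<integral>\<^sup>+ V. h (mat 1) V \<partial>lborel)"
    using nn_integral_lborel_linear[OF TT linTT, of "h (mat 1)"] by simp
  finally show ?thesis
    using rot[of G] rot[of "mat 1"] by simp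
qed

section \<open>The Haar measure of the Grassmannian under linear maps\<close>

text \<open>The map from \<open>adapted_linear_map\<close> is applied to every row, and each of the
  CARD('n) rows contributes one factor \<open>inv_jac L E\<close>.\<close>

lemma nn_integral_right_mult_proj:
  fixes E :: "(real ^ 'n) set" and L :: "real ^ 'n \<Rightarrow> real ^ 'n" and f :: "real ^ 'n ^ 'n \<Rightarrow> ennreal"
  assumes E: "subspace E" and lin: "linear L" and inj: "inj L" and f[measurable]: "f \<in> borel_measurable borel"
  shows "(\<integral>\<^sup>+ Z. f (Z ** proj_mat E ** transpose (matrix L)) * gauss (Z - Z ** proj_mat E) \<partial>lborel)
    = inv_jac L E ^ CARD('n) * (\<integral>\<^sup>+ Z. f (Z ** proj_mat (L ` E)) * gauss (Z - Z ** proj_mat (L ` E)) \<partial>lborel)"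
proof -
  have E': "subspace (L ` E)" using E lin by (rule linear_subspace_image[rotated])
  obtain M c where M: "linear M" "bij M" "\<And>x. closest_point (L ` E) (M x) = L (closest_point E x)"
    "\<And>x. norm (M x - L (closest_point E x)) = norm (x - closest_point E x)"
    "0 < c" "distr lborel borel M = density lborel (\<lambda>_. ennreal c)" "inv_jac L E = ennreal c"
    using adapted_linear_map[OF E lin inj] by metis
  define T where "T Z = (\<chi> i. M (Z $ i))" for Z :: "real ^ 'n ^ 'n"
  have T: "distr lborel borel T = density lborel (\<lambda>_. ennreal (c ^ CARD('n)))"
    using distr_lborel_rows[of "\<lambda>_ :: 'n. M" "\<lambda>_. c", OF M(1,2,5,6)] by (simp add: T_def[abs_def])
  have linT: "linear T"
    unfolding T_def using M(1) by (intro linearI) (simp_all add: vec_eq_iff linear_add linear_scale)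
  have mL: "matrix L *v x = L x" for x using lin by (simp add: matrix_works linear_matrix_vector_mul_eq)
  have 1: "Z ** proj_mat E ** transpose (matrix L) = T Z ** proj_mat (L ` E)" for Z
  proof -
    have "(Z ** proj_mat E ** transpose (matrix L)) $ i = (T Z ** proj_mat (L ` E)) $ i" for i
      unfolding row_matrix_mult transpose_transpose transpose_proj_mat[OF E] transpose_proj_mat[OF E']
        proj_mat_mult[OF E] proj_mat_mult[OF E'] mL T_def vec_lambda_beta M(3) ..
    then show ?thesis by (simp add: vec_eq_iff)
  qed
  have 2: "gauss (Z - Z ** proj_mat E) = gauss (T Z - T Z ** proj_mat (L ` E))" for Z
  proof (rule gauss_cong)
    have "norm ((T Z - T Z ** proj_mat (L ` E)) $ i) = norm ((Z - Z ** proj_mat E) $ i)" for i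
      unfolding vector_minus_component row_matrix_mult transpose_proj_mat[OF E] transpose_proj_mat[OF E']
        proj_mat_mult[OF E] proj_mat_mult[OF E'] T_def vec_lambda_beta M(3) M(4) ..
    then have "(norm (Z - Z ** proj_mat E))\<^sup>2 = (norm (T Z - T Z ** proj_mat (L ` E)))\<^sup>2"
      unfolding norm_matrix_sq by simp
    then show "norm (Z - Z ** proj_mat E) = norm (T Z - T Z ** proj_mat (L ` E))" by simp
  qed
  show ?thesis
    unfolding 1 2
    by (subst nn_integral_lborel_linear[OF T linT, where f="\<lambda>W. f (W ** proj_mat (L ` E)) * gauss (W - W ** proj_mat (L ` E))"])
      (auto simp: M(7) ennreal_power M(5) less_imp_le)
qed

lemma measurable_vimage_algebra_map:
  assumes "\<And>x. x \<in> space N \<Longrightarrow> g x \<in> X" "(\<lambda>x. f (g x)) \<in> measurable N M"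
  shows "g \<in> measurable N (vimage_algebra X f M)"
  using assms by (intro measurable_vimage_algebra2) auto

lemma proj_mat_linear_image:
  fixes L :: "real ^ 'n \<Rightarrow> real ^ 'n" and E :: "(real ^ 'n) set"
  assumes E: "subspace E" and lin: "linear L"
  shows "proj_mat (L ` E) = proj_range (matrix L ** proj_mat E)"
proof -
  have "matrix L *v x = L x" for x using lin by (simp add: matrix_works linear_matrix_vector_mul_eq)
  then have "(*v) (matrix L ** proj_mat E) = L \<circ> (*v) (proj_mat E)"
    by (simp add: fun_eq_iff matrix_vector_mul_assoc[symmetric])
  then have "range ((*v) (matrix L ** proj_mat E)) = L ` range ((*v) (proj_mat E))"
    by (simp only: image_comp)
  then show ?thesis by (simp only: proj_range_def proj_mat_range[OF E])
qed

locale haar_grassmannian =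
  fixes k :: nat and \<mu> :: "(real ^ 'n) set measure"
  assumes haar: "grassmannian_haar k \<mu>"
begin

lemma prob_space_mu: "prob_space \<mu>" and sets_mu: "sets \<mu> = sets (grassmannian_borel k)"
  using haar by (auto simp: grassmannian_haar_def)

sublocale prob_space \<mu> by (rule prob_space_mu)

lemma space_mu: "space \<mu> = grassmannian k"
  using sets_eq_imp_space_eq[OF sets_mu] by (simp add: grassmannian_borel_def)

lemma subspace_mu: "E \<in> space \<mu> \<Longrightarrow> subspace E" and dim_mu: "E \<in> space \<mu> \<Longrightarrow> dim E = k"
  by (auto simp: space_mu grassmannian_def)

lemma measurable_proj_mat[measurable]: "proj_mat \<in> borel_measurable \<mu>"
proof -
  have "proj_mat \<in> borel_measurable (grassmannian_borel k)"
    unfolding grassmannian_borel_def by (intro measurable_vimage_algebra1) auto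
  then show ?thesis using measurable_cong_sets[OF sets_mu refl] by blast
qed

lemma linear_image_grassmannian:
  assumes "E \<in> grassmannian k" "linear L" "inj L"
  shows "L ` E \<in> grassmannian k"
  using assms by (auto simp: grassmannian_def linear_subspace_image intro: dim_image_eq[THEN trans] inj_on_subset)

lemma measurable_linear_image_mu:
  assumes lin: "linear L" and inj: "inj L"
  shows "(\<lambda>E. L ` E) \<in> measurable \<mu> \<mu>"
proof -
  have "(\<lambda>E. L ` E) \<in> measurable \<mu> (grassmannian_borel k)"
    unfolding grassmannian_borel_def
  proof (rule measurable_vimage_algebra_map)
    show "L ` E \<in> grassmannian k" if "E \<in> space \<mu>" for E
      using that lin inj by (simp add: space_mu linear_image_grassmannian)
    have "(\<lambda>E. proj_range (matrix L ** proj_mat E)) \<in> borel_measurable \<mu>" by measurable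
    then show "(\<lambda>E. proj_mat (L ` E)) \<in> borel_measurable \<mu>"
      by (subst measurable_cong[where g="\<lambda>E. proj_range (matrix L ** proj_mat E)"])
        (auto simp: proj_mat_linear_image subspace_mu lin)
  qed
  then show ?thesis using measurable_cong_sets[OF refl sets_mu] by blast
qed

lemma nn_integral_orthogonal_image:
  assumes h: "orthogonal_transformation h" and \<phi>: "\<phi> \<in> borel_measurable \<mu>"
  shows "(\<integral>\<^sup>+ E. \<phi> (h ` E) \<partial>\<mu>) = (\<integral>\<^sup>+ E. \<phi> E \<partial>\<mu>)"
proof -
  have [measurable]: "(\<lambda>E. h ` E) \<in> measurable \<mu> \<mu>"
    using h by (intro measurable_linear_image_mu orthogonal_transformation_linear orthogonal_transformation_inj)
  have "distr \<mu> \<mu> (\<lambda>E. h ` E) = \<mu>" using haar h by (simp add: grassmannian_haar_def)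
  then show ?thesis using nn_integral_distr[of "\<lambda>E. h ` E" \<mu> \<mu> \<phi>] \<phi> by simp
qed

text \<open>The integral of f against Lebesgue measure on the matrices with rows in E, in the
  Gaussian form of \<open>nn_integral_flat_lborel\<close>: right multiplication by
  \<open>proj_mat E\<close> projects every row onto E.\<close>

definition fibre_integral :: "(real ^ 'n ^ 'n \<Rightarrow> ennreal) \<Rightarrow> (real ^ 'n) set \<Rightarrow> ennreal" where
  "fibre_integral f E = (\<integral>\<^sup>+ Z. f (Z ** proj_mat E) * gauss (Z - Z ** proj_mat E) \<partial>lborel)"

text \<open>The measure \<open>\<integral> \<lambda>\<^sub>E d\<mu>(E)\<close>, where \<open>\<lambda>\<^sub>E\<close> is Lebesgue measure on the matrices with all rows in \<open>E\<close>.\<close>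

definition row_measure :: "(real ^ 'n ^ 'n) measure" where
  "row_measure = distr (density (\<mu> \<Otimes>\<^sub>M lborel) (\<lambda>(E, Z). gauss (Z - Z ** proj_mat E))) borel (\<lambda>(E, Z). Z ** proj_mat E)"

lemma measurable_fibre_integral[measurable]:
  assumes [measurable]: "f \<in> borel_measurable borel"
  shows "fibre_integral f \<in> borel_measurable \<mu>"
  unfolding fibre_integral_def by measurable

lemma sets_row_measure[simp, measurable_cong]: "sets row_measure = sets borel"
  by (simp add: row_measure_def)

lemma nn_integral_row_measure:
  assumes [measurable]: "f \<in> borel_measurable borel"
  shows "(\<integral>\<^sup>+ A. f A \<partial>row_measure) = (\<integral>\<^sup>+ E. fibre_integral f E \<partial>\<mu>)"
proof -
  have "(\<integral>\<^sup>+ A. f A \<partial>row_measure) = (\<integral>\<^sup>+ (E, Z). f (Z ** proj_mat E) * gauss (Z - Z ** proj_mat E) \<partial>(\<mu> \<Otimes>\<^sub>M lborel))"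
    unfolding row_measure_def
    by (subst nn_integral_distr, measurable, subst nn_integral_density, measurable)
      (auto intro!: nn_integral_cong simp: mult.commute split_beta)
  also have "\<dots> = (\<integral>\<^sup>+ E. fibre_integral f E \<partial>\<mu>)"
    unfolding fibre_integral_def by (subst lborel.nn_integral_fst[symmetric]) auto
  finally show ?thesis .
qed

text \<open>Right multiplication by H carries the fibre over E isometrically to the fibre over the
  image of E under \<open>transpose H\<close>. It thus only permutes fibres, and the orthogonal
  invariance of \<mu> absorbs this.\<close>

lemma row_measure_mult_right:
  assumes H: "orthogonal_matrix H" and [measurable]: "f \<in> borel_measurable borel"
  shows "(\<integral>\<^sup>+ A. f (A ** H) \<partial>row_measure) = (\<integral>\<^sup>+ A. f A \<partial>row_measure)"
proof -
  let ?h = "(*v) (transpose H)"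
  have h: "orthogonal_transformation ?h" using H by (simp add: orthogonal_transformation_matrix)
  have HH: "H ** transpose H = mat 1" using H by (simp add: orthogonal_matrix_def)
  have "fibre_integral (\<lambda>A. f (A ** H)) E = fibre_integral f (?h ` E)" if E: "subspace E" for E
  proof -
    have P: "proj_mat (?h ` E) = transpose H ** proj_mat E ** H"
      using proj_mat_orthogonal_image[OF E h] by simp
    have ZH: "Z ** H ** proj_mat (?h ` E) = Z ** proj_mat E ** H" for Z
      unfolding P by (metis HH matrix_mul_assoc matrix_mul_rid)
    have norm: "norm (Z ** H - Z ** H ** proj_mat (?h ` E)) = norm (Z - Z ** proj_mat E)" for Z
      unfolding ZH matrix_mult_diff_left[symmetric] by (rule norm_orthogonal_mult_right[OF H])
    have "fibre_integral (\<lambda>A. f (A ** H)) E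
      = (\<integral>\<^sup>+ Z. f (Z ** H ** proj_mat (?h ` E)) * gauss (Z ** H - Z ** H ** proj_mat (?h ` E)) \<partial>lborel)"
      unfolding fibre_integral_def gauss_cong[OF norm] unfolding ZH ..
    also have "\<dots> = fibre_integral f (?h ` E)"
      unfolding fibre_integral_def
      by (rule nn_integral_lborel_isometry[OF linear_matrix_mult_right norm_orthogonal_mult_right[OF H],
            where f="\<lambda>W. f (W ** proj_mat (?h ` E)) * gauss (W - W ** proj_mat (?h ` E))"]) measurable
    finally show ?thesis .
  qed
  then have "(\<integral>\<^sup>+ A. f (A ** H) \<partial>row_measure) = (\<integral>\<^sup>+ E. fibre_integral f (?h ` E) \<partial>\<mu>)"
    by (subst nn_integral_row_measure) (auto intro!: nn_integral_cong simp: subspace_mu)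
  also have "\<dots> = (\<integral>\<^sup>+ A. f A \<partial>row_measure)"
    by (subst nn_integral_orthogonal_image[OF h]) (auto simp: nn_integral_row_measure)
  finally show ?thesis .
qed

lemma row_measure_mult_left:
  assumes G: "distr lborel borel ((*v) G) = lborel" "bij ((*v) G)" and [measurable]: "f \<in> borel_measurable borel"
  shows "(\<integral>\<^sup>+ A. f (G ** A) \<partial>row_measure) = (\<integral>\<^sup>+ A. f A \<partial>row_measure)"
proof -
  have "fibre_integral (\<lambda>A. f (G ** A)) E = fibre_integral f E" if "subspace E" for E
    unfolding fibre_integral_def using nn_integral_left_mult_proj[OF that G, of f] by simp
  then show ?thesis
    by (subst (1 2) nn_integral_row_measure) (auto intro!: nn_integral_cong simp: subspace_mu)
qed

lemma row_measure_orthogonal_left: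
  assumes H: "orthogonal_matrix H" and f: "f \<in> borel_measurable borel"
  shows "(\<integral>\<^sup>+ A. f (H ** A) \<partial>row_measure) = (\<integral>\<^sup>+ A. f A \<partial>row_measure)"
proof -
  have h: "orthogonal_transformation ((*v) H)" using H by (simp add: orthogonal_transformation_matrix)
  then have "linear ((*v) H)" "\<And>x. norm (H *v x) = norm x"
    by (auto simp: orthogonal_transformation_linear orthogonal_transformation_norm)
  then show ?thesis
    by (intro row_measure_mult_left f distr_lborel_isometry orthogonal_transformation_bij h)
qed

lemma nn_integral_gauss_row_measure: "(\<integral>\<^sup>+ A. gauss A \<partial>row_measure) = 1"
proof -
  have "fibre_integral gauss E = 1" if "subspace E" for E
    unfolding fibre_integral_def gauss_proj_mult[OF that] by (rule nn_integral_gauss)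
  then have "(\<integral>\<^sup>+ E. fibre_integral gauss E \<partial>\<mu>) = (\<integral>\<^sup>+ E. 1 \<partial>\<mu>)"
    by (intro nn_integral_cong) (simp add: subspace_mu)
  then have "(\<integral>\<^sup>+ A. gauss A \<partial>row_measure) = (\<integral>\<^sup>+ E. 1 \<partial>\<mu>)"
    by (simp only: nn_integral_row_measure[OF gauss_measurable])
  then show ?thesis by (simp add: emeasure_space_1)
qed

text \<open>The Gaussian has integral 1 and is bounded below on each ball. This local finiteness is
  required by \<open>measure_eqI_balls\<close>.\<close>

lemma row_measure_ball_finite: "emeasure row_measure (ball 0 r) < \<infinity>"
proof -
  have "emeasure row_measure (ball 0 r) = (\<integral>\<^sup>+ A. indicator (ball 0 r) A \<partial>row_measure)" by simp
  also have "\<dots> \<le> (\<integral>\<^sup>+ A. ennreal (exp (pi * r\<^sup>2)) * gauss A \<partial>row_measure)"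
  proof (intro nn_integral_mono)
    fix A :: "real ^ 'n ^ 'n"
    show "indicator (ball 0 r) A \<le> ennreal (exp (pi * r\<^sup>2)) * gauss A"
    proof (cases "A \<in> ball 0 r")
      case True
      then have "(norm A)\<^sup>2 \<le> r\<^sup>2" by (intro power_mono) auto
      then have "0 \<le> pi * r\<^sup>2 + - (pi * (norm A)\<^sup>2)" by simp
      then have "1 \<le> exp (pi * r\<^sup>2) * exp (- (pi * (norm A)\<^sup>2))"
        unfolding exp_add[symmetric] by (simp only: one_le_exp_iff)
      then show ?thesis using True by (simp add: gauss_def ennreal_mult'[symmetric])
    qed simp
  qed
  also have "\<dots> = ennreal (exp (pi * r\<^sup>2))"
    by (subst nn_integral_cmult) (auto simp: nn_integral_gauss_row_measure)
  finally show ?thesis by (simp add: le_less_trans)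
qed

text \<open>Gelfand's argument: \<open>row_measure\<close> is invariant under the orthogonal group from both sides, and every
  matrix is in the same double coset as its transpose.\<close>

lemma row_measure_transpose: "distr row_measure borel transpose = row_measure"
proof (rule measure_eqI_balls[symmetric])
  have [measurable]: "transpose \<in> borel_measurable (borel :: (real ^ 'n ^ 'n) measure)"
    using borel_measurable_transpose[of "\<lambda>x. x"] by simp
  fix B :: "real ^ 'n ^ 'n" and r :: real
  have ball[measurable]: "ball B r \<in> sets borel" by simp
  \<comment> \<open>Q varies with the centre B, but a single Q serves the whole ball around it; this
    is why balls are suitable test sets.\<close>
  obtain Q where Q: "orthogonal_matrix Q" and BQ: "transpose B = Q ** B ** Q"
    using transpose_orthogonally_equivalent .
  have QQ: "Q ** transpose Q = mat 1" "transpose Q ** Q = mat 1" using Q by (auto simp: orthogonal_matrix_def)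
  have dist: "dist B (transpose A) = dist B (transpose Q ** (A ** transpose Q))" for A
  proof -
    have "dist B (transpose A) = norm (transpose B - A)"
      unfolding dist_norm by (metis norm_transpose transpose_diff transpose_transpose)
    also have "transpose B - A = Q ** (B - transpose Q ** (A ** transpose Q)) ** Q"
    proof -
      have "Q ** (transpose Q ** (A ** transpose Q)) ** Q = (Q ** transpose Q) ** A ** (transpose Q ** Q)"
        by (simp only: matrix_mul_assoc)
      then show ?thesis
        unfolding matrix_mult_diff_left matrix_mult_diff_right BQ by (simp add: QQ)
    qed
    also have "norm \<dots> = dist B (transpose Q ** (A ** transpose Q))"
      by (simp add: dist_norm norm_orthogonal_mult_right[OF Q] norm_orthogonal_mult_left[OF Q])
    finally show ?thesis .
  qed
  have "emeasure (distr row_measure borel transpose) (ball B r) = (\<integral>\<^sup>+ A. indicator (ball B r) (transpose A) \<partial>row_measure)"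
    by (subst nn_integral_indicator[symmetric], simp, subst nn_integral_distr) auto
  also have "\<dots> = (\<integral>\<^sup>+ A. indicator (ball B r) (transpose Q ** (A ** transpose Q)) \<partial>row_measure)"
    by (intro nn_integral_cong) (simp add: indicator_def dist)
  also have "\<dots> = (\<integral>\<^sup>+ A. indicator (ball B r) (transpose Q ** A) \<partial>row_measure)"
    using Q by (intro row_measure_mult_right[where f="\<lambda>A. indicator (ball B r) (transpose Q ** A)"]) auto
  also have "\<dots> = (\<integral>\<^sup>+ A. indicator (ball B r) A \<partial>row_measure)"
    using Q by (intro row_measure_orthogonal_left borel_measurable_indicator ball) simp
  finally show "emeasure row_measure (ball B r) = emeasure (distr row_measure borel transpose) (ball B r)"
    by simp
qed (use row_measure_ball_finite in simp_all)

lemma row_measure_mult_right_transpose: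
  assumes G: "distr lborel borel ((*v) G) = lborel" "bij ((*v) G)" and [measurable]: "f \<in> borel_measurable borel"
  shows "(\<integral>\<^sup>+ A. f (A ** transpose G) \<partial>row_measure) = (\<integral>\<^sup>+ A. f A \<partial>row_measure)"
proof -
  have [measurable]: "transpose \<in> borel_measurable (borel :: (real ^ 'n ^ 'n) measure)"
    using borel_measurable_transpose[of "\<lambda>x. x"] by simp
  have "(\<integral>\<^sup>+ A. f (A ** transpose G) \<partial>row_measure) = (\<integral>\<^sup>+ A. f (transpose (G ** A)) \<partial>row_measure)"
    by (subst row_measure_transpose[symmetric], subst nn_integral_distr) (auto simp: matrix_transpose_mul)
  also have "\<dots> = (\<integral>\<^sup>+ A. f (transpose A) \<partial>row_measure)"
    by (rule row_measure_mult_left[OF G, where f="\<lambda>A. f (transpose A)"]) measurable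
  also have "\<dots> = (\<integral>\<^sup>+ A. f A \<partial>row_measure)"
    by (subst (2) row_measure_transpose[symmetric], subst nn_integral_distr) auto
  finally show ?thesis .
qed

text \<open>For P projecting onto a k-dimensional E, this is the Gaussian mass of those Z for which
  the rows of \<open>Z ** P\<close> span E; it serves as a normalising constant. The rank is
  expressed by a trace so that the integrand is Borel in P and Z jointly.\<close>

definition full_rank_mass :: "real ^ 'n ^ 'n \<Rightarrow> ennreal" where
  "full_rank_mass P = (\<integral>\<^sup>+ Z. indicator {0} (trace (proj_range (P ** transpose Z)) - real k) * gauss (Z :: real ^ 'n ^ 'n) \<partial>lborel)"

lemma measurable_full_rank_mass[measurable]: "full_rank_mass \<in> borel_measurable borel"
  unfolding full_rank_mass_def by measurable

text \<open>Positive because every invertible Z qualifies and the invertible matrices form a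
  nonempty open set; finite because the Gaussian has mass 1.\<close>

lemma full_rank_mass_bounds:
  assumes E: "E \<in> space \<mu>"
  shows "full_rank_mass (proj_mat E) \<noteq> 0" "full_rank_mass (proj_mat E) \<noteq> \<infinity>"
proof -
  let ?f = "\<lambda>Z :: real ^ 'n ^ 'n. indicator {0} (trace (proj_range (proj_mat E ** transpose Z)) - real k) * gauss Z"
  note sub = subspace_mu[OF E]
  have [measurable]: "?f \<in> borel_measurable lborel" by measurable
  have op: "open {Z :: real ^ 'n ^ 'n. det Z \<noteq> 0}"
    unfolding det_def by (intro open_Collect_neq continuous_intros)
  show "full_rank_mass (proj_mat E) \<noteq> 0"
  proof
    assume "full_rank_mass (proj_mat E) = 0"
    then have "AE Z in lborel. ?f Z = 0"
      unfolding full_rank_mass_def by (subst (asm) nn_integral_0_iff_AE) auto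
    moreover have "?f Z \<noteq> 0" if "det Z \<noteq> 0" for Z
    proof -
      have "invertible (transpose Z)" using that by (simp add: invertible_det_nz)
      then have "surj ((*v) (transpose Z))" by (metis invertible_right_inverse matrix_right_invertible_surjective)
      then have "range ((*v) (proj_mat E ** transpose Z)) = E"
        using proj_mat_range[OF sub]
        by (metis (no_types, lifting) image_cong image_image matrix_vector_mul_assoc)
      then have "proj_range (proj_mat E ** transpose Z) = proj_mat E" by (simp add: proj_range_def)
      then show ?thesis by (simp add: trace_proj_mat[OF sub] dim_mu[OF E] gauss_pos)
    qed
    ultimately have "AE Z in lborel. Z \<notin> {Z :: real ^ 'n ^ 'n. det Z \<noteq> 0}" by (auto elim: eventually_mono)
    then have "emeasure lborel {Z :: real ^ 'n ^ 'n. det Z \<noteq> 0} = 0"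
      using op by (subst (asm) AE_iff_measurable[of "{Z. det Z \<noteq> 0}"]) auto
    moreover have "0 < emeasure lborel {Z :: real ^ 'n ^ 'n. det Z \<noteq> 0}"
      by (rule emeasure_lborel_open_pos[OF op, of "mat 1"]) simp
    ultimately show False by simp
  qed
  have "full_rank_mass (proj_mat E) \<le> (\<integral>\<^sup>+ Z. gauss (Z :: real ^ 'n ^ 'n) \<partial>lborel)"
    unfolding full_rank_mass_def by (intro nn_integral_mono) (auto simp: indicator_def)
  then show "full_rank_mass (proj_mat E) \<noteq> \<infinity>" by (auto simp: nn_integral_gauss top_unique)
qed

lemma range_proj_mult:
  fixes Z :: "real ^ 'n ^ 'n"
  assumes E: "E \<in> space \<mu>" and tr: "trace (proj_range (proj_mat E ** transpose Z)) = real k"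
  shows "proj_range (proj_mat E ** transpose Z) = proj_mat E"
proof -
  let ?R = "range ((*v) (proj_mat E ** transpose Z))"
  note sub = subspace_mu[OF E]
  have "?R \<subseteq> range ((*v) (proj_mat E))" by (auto simp: matrix_vector_mul_assoc[symmetric])
  then have le: "?R \<subseteq> E" by (simp add: proj_mat_range[OF sub])
  have "real (dim ?R) = real k"
    using tr trace_proj_mat[OF subspace_range_matrix] unfolding proj_range_def by metis
  then have "dim ?R = dim E" by (simp add: dim_mu[OF E])
  then have "?R = E" using subspace_dim_equal[OF subspace_range_matrix sub le] by simp
  then show ?thesis by (simp add: proj_range_def)
qed

text \<open>The function \<psi> is lifted to a function on matrices whose integral over the fibre at
  E is \<open>\<psi> (proj_mat E)\<close>. Right multiplication by
  \<open>transpose (matrix L)\<close> produces the Jacobian factor and the image of E in each fibre,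
  while leaving the total integral unchanged.\<close>

theorem nn_integral_linear_image:
  assumes lin: "linear L" and inj: "inj L" and vol: "distr lborel borel L = lborel"
    and \<psi>[measurable]: "\<psi> \<in> borel_measurable borel"
  shows "(\<integral>\<^sup>+ E. inv_jac L E ^ CARD('n) * \<psi> (proj_mat (L ` E)) \<partial>\<mu>) = (\<integral>\<^sup>+ E. \<psi> (proj_mat E) \<partial>\<mu>)"
proof -
  \<comment> \<open>The range of \<open>transpose A\<close> is the row space of A. Where it has
    dimension k, f evaluates \<psi> there; the Gaussian restricted to these A and divided by
    \<open>full_rank_mass\<close> has total mass 1 on each fibre.\<close>
  define f where "f A = indicator {0} (trace (proj_range (transpose A)) - real k) *
    (\<psi> (proj_range (transpose A)) * gauss A / full_rank_mass (proj_range (transpose A)))" for A :: "real ^ 'n ^ 'n"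
  have f[measurable]: "f \<in> borel_measurable borel" unfolding f_def by measurable
  have fibre: "fibre_integral f E = \<psi> (proj_mat E)" if E: "E \<in> space \<mu>" for E
  proof -
    note sub = subspace_mu[OF E]
    let ?c = "\<psi> (proj_mat E) / full_rank_mass (proj_mat E)"
    \<comment> \<open>On the fibre over E a matrix of rank k has row space exactly E, so \<psi> and
      the normalisation are constant there.\<close>
    have "f (Z ** proj_mat E) * gauss (Z - Z ** proj_mat E) =
        ?c * (indicator {0} (trace (proj_range (proj_mat E ** transpose Z)) - real k) * gauss Z)" for Z
    proof (cases "trace (proj_range (proj_mat E ** transpose Z)) = real k")
      case True
      then show ?thesis
        unfolding f_def matrix_transpose_mul transpose_proj_mat[OF sub] range_proj_mult[OF E True]
          gauss_proj_mult[OF sub, of Z, symmetric]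
        by (simp add: divide_ennreal_def trace_proj_mat[OF sub] dim_mu[OF E] mult_ac)
    next
      case False
      then show ?thesis
        by (simp add: f_def matrix_transpose_mul transpose_proj_mat[OF sub])
    qed
    then have "fibre_integral f E = ?c * full_rank_mass (proj_mat E)"
      unfolding fibre_integral_def full_rank_mass_def by (simp add: nn_integral_cmult)
    also have "\<dots> = \<psi> (proj_mat E)"
      using full_rank_mass_bounds[OF E] by (simp add: ennreal_divide_times ennreal_divide_self less_top)
    finally show ?thesis .
  qed
  have mL: "(*v) (matrix L) = L" using lin by (simp add: fun_eq_iff matrix_works linear_matrix_vector_mul_eq)
  have bij: "bij L" using lin inj linear_injective_imp_surjective by (auto simp: bij_def)
  have "(\<integral>\<^sup>+ E. inv_jac L E ^ CARD('n) * \<psi> (proj_mat (L ` E)) \<partial>\<mu>)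
    = (\<integral>\<^sup>+ E. fibre_integral (\<lambda>A. f (A ** transpose (matrix L))) E \<partial>\<mu>)"
  proof (intro nn_integral_cong)
    fix E assume E: "E \<in> space \<mu>"
    then have "L ` E \<in> space \<mu>" using linear_image_grassmannian lin inj by (simp add: space_mu)
    then show "inv_jac L E ^ CARD('n) * \<psi> (proj_mat (L ` E)) = fibre_integral (\<lambda>A. f (A ** transpose (matrix L))) E"
      using nn_integral_right_mult_proj[OF subspace_mu[OF E] lin inj f] fibre
      by (simp add: fibre_integral_def)
  qed
  also have "\<dots> = (\<integral>\<^sup>+ A. f (A ** transpose (matrix L)) \<partial>row_measure)"
    by (rule nn_integral_row_measure[symmetric]) measurable
  also have "\<dots> = (\<integral>\<^sup>+ A. f A \<partial>row_measure)"
    by (rule row_measure_mult_right_transpose) (simp_all add: mL vol bij)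
  also have "\<dots> = (\<integral>\<^sup>+ E. \<psi> (proj_mat E) \<partial>\<mu>)"
    by (subst nn_integral_row_measure) (auto intro!: nn_integral_cong simp: fibre)
  finally show ?thesis .
qed

end

section \<open>The measure on the affine Grassmannian\<close>

lemma translate_subspace_eq:
  assumes "subspace E" "v \<in> E"
  shows "(\<lambda>y. z + v + y) ` E = (\<lambda>y. z + y) ` E"
proof -
  have "(\<lambda>y. v + y) ` E = E"
  proof (intro equalityI subsetI)
    fix x assume "x \<in> E"
    then have "x = v + (x - v)" "x - v \<in> E" using assms by (auto intro: subspace_diff)
    then show "x \<in> (\<lambda>y. v + y) ` E" by blast
  qed (use assms in \<open>auto intro: subspace_add\<close>)
  then have "(\<lambda>y. z + y) ` E = (\<lambda>y. z + y) ` ((\<lambda>y. v + y) ` E)" by simp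
  then show ?thesis by (simp add: image_image add.assoc)
qed

lemma affine_image_translate:
  assumes "linear L"
  shows "(\<lambda>x. L x + b) ` ((\<lambda>y. z + y) ` E) = (\<lambda>y. L z + b + y) ` (L ` E)"
  by (auto simp: image_image linear_add[OF assms] algebra_simps)

definition flat_code :: "(real ^ 'n) set \<Rightarrow> (real ^ 'n ^ 'n) \<times> (real ^ 'n)" where
  "flat_code F = (proj_mat (direction F), closest_point F 0)"

lemma flat_code_translate:
  "subspace E \<Longrightarrow> flat_code ((\<lambda>y. z + y) ` E) = (proj_mat E, z - proj_mat E *v z)"
  by (simp add: flat_code_def direction_translate closest_point_translate_0 proj_mat_mult)

lemma space_affine_grassmannian_borel: "space (affine_grassmannian_borel k) = affine_grassmannian k"
  by (simp add: affine_grassmannian_borel_def)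

lemma affine_grassmannian_borel_flat_code:
  "affine_grassmannian_borel k = vimage_algebra (affine_grassmannian k) flat_code borel"
  by (simp add: affine_grassmannian_borel_def flat_code_def[abs_def])

lemma measurable_flat_code[measurable]: "flat_code \<in> borel_measurable (affine_grassmannian_borel k)"
  unfolding affine_grassmannian_borel_flat_code by (intro measurable_vimage_algebra1) auto

lemma sets_affine_grassmannian_borel:
  assumes "A \<in> sets (affine_grassmannian_borel k)"
  obtains B where "B \<in> sets borel" "A = flat_code -` B \<inter> affine_grassmannian k"
  using assms unfolding affine_grassmannian_borel_flat_code by (auto simp: sets_vimage_algebra2)

lemma affine_grassmannianE:
  assumes "F \<in> affine_grassmannian k"
  obtains z E where "F = (\<lambda>y. z + y) ` E" "subspace E" "dim E = k" "E \<in> grassmannian k"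
  using assms unfolding affine_grassmannian_eq by (auto simp: grassmannian_def)

lemma affine_image_affine_grassmannian:
  fixes L :: "'a::euclidean_space \<Rightarrow> 'a"
  assumes F: "F \<in> affine_grassmannian k" and lin: "linear L" and inj: "inj L"
  shows "(\<lambda>x. L x + b) ` F \<in> affine_grassmannian k"
proof -
  obtain z E where F: "F = (\<lambda>y. z + y) ` E" and E: "subspace E" "dim E = k"
    using affine_grassmannianE[OF F] by metis
  have "L ` E \<in> grassmannian k"
    using E lin inj by (auto simp: grassmannian_def linear_subspace_image intro: dim_image_eq[THEN trans] inj_on_subset)
  then show ?thesis
    unfolding F affine_image_translate[OF lin] affine_grassmannian_eq by blast
qed

lemma measurable_affine_image:
  fixes L :: "real ^ 'n \<Rightarrow> real ^ 'n"
  assumes lin: "linear L" and inj: "inj L"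
  shows "(\<lambda>F. (\<lambda>x. L x + b) ` F) \<in> measurable (affine_grassmannian_borel k) (affine_grassmannian_borel k)"
  unfolding affine_grassmannian_borel_flat_code
proof (rule measurable_vimage_algebra_map)
  fix F assume "F \<in> space (vimage_algebra (affine_grassmannian k) flat_code (borel :: (_ \<times> (real ^ 'n)) measure))"
  then show "(\<lambda>x. L x + b) ` F \<in> affine_grassmannian k"
    using affine_image_affine_grassmannian[OF _ lin inj] by auto
next
  \<comment> \<open>The action on codes: the base point of F orthogonal to its direction is mapped
    and its component along the new direction removed, while \<open>proj_range\<close> supplies the
    new projection matrix.\<close>
  define h where "h c = (let P = proj_range (matrix L ** fst c); w = L (snd c) + b in (P, w - P *v w))" for c
  have [measurable]: "L \<in> borel_measurable borel" by (rule linear_borel_measurable[OF lin])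
  have h[measurable]: "h \<in> borel_measurable borel"
    unfolding h_def Let_def borel_prod[symmetric] by measurable
  have "flat_code ((\<lambda>x. L x + b) ` F) = h (flat_code F)" if Fk: "F \<in> affine_grassmannian k" for F
  proof -
    obtain z E where F: "F = (\<lambda>y. z + y) ` E" and E: "subspace E"
      using affine_grassmannianE[OF Fk] by metis
    have "F = (\<lambda>y. (z - proj_mat E *v z) + y) ` E"
      unfolding F using translate_subspace_eq[OF E, of "- (proj_mat E *v z)" z]
      by (simp add: proj_mat_mult[OF E] subspace_neg[OF E] closest_point_subspace_in[OF E])
    then have "(\<lambda>x. L x + b) ` F = (\<lambda>y. L (z - proj_mat E *v z) + b + y) ` (L ` E)"
      using affine_image_translate[OF lin] by metis
    then show ?thesis
      using linear_subspace_image[OF lin E]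
      by (simp add: flat_code_translate F E h_def Let_def proj_mat_linear_image[OF E lin])
  qed
  then show "(\<lambda>F. flat_code ((\<lambda>x. L x + b) ` F)) \<in> borel_measurable (vimage_algebra (affine_grassmannian k) flat_code (borel :: (_ \<times> (real ^ 'n)) measure))"
    using measurable_compose[OF measurable_flat_code h, of k]
    by (subst measurable_cong[where g="\<lambda>F. h (flat_code F)"]) (auto simp: affine_grassmannian_borel_flat_code)
qed

context haar_grassmannian
begin

lemma sets_affine_measure: "sets (affine_grassmannian_measure k \<mu>) = sets (affine_grassmannian_borel k)"
  unfolding affine_grassmannian_measure_def
  by (subst sets_measure_of) (auto simp: space_affine_grassmannian_borel[symmetric] sets.sigma_sets_eq dest: sets.sets_into_space)

text \<open>Base points run over the whole space rather than over the complement of E, so that the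
  parameter space is a fixed product; the weight \<open>gauss (proj_mat E *v z)\<close> compensates
  for the redundant component in E.\<close>

definition spread :: "(real ^ 'n) set \<times> (real ^ 'n) \<Rightarrow> (real ^ 'n) set" where
  "spread = (\<lambda>(E, z). (\<lambda>y. z + y) ` E)"

lemma spread_affine_grassmannian: "E \<in> space \<mu> \<Longrightarrow> (\<lambda>y. z + y) ` E \<in> affine_grassmannian k"
  by (auto simp: affine_grassmannian_eq space_mu)

lemma measurable_spread[measurable]: "spread \<in> measurable (\<mu> \<Otimes>\<^sub>M lborel) (affine_grassmannian_borel k)"
  unfolding affine_grassmannian_borel_flat_code
proof (rule measurable_vimage_algebra_map)
  show "spread p \<in> affine_grassmannian k" if "p \<in> space (\<mu> \<Otimes>\<^sub>M lborel)" for p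
    using that by (auto simp: spread_def space_pair_measure spread_affine_grassmannian)
  have "(\<lambda>(E, z). (proj_mat E, z - proj_mat E *v z)) \<in> borel_measurable (\<mu> \<Otimes>\<^sub>M lborel)"
    unfolding borel_prod[symmetric] by measurable
  then show "(\<lambda>p. flat_code (spread p)) \<in> borel_measurable (\<mu> \<Otimes>\<^sub>M lborel)"
    by (subst measurable_cong[where g="\<lambda>(E, z). (proj_mat E, z - proj_mat E *v z)"])
      (auto simp: spread_def space_pair_measure flat_code_translate subspace_mu)
qed

lemma indicator_flat_code:
  assumes "A = flat_code -` B \<inter> affine_grassmannian k" "E \<in> space \<mu>"
  shows "indicator A ((\<lambda>y. z + y) ` E) = indicator B (proj_mat E, z - proj_mat E *v z)"
  using assms spread_affine_grassmannian[OF assms(2), of z]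
  by (simp add: indicator_def flat_code_translate subspace_mu)

text \<open>Applied to the complement of E, \<open>nn_integral_flat_lborel\<close> puts the Gaussian
  on the component in E. The flat through z depends on z only modulo E, so the projection disappears
  from the indicator.\<close>

lemma emeasure_flat_orthogonal_comp:
  assumes E: "E \<in> space \<mu>" and A: "A \<in> sets (affine_grassmannian_borel k)"
  shows "emeasure (flat_lborel (E\<^sup>\<bottom>)) {x \<in> E\<^sup>\<bottom>. (\<lambda>y. x + y) ` E \<in> A}
    = (\<integral>\<^sup>+ z. gauss (proj_mat E *v z) * indicator A ((\<lambda>y. z + y) ` E) \<partial>lborel)"
proof -
  note sub = subspace_mu[OF E]
  obtain B where B[measurable]: "B \<in> sets borel" and AB: "A = flat_code -` B \<inter> affine_grassmannian k"
    using sets_affine_grassmannian_borel[OF A] .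
  let ?S = "{x \<in> E\<^sup>\<bottom>. (\<lambda>y. x + y) ` E \<in> A}"
  have cp: "z - closest_point E z \<in> E\<^sup>\<bottom>" for z by (rule orthogonal_comp_closest_point[OF sub])
  have AB': "(\<lambda>y. x + y) ` E \<in> A \<longleftrightarrow> (proj_mat E, x - proj_mat E *v x) \<in> B" for x
    using spread_affine_grassmannian[OF E, of x] by (simp add: AB flat_code_translate sub)
  have S: "?S = {x \<in> space borel. x \<in> E\<^sup>\<bottom> \<and> (proj_mat E, x - proj_mat E *v x) \<in> B}"
    using AB' by auto
  have [measurable]: "E\<^sup>\<bottom> \<in> sets borel"
    by (intro borel_closed closed_subspace subspace_orthogonal_comp)
  have "B \<in> sets (borel \<Otimes>\<^sub>M borel)" using B by (simp only: borel_prod)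
  then have [measurable]: "?S \<in> sets borel" unfolding S by measurable
  have "emeasure (flat_lborel (E\<^sup>\<bottom>)) ?S = (\<integral>\<^sup>+ x. indicator ?S x \<partial>flat_lborel (E\<^sup>\<bottom>))" by simp
  also have "\<dots> = (\<integral>\<^sup>+ z. indicator ?S (z - closest_point E z) * gauss (closest_point E z) \<partial>lborel)"
    by (subst nn_integral_flat_lborel) (auto simp: subspace_orthogonal_comp closest_point_orthogonal_comp[OF sub])
  also have "\<dots> = (\<integral>\<^sup>+ z. gauss (proj_mat E *v z) * indicator A ((\<lambda>y. z + y) ` E) \<partial>lborel)"
  proof (intro nn_integral_cong)
    fix z
    have "(\<lambda>y. z - closest_point E z + y) ` E = (\<lambda>y. z + y) ` E"
      using translate_subspace_eq[OF sub, of "- closest_point E z" z]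
      by (simp add: subspace_neg[OF sub] closest_point_subspace_in[OF sub])
    then show "indicator ?S (z - closest_point E z) * gauss (closest_point E z) =
        gauss (proj_mat E *v z) * indicator A ((\<lambda>y. z + y) ` E)"
      using cp[of z] by (simp add: indicator_def proj_mat_mult[OF sub] mult.commute)
  qed
  finally show ?thesis .
qed

text \<open>A push-forward is countably additive, so the set function in the definition is a measure
  and \<open>measure_of\<close> does not default to the zero measure.\<close>

lemma affine_measure_eq:
  "affine_grassmannian_measure k \<mu> =
    distr (density (\<mu> \<Otimes>\<^sub>M lborel) (\<lambda>(E, z). gauss (proj_mat E *v z))) (affine_grassmannian_borel k) spread" (is "_ = ?N")
proof -
  have sN: "sets ?N = sets (affine_grassmannian_borel k)" and spN: "space ?N = affine_grassmannian k"
    by (simp_all add: space_affine_grassmannian_borel)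
  have em: "(\<integral>\<^sup>+ E. emeasure (flat_lborel (E\<^sup>\<bottom>)) {x \<in> E\<^sup>\<bottom>. (\<lambda>y. x + y) ` E \<in> A} \<partial>\<mu>) = emeasure ?N A"
    if A[measurable]: "A \<in> sets (affine_grassmannian_borel k)" for A
  proof -
    have "emeasure ?N A = (\<integral>\<^sup>+ p. (case p of (E, z) \<Rightarrow> gauss (proj_mat E *v z)) * indicator A (spread p) \<partial>(\<mu> \<Otimes>\<^sub>M lborel))"
      by (subst nn_integral_indicator[symmetric], simp, subst nn_integral_distr, measurable, subst nn_integral_density) measurable
    also have "\<dots> = (\<integral>\<^sup>+ E. (\<integral>\<^sup>+ z. gauss (proj_mat E *v z) * indicator A ((\<lambda>y. z + y) ` E) \<partial>lborel) \<partial>\<mu>)"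
      by (subst lborel.nn_integral_fst[symmetric]) (measurable, simp add: spread_def)
    also have "\<dots> = (\<integral>\<^sup>+ E. emeasure (flat_lborel (E\<^sup>\<bottom>)) {x \<in> E\<^sup>\<bottom>. (\<lambda>y. x + y) ` E \<in> A} \<partial>\<mu>)"
      by (intro nn_integral_cong) (simp add: emeasure_flat_orthogonal_comp A)
    finally show ?thesis by simp
  qed
  have "affine_grassmannian_measure k \<mu> = measure_of (space ?N) (sets ?N) (emeasure ?N)"
    unfolding affine_grassmannian_measure_def spN sN
    by (rule measure_of_eq)
      (auto simp: em space_affine_grassmannian_borel[symmetric] sets.sigma_sets_eq dest: sets.sets_into_space)
  then show ?thesis by (simp only: measure_of_of_measure)
qed

lemma nn_integral_affine_measure:
  assumes [measurable]: "u \<in> borel_measurable (affine_grassmannian_borel k)"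
  shows "(\<integral>\<^sup>+ F. u F \<partial>affine_grassmannian_measure k \<mu>)
    = (\<integral>\<^sup>+ E. (\<integral>\<^sup>+ z. gauss (proj_mat E *v z) * u ((\<lambda>y. z + y) ` E) \<partial>lborel) \<partial>\<mu>)"
proof -
  have "(\<integral>\<^sup>+ F. u F \<partial>affine_grassmannian_measure k \<mu>) =
      (\<integral>\<^sup>+ p. (case p of (E, z) \<Rightarrow> gauss (proj_mat E *v z)) * u (spread p) \<partial>(\<mu> \<Otimes>\<^sub>M lborel))"
    unfolding affine_measure_eq by (subst nn_integral_distr, measurable, subst nn_integral_density) measurable
  also have "\<dots> = (\<integral>\<^sup>+ E. (\<integral>\<^sup>+ z. gauss (proj_mat E *v z) * u ((\<lambda>y. z + y) ` E) \<partial>lborel) \<partial>\<mu>)"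
    by (subst lborel.nn_integral_fst[symmetric]) (measurable, simp add: spread_def)
  finally show ?thesis .
qed

lemma measurable_inv_jac_direction:
  fixes L :: "real ^ 'n \<Rightarrow> real ^ 'n"
  assumes lin: "linear L"
  shows "(\<lambda>F. inv_jac L (direction F)) \<in> borel_measurable (affine_grassmannian_borel k)"
proof -
  have [measurable]: "L \<in> borel_measurable borel" by (rule linear_borel_measurable[OF lin])
  have "(\<lambda>P :: real ^ 'n ^ 'n. \<integral>\<^sup>+ z. gauss (L (P *v z)) * gauss (z - P *v z) \<partial>lborel) \<in> borel_measurable borel"
    by measurable
  then have "(\<lambda>F. \<integral>\<^sup>+ z. gauss (L (fst (flat_code F) *v z)) * gauss (z - fst (flat_code F) *v z) \<partial>lborel)
      \<in> borel_measurable (affine_grassmannian_borel k)"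
    by (rule measurable_compose[rotated])
      (rule measurable_compose[OF measurable_flat_code], simp add: borel_measurable_continuous_onI continuous_on_fst)
  then show ?thesis
  proof (subst measurable_cong)
    fix F :: "(real ^ 'n) set" assume "F \<in> space (affine_grassmannian_borel k)"
    then obtain z E where "F = (\<lambda>y. z + y) ` E" "subspace E"
      by (metis affine_grassmannianE space_affine_grassmannian_borel)
    then show "inv_jac L (direction F) = (\<integral>\<^sup>+ z. gauss (L (fst (flat_code F) *v z)) * gauss (z - fst (flat_code F) *v z) \<partial>lborel)"
      by (simp add: inv_jac_def flat_code_def direction_translate proj_mat_mult)
  qed
qed

theorem distr_affine_measure:
  fixes L :: "real ^ 'n \<Rightarrow> real ^ 'n"
  assumes lin: "linear L" and inj: "inj L" and vol: "distr lborel borel L = lborel"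
  shows "distr (density (affine_grassmannian_measure k \<mu>) (\<lambda>F. inv_jac L (direction F) ^ (CARD('n) + 1)))
    (affine_grassmannian_borel k) (\<lambda>F. (\<lambda>x. L x + b) ` F) = affine_grassmannian_measure k \<mu>" (is "?D = ?N")
proof (rule measure_eqI)
  show "sets ?D = sets ?N" by (simp add: sets_affine_measure)
  fix A assume "A \<in> sets ?D"
  then have A[measurable]: "A \<in> sets (affine_grassmannian_borel k)" by simp
  let ?g = "\<lambda>F. (\<lambda>x. L x + b) ` F"
  note [measurable] = measurable_affine_image[OF lin inj, of b k] measurable_inv_jac_direction[OF lin]
  note [measurable_cong] = sets_affine_measure
  obtain B where B[measurable]: "B \<in> sets borel" and AB: "A = flat_code -` B \<inter> affine_grassmannian k"
    using sets_affine_grassmannian_borel[OF A] .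
  have B'[measurable]: "B \<in> sets (borel \<Otimes>\<^sub>M borel)" using B by (simp only: borel_prod)
  \<comment> \<open>The integral over base points, written as a function of the projection matrix
    alone so that \<open>nn_integral_linear_image\<close> applies.\<close>
  define \<psi> where "\<psi> P = (\<integral>\<^sup>+ y. indicator B (P, y - P *v y) * gauss (P *v y) \<partial>lborel)" for P
  have \<psi>[measurable]: "\<psi> \<in> borel_measurable borel" unfolding \<psi>_def by measurable
  have "emeasure ?D A = (\<integral>\<^sup>+ F. inv_jac L (direction F) ^ (CARD('n) + 1) * indicator A (?g F) \<partial>?N)"
    by (subst nn_integral_indicator[symmetric], simp, subst nn_integral_distr, measurable, subst nn_integral_density) measurable
  also have "\<dots> = (\<integral>\<^sup>+ E. (\<integral>\<^sup>+ z. gauss (proj_mat E *v z) *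
      (inv_jac L (direction ((\<lambda>y. z + y) ` E)) ^ (CARD('n) + 1) * indicator A (?g ((\<lambda>y. z + y) ` E))) \<partial>lborel) \<partial>\<mu>)"
    by (rule nn_integral_affine_measure) measurable
  also have "\<dots> = (\<integral>\<^sup>+ E. inv_jac L E ^ CARD('n) * \<psi> (proj_mat (L ` E)) \<partial>\<mu>)"
  proof (intro nn_integral_cong)
    fix E assume E: "E \<in> space \<mu>"
    note sub = subspace_mu[OF E]
    have E': "L ` E \<in> space \<mu>" using E lin inj by (simp add: space_mu linear_image_grassmannian)
    note sub' = subspace_mu[OF E']
    define u where "u y = (indicator A ((\<lambda>x. y + x) ` (L ` E)) :: ennreal)" for y
    have u: "u y = indicator B (proj_mat (L ` E), y - proj_mat (L ` E) *v y)" for y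
      unfolding u_def by (rule indicator_flat_code[OF AB E'])
    have um[measurable]: "u \<in> borel_measurable borel" unfolding u by measurable
    have uinv: "u (y + v) = u y" if "v \<in> L ` E" for y v
      unfolding u_def using translate_subspace_eq[OF sub' that] by simp
    have [measurable]: "L \<in> borel_measurable borel" "closest_point E \<in> borel_measurable borel"
      by (auto intro!: linear_borel_measurable lin closest_point_subspace_measurable sub)
    have "(\<integral>\<^sup>+ z. gauss (proj_mat E *v z) *
      (inv_jac L (direction ((\<lambda>y. z + y) ` E)) ^ (CARD('n) + 1) * indicator A (?g ((\<lambda>y. z + y) ` E))) \<partial>lborel)
      = (\<integral>\<^sup>+ z. inv_jac L E ^ (CARD('n) + 1) * (u (L z + b) * gauss (closest_point E z)) \<partial>lborel)"
      unfolding u_def affine_image_translate[OF lin] direction_translate[OF sub] proj_mat_mult[OF sub]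
      by (simp add: mult_ac)
    \<comment> \<open>One of the CARD('n) + 1 factors is split off for the change of variables
      between complements; the others are left for the Grassmannian.\<close>
    also have "\<dots> = inv_jac L E ^ CARD('n) * (inv_jac L E * (\<integral>\<^sup>+ z. u (L z + b) * gauss (closest_point E z) \<partial>lborel))"
      by (subst nn_integral_cmult) (auto simp: mult_ac)
    also have "inv_jac L E * (\<integral>\<^sup>+ z. u (L z + b) * gauss (closest_point E z) \<partial>lborel) = \<psi> (proj_mat (L ` E))"
      unfolding \<psi>_def u[symmetric] unfolding proj_mat_mult[OF sub']
      by (rule nn_integral_coset_function[OF sub lin inj vol um uinv])
    finally show "(\<integral>\<^sup>+ z. gauss (proj_mat E *v z) *
      (inv_jac L (direction ((\<lambda>y. z + y) ` E)) ^ (CARD('n) + 1) * indicator A (?g ((\<lambda>y. z + y) ` E))) \<partial>lborel)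
      = inv_jac L E ^ CARD('n) * \<psi> (proj_mat (L ` E))" .
  qed
  also have "\<dots> = (\<integral>\<^sup>+ E. \<psi> (proj_mat E) \<partial>\<mu>)"
    by (rule nn_integral_linear_image[OF lin inj vol \<psi>])
  also have "\<dots> = (\<integral>\<^sup>+ E. (\<integral>\<^sup>+ z. gauss (proj_mat E *v z) * indicator A ((\<lambda>y. z + y) ` E) \<partial>lborel) \<partial>\<mu>)"
    unfolding \<psi>_def by (intro nn_integral_cong) (simp add: indicator_flat_code[OF AB] mult.commute)
  also have "\<dots> = (\<integral>\<^sup>+ F. indicator A F \<partial>?N)"
    by (rule nn_integral_affine_measure[symmetric]) measurable
  also have "\<dots> = emeasure ?N A" by (simp add: sets_affine_measure)
  finally show "emeasure ?D A = emeasure ?N A" .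
qed

end

section \<open>Norms on flats under affine maps and the final change of variables\<close>

lemma ennpowr_cmult:
  assumes d: "0 < d"
  shows "ennpowr (ennreal d * x) a = ennreal (d powr a) * ennpowr x a"
\<comment> \<open>A finite positive factor fixes 0 and infinity, and for a = 0 both sides are 1, so
  the default values are respected.\<close>
proof (cases x)
  case (real r)
  show ?thesis
  proof (cases "r = 0")
    case True
    then show ?thesis using d real by (simp add: ennpowr_def ennreal_mult_top)
  next
    case False
    then have r: "0 < r" using real by simp
    have "enn2real (ennreal d * ennreal r) = d * r"
      using d r by (simp add: ennreal_mult'[symmetric])
    then show ?thesis
      using d r real by (simp add: ennpowr_def powr_mult ennreal_mult'[symmetric] ennreal_mult_eq_top_iff)
  qed
next
  case top
  then show ?thesis using d by (simp add: ennpowr_def ennreal_mult_top)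
qed

lemma volume_preserving_affineE:
  fixes g :: "'a::euclidean_space \<Rightarrow> 'a"
  assumes "volume_preserving_affine g"
  obtains L b where "linear L" "inj L" "g = (\<lambda>x. L x + b)" "distr lborel borel L = lborel"
proof -
  obtain L b where lin: "linear L" and g: "g = (\<lambda>x. L x + b)" and bij: "bij g"
    and vol: "\<And>A. A \<in> sets lebesgue \<Longrightarrow> emeasure lebesgue (g ` A) = emeasure lebesgue A"
    using assms unfolding volume_preserving_affine_def by blast
  have inj: "inj L" using bij_is_inj[OF bij] by (simp add: inj_def g)
  have surj: "surj L" using lin inj linear_injective_imp_surjective by auto
  have [measurable]: "L \<in> borel_measurable borel" by (rule linear_borel_measurable[OF lin])
  have "distr lborel borel L = lborel"
  proof (rule measure_eqI)
    fix A assume "A \<in> sets (distr lborel borel L)"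
    then have [measurable]: "A \<in> sets borel" by simp
    have [measurable]: "L -` A \<in> sets borel" using measurable_sets[OF \<open>L \<in> borel_measurable borel\<close>, of A] by simp
    \<comment> \<open>Volume preservation concerns images under g; applied to the preimage of A
      under L it yields A translated by b, and translation invariance removes b.\<close>
    have gA: "g ` (L -` A) = (+) b ` A"
    proof (intro equalityI subsetI)
      fix x assume "x \<in> (+) b ` A"
      then obtain y where "x = b + L y" "L y \<in> A" using surj by (metis imageE surjD)
      then show "x \<in> g ` (L -` A)" by (auto simp: g add.commute)
    qed (auto simp: g add.commute)
    have inv: "(+) b ` A = (+) (- b) -` A" by force
    have [measurable]: "(+) (- b) -` A \<in> sets borel"
      using measurable_sets[of "(+) (- b)" borel borel A] by simp
    have "emeasure (distr lborel borel L) A = emeasure lebesgue (g ` (L -` A))"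
      by (subst emeasure_distr) (auto simp: vol)
    also have "\<dots> = emeasure lborel ((+) (- b) -` A)" unfolding gA inv by simp
    also have "\<dots> = emeasure (distr lborel borel ((+) (- b))) A" by (subst emeasure_distr) auto
    finally show "emeasure (distr lborel borel L) A = emeasure lborel A" by (simp only: lborel_distr_plus)
  qed simp
  then show ?thesis using that lin inj g by blast
qed

text \<open>The rules for lower integrals apply because g has a measurable inverse and the density
  is a finite positive constant; the outer power then turns d into \<open>d powr (1 / q)\<close>,
  whatever the sign of q.\<close>

lemma p_norm_affine_image:
  fixes g :: "'a::euclidean_space \<Rightarrow> 'a"
  assumes lin: "linear L" and inj: "inj L" and g: "g = (\<lambda>x. L x + b)"
    and F: "F \<in> affine_grassmannian k" and d: "inv_jac L (direction F) = ennreal d" "0 < d"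
  shows "p_norm (flat_lborel F) q f = ennreal (d powr (1 / q)) * p_norm (flat_lborel (g ` F)) q (\<lambda>t. f (inv g t))"
proof -
  obtain z E where zE: "F = (\<lambda>y. z + y) ` E" and E: "subspace E"
    using affine_grassmannianE[OF F] by metis
  have dir: "direction F = E" unfolding zE by (rule direction_translate[OF E])
  have bijL: "bij L" using lin inj linear_injective_imp_surjective by (auto simp: bij_def)
  have bij: "bij g"
  proof -
    have "g = (\<lambda>x. x + b) \<circ> L" by (auto simp: g)
    then show ?thesis using bijL by (simp add: bij_comp bij_plus_right)
  qed
  have linL': "linear (inv L)" using lin inj by (rule inj_linear_imp_inv_linear)
  have inv_g: "inv g t = inv L (t - b)" for t
  proof (rule inv_f_eq[OF bij_is_inj[OF bij]])
    show "g (inv L (t - b)) = t" using bijL by (simp add: g bij_is_surj surj_f_inv_f)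
  qed
  have [measurable]: "L \<in> borel_measurable borel" "inv L \<in> borel_measurable borel"
    by (auto intro!: linear_borel_measurable lin linL')
  have [measurable]: "g \<in> borel_measurable (flat_lborel F)" unfolding g by measurable
  have [measurable]: "inv g \<in> measurable borel (flat_lborel F)" unfolding inv_g[abs_def] by measurable
  let ?h = "\<lambda>t. ennpowr (ennreal \<bar>f t\<bar>) q"
  have "(\<integral>\<^sup>+ t. ?h t \<partial>flat_lborel F) = (\<integral>\<^sup>+ t. ?h (inv g (g t)) \<partial>flat_lborel F)"
    using bij_is_inj[OF bij] by simp
  also have "\<dots> = (\<integral>\<^sup>+ t. ?h (inv g t) \<partial>distr (flat_lborel F) borel g)"
    using bij by (intro nn_integral_distr_bij[where S="inv g", symmetric])
      (auto simp: bij_is_inj bij_is_surj surj_f_inv_f)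
  also have "distr (flat_lborel F) borel g = density (flat_lborel (g ` F)) (\<lambda>_. ennreal d)"
    using distr_flat_lborel_affine[OF E lin inj, of z b] d(1) unfolding dir by (simp add: zE g)
  also have "(\<integral>\<^sup>+ t. ?h (inv g t) \<partial>density (flat_lborel (g ` F)) (\<lambda>_. ennreal d)) =
      (\<integral>\<^sup>+ t. ennreal d * ?h (inv g t) \<partial>flat_lborel (g ` F))"
    using d(2) by (intro nn_integral_density_pos) auto
  also have "\<dots> = ennreal d * (\<integral>\<^sup>+ t. ?h (inv g t) \<partial>flat_lborel (g ` F))"
    by (rule nn_integral_cmult_pos[OF d(2)])
  finally show ?thesis by (simp add: p_norm_def ennpowr_cmult[OF d(2)])
qed

theorem theorem3p6:
  fixes k m :: nat
    and \<mu> :: "(real ^ 'n) set measure"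
    and p \<alpha> :: "nat \<Rightarrow> real"
    and f :: "nat \<Rightarrow> real ^ 'n \<Rightarrow> real"
    and g :: "real ^ 'n \<Rightarrow> real ^ 'n"
  assumes "1 \<le> k" and "k \<le> CARD('n) - 1"
    and "grassmannian_haar k \<mu>"
    and "1 \<le> m"
    and "\<And>i. i \<in> {1..m} \<Longrightarrow> p i \<noteq> 0"
    and "\<And>i. i \<in> {1..m} \<Longrightarrow> bounded (range (f i))"
    and "\<And>i. i \<in> {1..m} \<Longrightarrow> in_Lp (p i) (f i)"
    and "I_tilde k \<mu> m p \<alpha> f < \<infinity>"
    and "(\<Sum>i\<in>{1..m}. \<alpha> i / p i) = real CARD('n) + 1"
    and "volume_preserving_affine g"
  shows "I_tilde k \<mu> m p \<alpha> (\<lambda>i t. f i (inv g t)) = I_tilde k \<mu> m p \<alpha> f"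
proof -
  interpret haar_grassmannian k \<mu> by standard fact
  obtain L b where lin: "linear L" and inj: "inj L" and g: "g = (\<lambda>x. L x + b)"
    and vol: "distr lborel borel L = lborel"
    using volume_preserving_affineE[OF assms(10)] .
  let ?N = "affine_grassmannian_measure k \<mu>" and ?A = "affine_grassmannian_borel k :: (real ^ 'n) set measure"
  let ?J = "\<lambda>F. inv_jac L (direction F) ^ (CARD('n) + 1)"
  define \<Phi> where "\<Phi> F = (\<Prod>i\<in>{1..m}. ennpowr (p_norm (flat_lborel F) (p i) (f i)) (\<alpha> i))" for F
  define \<Phi>' where "\<Phi>' F = (\<Prod>i\<in>{1..m}. ennpowr (p_norm (flat_lborel F) (p i) (\<lambda>t. f i (inv g t))) (\<alpha> i))" for F
  have spN: "space ?N = affine_grassmannian k"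
    using sets_eq_imp_space_eq[OF sets_affine_measure] by (simp add: space_affine_grassmannian_borel)
  have jac: "\<exists>d. inv_jac L (direction F) = ennreal d \<and> 0 < d" if F: "F \<in> affine_grassmannian k" for F
  proof -
    obtain z E where zE: "F = (\<lambda>y. z + y) ` E" and E: "subspace E"
      using affine_grassmannianE[OF F] by metis
    have "direction F = E" unfolding zE by (rule direction_translate[OF E])
    then show ?thesis
      using inv_jac_pos_fin[OF E lin inj] by (cases "inv_jac L E") (auto simp: less_le)
  qed
  have point: "?J F * \<Phi>' (g ` F) = \<Phi> F" if F: "F \<in> affine_grassmannian k" for F
  proof -
    obtain d where d: "inv_jac L (direction F) = ennreal d" "0 < d" using jac[OF F] by blast
    have "\<Phi> F = (\<Prod>i\<in>{1..m}. ennreal (d powr (\<alpha> i / p i)) * ennpowr (p_norm (flat_lborel (g ` F)) (p i) (\<lambda>t. f i (inv g t))) (\<alpha> i))"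
      unfolding \<Phi>_def p_norm_affine_image[OF lin inj g F d]
      using d(2) by (intro prod.cong refl) (simp add: ennpowr_cmult powr_powr)
    also have "\<dots> = (\<Prod>i\<in>{1..m}. ennreal (d powr (\<alpha> i / p i))) * \<Phi>' (g ` F)"
      by (simp add: prod.distrib \<Phi>'_def)
    also have "(\<Prod>i\<in>{1..m}. ennreal (d powr (\<alpha> i / p i))) = ennreal (d powr (\<Sum>i\<in>{1..m}. \<alpha> i / p i))"
      using d(2) by (simp add: prod_ennreal powr_sum)
    \<comment> \<open>Here the condition on the sum of \<open>\<alpha> i / p i\<close> enters: it
      makes the exponent CARD('n) + 1, exactly the weight in
      \<open>distr_affine_measure\<close>.\<close>
    also have "\<dots> = ?J F"
      unfolding assms(9) d(1) using d(2)
      by (simp add: ennreal_power powr_add powr_realpow ennreal_mult' mult.commute)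
    finally show ?thesis by simp
  qed
  define L' where "L' = inv L"
  have linL': "linear L'" unfolding L'_def using lin inj by (rule inj_linear_imp_inv_linear)
  have L'L: "L' (L x) = x" and LL': "L (L' x) = x" for x
    using inj linear_injective_imp_surjective[OF lin inj refl] by (auto simp: L'_def surj_f_inv_f)
  have injL': "inj L'" by (metis LL' injI)
  have Tm[measurable]: "(\<lambda>F. g ` F) \<in> measurable ?A ?A" unfolding g by (rule measurable_affine_image[OF lin inj])
  \<comment> \<open>The inverse of g, acting measurably on flats, is what transports the possibly
    nonmeasurable integrand \<Phi>'.\<close>
  have Sm[measurable]: "(\<lambda>F. (\<lambda>x. L' x + - L' b) ` F) \<in> measurable ?A ?A" by (rule measurable_affine_image[OF linL' injL'])
  note [measurable_cong] = sets_affine_measure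
  note Jm[measurable] = measurable_inv_jac_direction[OF lin]
  have "I_tilde k \<mu> m p \<alpha> (\<lambda>i t. f i (inv g t)) = (\<integral>\<^sup>+ F. \<Phi>' F \<partial>?N)"
    by (simp add: I_tilde_def \<Phi>'_def)
  also have "\<dots> = (\<integral>\<^sup>+ F. \<Phi>' F \<partial>distr (density ?N ?J) ?A (\<lambda>F. g ` F))"
    unfolding g distr_affine_measure[OF lin inj vol] ..
  also have "\<dots> = (\<integral>\<^sup>+ F. \<Phi>' (g ` F) \<partial>density ?N ?J)"
    by (rule nn_integral_distr_bij[where S="\<lambda>F. (\<lambda>x. L' x + - L' b) ` F"], measurable)
      (auto simp: g image_image linear_add[OF linL'] linear_diff[OF lin] L'L LL')
  also have "\<dots> = (\<integral>\<^sup>+ F. ?J F * \<Phi>' (g ` F) \<partial>?N)"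
  proof (rule nn_integral_density_pos)
    show "?J \<in> borel_measurable ?N" by measurable
    fix F assume "F \<in> space ?N"
    then obtain d where d: "inv_jac L (direction F) = ennreal d" "0 < d" using jac[of F] by (auto simp: spN)
    then have "?J F = ennreal (d ^ (CARD('n) + 1))" by (simp only: ennreal_power less_imp_le)
    then show "?J F \<noteq> 0" "?J F \<noteq> \<infinity>" using d(2) by simp_all
  qed
  also have "\<dots> = (\<integral>\<^sup>+ F. \<Phi> F \<partial>?N)"
    by (intro nn_integral_cong point) (simp add: spN)
  also have "\<dots> = I_tilde k \<mu> m p \<alpha> f"
    by (simp add: I_tilde_def \<Phi>_def)
  finally show ?thesis .
qed

end
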